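(* Let $m\ge3$ and let $W=I_2(m)$ be the dihedral group of order $2m$. For any set $\mathcal S$ of irreducible characters of $I_2(m)$ with $\chi_0,\chi_1,\epsilon\in\mathcal S$, there is a (necessarily unique) maximal Springer correspondence for $I_2(m)$ whose set of Springer representations is $\mathcal S$ (uniqueness being understood for the underlying partition of $\mathrm{Irr}(W)$).
   Context: **Characters.** $W=I_2(m)$ acts on $V=\mathbb C^2$ by its (complexified) reflection representation. Its irreducible characters are: the trivial character $\chi_0$; the sign character $\epsilon=\det_V$; for $1\le i\le\lfloor (m-1)/2\rfloor$ the $2$-dimensional character $\chi_i$ in which the rotation by $2\pi/m$ has eigenvalues $e^{\pm 2\pi \sqrt{-1}\, i/m}$; and, if $m=2r$ is even, the two remaining $1$-dimensional characters $\chi_r,\chi_r'$ (those taking opposite signs on the two classes of reflections). **Fake degrees.** Let $q$ be an indeterminate. For a class function $f$ on $W$ set $$R(f)(q)=\frac{(q^2-1)(q^m-1)}{2m}\sum_{w\in W}\frac{\det_V(w)f(w)}{\det_V(q\cdot \mathrm{id}_V-w)}.$$ For $\chi\in\mathrm{Irr}(W)$, $R(\chi)$ is a polynomial (the fake degree), and $b_\chi$ is the exponent of the largest power of $q$ dividing it. One has $b_{\chi_i}=i$, $b_{\chi_r'}=r$, $b_\epsilon=m$. Let $\Omega=(\omega_{\chi,\chi'})_{\chi,\chi'\in\mathrm{Irr}(W)}$ with $\omega_{\chi,\chi'}=q^{m}R(\chi\otimes\chi'\otimes\epsilon)$. **Special characters and families** (with respect to the usual one-parameter Iwahori–Hecke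 algebra of $W$). The special characters are $\chi_0,\chi_1,\epsilon$. The families are $\{\chi_0\}$, $\{\epsilon\}$ and $\mathrm{Irr}(W)\setminus\{\chi_0,\epsilon\}$ (the last one containing $\chi_1$). **Lusztig–Shoji datum.** A triple $(X,<,a)$ where $X$ is a partition of $\mathrm{Irr}(W)$ into disjoint nonempty subsets $\mathcal C$, $<$ is a total order on $X$, and $a:X\to\mathbb N$, $\mathcal C\mapsto a_{\mathcal C}$, is a (weakly) order-reversing function. For $\chi\in\mathrm{Irr}(W)$, $\mathrm{supp}\,\chi=\mathrm{supp}_X\chi$ denotes the member of $X$ containing $\chi$. **System of Green functions** with respect to $(X,<,a)$: a solution of the matrix equation $P\Lambda P^t=\Omega$, where $P,\Lambda$ are square matrices indexed by $\mathrm{Irr}(W)$ with entries in $\mathbb Q(q)$ such that $P_{\chi,\chi'}=0$ if $\mathrm{supp}\,\chi<\mathrm{supp}\,\chi'$; $P_{\chi,\chi'}=\delta_{\chi,\chi'}q^{a_{\mathcal C}}$ if $\mathrm{supp}\,\chi=\mathrm{supp}\,\chi'=\mathcal C$; and $\Lambda_{\chi,\chi'}=0$ if $\mathrm{supp}\,\chi\ne\mathrm{supp}\,\chi'$. It is a known fact that every Lusztig–Shoji datum admits a unique system of Green functions. **Springer correspondence.** A Lusztig–Shoji datum $(X,<,a)$ is a Springer correspondence if, with $P,\Lambda$ its system of Green functions: (1) for each $\mathcal C\in X$, $a_{\mathcal C}=\min\{b_\chi\mid\chi\in\mathcal C\}$, and there is a unique member of $\mathcal C$ (called the Springer representation of $\mathcal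 C$) on which $b$ attains its minimum value; (2) every special character is the Springer representation of some $\mathcal C\in X$; (3) if $\chi'$ is a nonspecial character in the same family as the special character $\chi$, then $\mathrm{supp}\,\chi'\le\mathrm{supp}\,\chi$; (4) the entries of $\Lambda$ are polynomials in $q$ with integer coefficients, and the entries of $P$ are polynomials in $q$ with nonnegative integer coefficients; (5) if $\chi\in\mathcal C$, then $P_{\chi,\chi'}$ is divisible by $q^{a_{\mathcal C}}$ for all $\chi'$. The sets $\mathcal C\in X$ are then called unipotent classes. **Maximality.** Fix $\mathcal S$ and consider Springer correspondences whose set of Springer representations is $\mathcal S$. Unipotent classes in two such correspondences $X,X'$ are identified when they have the same Springer representation, so that for $\chi\in\mathrm{Irr}(W)$ the supports $\mathrm{supp}_X\chi$ and $\mathrm{supp}_{X'}\chi$ can be compared (using the order $<$ on classes). $X$ is called maximal if $\mathrm{supp}_X\chi\ge\mathrm{supp}_{X'}\chi$ for all $\chi\in\mathrm{Irr}(W)$ and all other Springer correspondences $X'$ with set of Springer representations $\mathcal S$. *)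

theory Defs
  imports
    "Jordan_Normal_Form.Char_Poly"
    "Jordan_Normal_Form.VS_Connect"
    "HOL-Library.Disjoint_Sets"
begin

section \<open>The dihedral group and its irreducible characters\<close>

definition rotation :: "nat \<Rightarrow> nat \<Rightarrow> complex mat" where
  "rotation m k = (let t = 2 * pi * real k / real m in
     mat_of_rows_list 2
       [[complex_of_real (cos t), - complex_of_real (sin t)],
        [complex_of_real (sin t), complex_of_real (cos t)]])"

text \<open>The reflection in the line that makes the angle \<open>pi * k / m\<close> with the first axis.\<close>

definition reflection :: "nat \<Rightarrow> nat \<Rightarrow> complex mat" where
  "reflection m k = (let t = 2 * pi * real k / real m in
     mat_of_rows_list 2
       [[complex_of_real (cos t), complex_of_real (sin t)],
        [complex_of_real (sin t), - complex_of_real (cos t)]])"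

text \<open>Elements of \<open>W = I_2(m)\<close> are identified with the matrices by which they act on the
  complexified reflection representation \<open>V\<close>; so \<open>det w\<close> below is the determinant of \<open>w\<close> on \<open>V\<close>.\<close>

definition dihedral_group :: "nat \<Rightarrow> complex mat monoid" where
  "dihedral_group m =
     \<lparr>carrier = rotation m ` {..<m} \<union> reflection m ` {..<m}, mult = (*), one = 1\<^sub>m 2\<rparr>"

definition mat_trace :: "'a :: comm_monoid_add mat \<Rightarrow> 'a" where
  "mat_trace A = (\<Sum>i<dim_row A. A $$ (i, i))"

definition representation :: "nat \<Rightarrow> nat \<Rightarrow> (complex mat \<Rightarrow> complex mat) \<Rightarrow> bool" where
  "representation m n \<rho> \<longleftrightarrow>
     \<rho> \<in> hom (dihedral_group m) (units_of (ring_mat TYPE(complex) n ()))"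

definition irreducible_representation ::
    "nat \<Rightarrow> nat \<Rightarrow> (complex mat \<Rightarrow> complex mat) \<Rightarrow> bool" where
  "irreducible_representation m n \<rho> \<longleftrightarrow>
     representation m n \<rho> \<and> n > 0 \<and>
     (\<forall>U. subspace class_ring U (module_vec TYPE(complex) n) \<and>
          (\<forall>w \<in> carrier (dihedral_group m). \<forall>u \<in> U. \<rho> w *\<^sub>v u \<in> U)
        \<longrightarrow> U = {0\<^sub>v n} \<or> U = carrier_vec n)"

text \<open>Characters are made extensional by restriction to the group, so that equality of characters
  is equality of functions.\<close>

definition Irr :: "nat \<Rightarrow> (complex mat \<Rightarrow> complex) set" where
  "Irr m = {\<lambda>w \<in> carrier (dihedral_group m). mat_trace (\<rho> w) | n \<rho>.
     irreducible_representation m n \<rho>}"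

definition trivial_char :: "nat \<Rightarrow> complex mat \<Rightarrow> complex" where
  "trivial_char m = (\<lambda>w \<in> carrier (dihedral_group m). 1)"

definition sign_char :: "nat \<Rightarrow> complex mat \<Rightarrow> complex" where
  "sign_char m = (\<lambda>w \<in> carrier (dihedral_group m). det w)"

text \<open>The character \<open>\<chi>\<^sub>1\<close>, in which the rotation by \<open>2 * pi / m\<close> has the eigenvalues
  \<open>exp (\<plusminus> 2 * pi * \<i> / m)\<close>, is the character of \<open>V\<close> itself.\<close>

definition reflection_char :: "nat \<Rightarrow> complex mat \<Rightarrow> complex" where
  "reflection_char m = (\<lambda>w \<in> carrier (dihedral_group m). mat_trace w)"


section \<open>Fake degrees\<close>

text \<open>Rational functions in \<open>q\<close> are elements of the type \<open>complex poly fract\<close>; the fields and rings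
  with smaller coefficients are subsets of it.\<close>

definition q :: "complex poly fract" where
  "q = to_fract [:0, 1:]"

definition rational_coeff_functions :: "complex poly fract set" where
  "rational_coeff_functions =
     {to_fract (map_poly of_rat f) / to_fract (map_poly of_rat g) | f g :: rat poly. g \<noteq> 0}"

definition integer_coeff_polys :: "complex poly fract set" where
  "integer_coeff_polys = range (\<lambda>f :: int poly. to_fract (map_poly of_int f))"

definition nonneg_integer_coeff_polys :: "complex poly fract set" where
  "nonneg_integer_coeff_polys = range (\<lambda>f :: nat poly. to_fract (map_poly of_nat f))"

definition divisible_by_q_power :: "nat \<Rightarrow> complex poly fract \<Rightarrow> bool" where
  "divisible_by_q_power k x \<longleftrightarrow> (\<exists>f :: complex poly. x = q ^ k * to_fract f)"

text \<open>The denominator \<open>det(q * id - w)\<close> is the characteristic polynomial of \<open>w\<close>.\<close>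

definition R :: "nat \<Rightarrow> (complex mat \<Rightarrow> complex) \<Rightarrow> complex poly fract" where
  "R m f = (q ^ 2 - 1) * (q ^ m - 1) / of_nat (2 * m) *
     (\<Sum>w \<in> carrier (dihedral_group m). to_fract [:det w * f w:] / to_fract (char_poly w))"

definition b :: "nat \<Rightarrow> (complex mat \<Rightarrow> complex) \<Rightarrow> nat" where
  "b m \<chi> = (GREATEST k. divisible_by_q_power k (R m \<chi>))"

definition Omega ::
    "nat \<Rightarrow> (complex mat \<Rightarrow> complex) \<Rightarrow> (complex mat \<Rightarrow> complex) \<Rightarrow> complex poly fract" where
  "Omega m \<chi> \<chi>' = q ^ m * R m (\<lambda>w. \<chi> w * \<chi>' w * sign_char m w)"


section \<open>Special characters and families\<close>

definition special_chars :: "nat \<Rightarrow> (complex mat \<Rightarrow> complex) set" where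
  "special_chars m = {trivial_char m, reflection_char m, sign_char m}"

definition families :: "nat \<Rightarrow> (complex mat \<Rightarrow> complex) set set" where
  "families m =
     {{trivial_char m}, {sign_char m}, Irr m - {trivial_char m, sign_char m}}"


section \<open>Lusztig--Shoji data and Green functions\<close>

text \<open>The strict total order of a datum is the relation \<open>lt\<close>. The weight \<open>a\<close> is a
  total function, of which only the values on \<open>X\<close> matter.\<close>

definition lusztig_shoji_datum ::
    "nat \<Rightarrow> (complex mat \<Rightarrow> complex) set set \<Rightarrow>
     (complex mat \<Rightarrow> complex) set rel \<Rightarrow> ((complex mat \<Rightarrow> complex) set \<Rightarrow> nat) \<Rightarrow> bool" where
  "lusztig_shoji_datum m X lt a \<longleftrightarrow>
     partition_on (Irr m) X \<and>
     lt \<subseteq> X \<times> X \<and> strict_linear_order_on X lt \<and>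
     (\<forall>C D. (C, D) \<in> lt \<longrightarrow> a D \<le> a C)"

definition supp :: "'c set set \<Rightarrow> 'c \<Rightarrow> 'c set" where
  "supp X \<chi> = (THE C. C \<in> X \<and> \<chi> \<in> C)"

definition green_functions ::
    "nat \<Rightarrow> (complex mat \<Rightarrow> complex) set set \<Rightarrow>
     (complex mat \<Rightarrow> complex) set rel \<Rightarrow> ((complex mat \<Rightarrow> complex) set \<Rightarrow> nat) \<Rightarrow>
     ((complex mat \<Rightarrow> complex) \<Rightarrow> (complex mat \<Rightarrow> complex) \<Rightarrow> complex poly fract) \<Rightarrow>
     ((complex mat \<Rightarrow> complex) \<Rightarrow> (complex mat \<Rightarrow> complex) \<Rightarrow> complex poly fract) \<Rightarrow> bool" where
  "green_functions m X lt a P \<Lambda> \<longleftrightarrow>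
     (\<forall>\<chi> \<in> Irr m. \<forall>\<chi>' \<in> Irr m.
        P \<chi> \<chi>' \<in> rational_coeff_functions \<and> \<Lambda> \<chi> \<chi>' \<in> rational_coeff_functions \<and>
        (\<Sum>\<psi> \<in> Irr m. \<Sum>\<psi>' \<in> Irr m. P \<chi> \<psi> * \<Lambda> \<psi> \<psi>' * P \<chi>' \<psi>') = Omega m \<chi> \<chi>' \<and>
        ((supp X \<chi>, supp X \<chi>') \<in> lt \<longrightarrow> P \<chi> \<chi>' = 0) \<and>
        (supp X \<chi> = supp X \<chi>' \<longrightarrow>
           P \<chi> \<chi>' = (if \<chi> = \<chi>' then q ^ a (supp X \<chi>) else 0)) \<and>
        (supp X \<chi> \<noteq> supp X \<chi>' \<longrightarrow> \<Lambda> \<chi> \<chi>' = 0))"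


section \<open>Springer correspondences\<close>

definition springer_rep ::
    "nat \<Rightarrow> (complex mat \<Rightarrow> complex) set \<Rightarrow> (complex mat \<Rightarrow> complex)" where
  "springer_rep m C = (THE \<chi>. \<chi> \<in> C \<and> b m \<chi> = Min (b m ` C))"

text \<open>Every Lusztig--Shoji datum has exactly one system of Green functions, so \<open>P\<close> and
  \<open>\<Lambda>\<close> can be introduced by an existential quantifier.\<close>

definition springer_correspondence ::
    "nat \<Rightarrow> (complex mat \<Rightarrow> complex) set set \<Rightarrow>
     (complex mat \<Rightarrow> complex) set rel \<Rightarrow> ((complex mat \<Rightarrow> complex) set \<Rightarrow> nat) \<Rightarrow> bool" where
  "springer_correspondence m X lt a \<longleftrightarrow>
     lusztig_shoji_datum m X lt a \<and>
     (\<forall>C \<in> X. a C = Min (b m ` C) \<and> (\<exists>!\<chi>. \<chi> \<in> C \<and> b m \<chi> = Min (b m ` C))) \<and>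
     special_chars m \<subseteq> springer_rep m ` X \<and>
     (\<forall>F \<in> families m. \<forall>\<chi> \<in> F \<inter> special_chars m. \<forall>\<chi>' \<in> F - special_chars m.
        supp X \<chi>' = supp X \<chi> \<or> (supp X \<chi>', supp X \<chi>) \<in> lt) \<and>
     (\<exists>P \<Lambda>. green_functions m X lt a P \<Lambda> \<and>
        (\<forall>\<chi> \<in> Irr m. \<forall>\<chi>' \<in> Irr m.
           \<Lambda> \<chi> \<chi>' \<in> integer_coeff_polys \<and> P \<chi> \<chi>' \<in> nonneg_integer_coeff_polys) \<and>
        (\<forall>C \<in> X. \<forall>\<chi> \<in> C. \<forall>\<chi>' \<in> Irr m. divisible_by_q_power (a C) (P \<chi> \<chi>')))"

definition springer_correspondence_with_reps ::
    "nat \<Rightarrow> (complex mat \<Rightarrow> complex) set \<Rightarrow> (complex mat \<Rightarrow> complex) set set \<Rightarrow>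
     (complex mat \<Rightarrow> complex) set rel \<Rightarrow> ((complex mat \<Rightarrow> complex) set \<Rightarrow> nat) \<Rightarrow> bool" where
  "springer_correspondence_with_reps m S X lt a \<longleftrightarrow>
     springer_correspondence m X lt a \<and> springer_rep m ` X = S"

text \<open>In the comparison of \<open>supp X \<chi>\<close> with \<open>supp X' \<chi>\<close>, the latter is replaced by
  the class \<open>C\<close> of \<open>X\<close> with the same Springer representation, and the order used is that
  of \<open>X\<close>.\<close>

definition maximal_springer_correspondence ::
    "nat \<Rightarrow> (complex mat \<Rightarrow> complex) set \<Rightarrow> (complex mat \<Rightarrow> complex) set set \<Rightarrow>
     (complex mat \<Rightarrow> complex) set rel \<Rightarrow> ((complex mat \<Rightarrow> complex) set \<Rightarrow> nat) \<Rightarrow> bool" where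
  "maximal_springer_correspondence m S X lt a \<longleftrightarrow>
     springer_correspondence_with_reps m S X lt a \<and>
     (\<forall>X' lt' a'. springer_correspondence_with_reps m S X' lt' a' \<longrightarrow>
        (\<forall>\<chi> \<in> Irr m. \<exists>C \<in> X. springer_rep m C = springer_rep m (supp X' \<chi>) \<and>
           (C = supp X \<chi> \<or> (C, supp X \<chi>) \<in> lt)))"

end

theory Submission
  imports Defs "Jordan_Normal_Form.Spectral_Radius"
begin

text \<open>
  Once the sign character is eliminated, the matrix \<open>Omega\<close> is essentially the covariance matrix of
  a random walk \<open>X\<^sub>0, X\<^sub>1, \<dots>\<close> indexed by the \<open>b\<close>-values, with \<open>X\<^sub>i - X\<^sub>i\<^sub>+\<^sub>1\<close> independent of
  \<open>X\<^sub>i\<^sub>+\<^sub>1, X\<^sub>i\<^sub>+\<^sub>2, \<dots>\<close>; for even \<open>m\<close> the last variable is the sum of two independent ones, one for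
  each character with \<open>b\<close>-value \<open>m / 2\<close>. Solving \<open>P \<Lambda> P\<^sup>t = \<Omega>\<close> is successive regression on the
  classes, from the lowest one upwards, and by the Markov property the regression coefficients only
  involve the neighbours of a character in a class. If \<open>i\<close> lies between neighbours \<open>l < i < u\<close> of a
  lower class, then the coefficient is \<open>(q ^ (2 * (u - i)) - 1) / (q ^ (2 * (u - l)) - 1)\<close> up to a power
  of \<open>q\<close>, which is not a polynomial. This forces each character into the class of the nearest Springer
  representation below it, except if exactly one of the two characters with \<open>b\<close>-value \<open>m / 2\<close> is in
  \<open>S\<close>: after conditioning on it, the coefficients at the upper end of a class become powers of \<open>q\<close>,
  and divisibility by \<open>q\<^sup>a\<close> is the only constraint. It is met by keeping just enough characters in
  the class of the last Springer representation before level \<open>m / 2\<close> and moving all higher ones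
  to the class of the reflection character, which is the highest position possible.
\<close>

section \<open>The dihedral group as a group of matrices\<close>

text \<open>Classes with the same Springer representation are identified and \<open>a\<close> is the
  b-value of that representation, so a character is placed higher the smaller \<open>a\<close> is on
  its class. The theorem thus splits into lower bounds for \<open>a\<close> in every correspondence
  and one correspondence that attains them all. The obstacle for the bounds is that the composition
  and the order of the classes are unknown, so \<open>P\<close> cannot be computed as a whole. A
  single column is accessible nevertheless: if a vector is supported on the classes up to a given
  one, and its image under \<open>Omega\<close> vanishes on these classes except at one character of
  the given class, then the image is proportional to the column of that character. With the tree
  kernel such vectors have only a few nonzero entries. The sign character can be eliminated because
  its weight \<open>m\<close> exceeds every other b-value, which puts its class at the bottom. In
  the exceptional case the bound arises from an interplay of both characters of level
  \<open>m / 2\<close>: the family condition gives the one outside \<open>S\<close> a weight of at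
  least 1, and this 1 reappears in the constant \<open>L\<close>.\<close>

lemma det_two: "A \<in> carrier_mat 2 2 \<Longrightarrow>
    det A = A $$ (0, 0) * A $$ (1, 1) - A $$ (0, 1) * A $$ (1, 0)" for A :: "'a :: comm_ring_1 mat"
  apply (subst laplace_expansion_column[of A 2 0])
  apply (simp_all add: cofactor_def numeral_2_eq_2 mat_delete_def)
  apply (subst det_single, simp)+
  apply simp
  done

text \<open>For \<open>norm z = 1\<close> this is a rotation if \<open>s = 1\<close> and a reflection if \<open>s = -1\<close>.\<close>

definition dih :: "complex \<Rightarrow> complex \<Rightarrow> complex mat" where
  "dih z s = mat_of_rows_list 2
     [[complex_of_real (Re z), - s * complex_of_real (Im z)],
      [complex_of_real (Im z), s * complex_of_real (Re z)]]"

lemma dih_carrier [simp]: "dih z s \<in> carrier_mat 2 2"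
  and dih_dim [simp]: "dim_row (dih z s) = 2" "dim_col (dih z s) = 2"
  by (auto simp: dih_def mat_of_rows_list_def)

lemma dih_index [simp]:
  "dih z s $$ (0, 0) = complex_of_real (Re z)"
  "dih z s $$ (0, Suc 0) = - s * complex_of_real (Im z)"
  "dih z s $$ (Suc 0, 0) = complex_of_real (Im z)"
  "dih z s $$ (Suc 0, Suc 0) = s * complex_of_real (Re z)"
  by (auto simp: dih_def mat_of_rows_list_def)

lemma less_two_cases: "(i::nat) < 2 \<Longrightarrow> i = 0 \<or> i = Suc 0"
  by auto

text \<open>Identify the real plane with the complex numbers: \<open>dih z 1\<close> is
  multiplication by \<open>z\<close>, and \<open>dih z (-1)\<close> is conjugation followed by
  multiplication by \<open>z\<close>. Hence the conjugate when a reflection stands on the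
  left.\<close>

lemma dih_mult:
  assumes "s = 1 \<or> s = -1"
  shows "dih z s * dih z' s' = dih (z * (if s = 1 then z' else cnj z')) (s * s')"
proof (rule eq_matI)
  fix i j
  assume "i < dim_row (dih (z * (if s = 1 then z' else cnj z')) (s * s'))"
    and "j < dim_col (dih (z * (if s = 1 then z' else cnj z')) (s * s'))"
  then have "i = 0 \<or> i = Suc 0" "j = 0 \<or> j = Suc 0"
    by auto
  then show "(dih z s * dih z' s') $$ (i, j)
      = dih (z * (if s = 1 then z' else cnj z')) (s * s') $$ (i, j)"
    using assms
    by (elim disjE; simp add: scalar_prod_def numeral_2_eq_2 algebra_simps)
qed auto

text \<open>The first column is the image of 1 when the plane is identified with the complex
  numbers. Together with \<open>det\<close> it recovers the parameters of a group element, so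
  characters can be written as functions of the matrix.\<close>

definition mat_arg :: "complex mat \<Rightarrow> complex" where
  "mat_arg w = w $$ (0, 0) + \<i> * w $$ (1, 0)"

lemma mat_arg_dih [simp]: "mat_arg (dih z s) = z"
  by (simp add: mat_arg_def complex_eq_iff)

lemma norm_root_of_unity: "z ^ m = 1 \<Longrightarrow> 0 < m \<Longrightarrow> norm z = 1" for z :: complex
  using power_eq_1_iff[of z m] by simp

lemma cnj_root_of_unity: "z ^ m = 1 \<Longrightarrow> 0 < m \<Longrightarrow> z * cnj z = 1" for z :: complex
  using norm_root_of_unity[of z m] complex_norm_square[of z] by simp

lemma det_dih [simp]: "norm z = 1 \<Longrightarrow> det (dih z s) = s"
proof -
  assume "norm z = 1"
  then have "(complex_of_real (Re z))\<^sup>2 + (complex_of_real (Im z))\<^sup>2 = 1"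
    by (metis cmod_power2 of_real_1 of_real_add of_real_power power_one)
  moreover have "det (dih z s) = s * ((complex_of_real (Re z))\<^sup>2 + (complex_of_real (Im z))\<^sup>2)"
    by (simp add: det_two[of "dih z s"] power2_eq_square algebra_simps)
  ultimately show ?thesis
    by simp
qed

lemma mat_trace_dih: "mat_trace (dih z s) = (1 + s) * complex_of_real (Re z)"
  by (simp add: mat_trace_def numeral_2_eq_2 algebra_simps)

lemma dih_eq_iff: "dih z s = dih z' s' \<longleftrightarrow> z = z' \<and> s = s'" if "norm z = 1" "norm z' = 1"
  using det_dih[OF that(1)] det_dih[OF that(2)] mat_arg_dih by metis

lemma carrier_dihedral_group:
  assumes "0 < m"
  shows "carrier (dihedral_group m) = {dih z s | z s. z ^ m = 1 \<and> (s = 1 \<or> s = -1)}"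
proof -
  have rot: "rotation m k = dih (cis (2 * pi * real k / real m)) 1" for k
    by (simp add: rotation_def dih_def Let_def)
  have ref: "reflection m k = dih (cis (2 * pi * real k / real m)) (-1)" for k
    by (simp add: reflection_def dih_def Let_def)
  have im: "(\<lambda>k. cis (2 * pi * real k / real m)) ` {..<m} = {z. z ^ m = 1}"
    using bij_betw_roots_unity[OF assms] by (simp add: bij_betw_def)
  have "carrier (dihedral_group m)
      = (\<lambda>z. dih z 1) ` ((\<lambda>k. cis (2 * pi * real k / real m)) ` {..<m})
        \<union> (\<lambda>z. dih z (-1)) ` ((\<lambda>k. cis (2 * pi * real k / real m)) ` {..<m})"
    unfolding image_image by (simp add: dihedral_group_def rot ref)
  then show ?thesis
    unfolding im by auto
qed

lemma sum_carrier_dihedral_group: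
  fixes f :: "complex mat \<Rightarrow> 'a :: comm_monoid_add"
  assumes "0 < m"
  shows "(\<Sum>w\<in>carrier (dihedral_group m). f w)
    = (\<Sum>z | z ^ m = 1. f (dih z 1)) + (\<Sum>z | z ^ m = 1. f (dih z (-1)))"
proof -
  have fin: "finite {z::complex. z ^ m = 1}"
    using finite_roots_unity[of m] assms by simp
  have inj: "inj_on (\<lambda>z. dih z s) {z. z ^ m = 1}" for s
    by (metis inj_onI mat_arg_dih)
  have eq: "carrier (dihedral_group m)
      = (\<lambda>z. dih z 1) ` {z. z ^ m = 1} \<union> (\<lambda>z. dih z (-1)) ` {z. z ^ m = 1}"
    using assms by (auto simp: carrier_dihedral_group)
  have disj: "(\<lambda>z. dih z 1) ` {z. z ^ m = 1} \<inter> (\<lambda>z. dih z (-1)) ` {z. z ^ m = 1} = {}"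
    using norm_root_of_unity[OF _ assms] by (auto simp: dih_eq_iff)
  show ?thesis
    unfolding eq
    by (subst sum.union_disjoint) (use fin disj inj in \<open>auto simp: sum.reindex\<close>)
qed

lemma char_poly_dih:
  assumes "norm z = 1"
  shows "char_poly (dih z 1) = [:-z, 1:] * [:- cnj z, 1:]"
    and "char_poly (dih z (-1)) = [:-1, 0, 1:]"
proof -
  have sq: "(complex_of_real (Re z))\<^sup>2 + (complex_of_real (Im z))\<^sup>2 = 1"
    using assms by (metis cmod_power2 of_real_1 of_real_add of_real_power power_one)
  have *: "char_poly (dih z s) = [:- complex_of_real (Re z), 1:] * [:- s * complex_of_real (Re z), 1:]
     + [:s * complex_of_real (Im z):] * [:complex_of_real (Im z):]" for s
    unfolding char_poly_def
    by (subst det_two) (auto simp: char_poly_matrix_def)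
  show "char_poly (dih z 1) = [:-z, 1:] * [:- cnj z, 1:]"
    unfolding * using sq by (auto simp: complex_eq_iff power2_eq_square algebra_simps)
  show "char_poly (dih z (-1)) = [:-1, 0, 1:]"
    unfolding * using sq by (auto simp: complex_eq_iff power2_eq_square algebra_simps)
qed

section \<open>Fake degrees as trigonometric sums\<close>

lemma q_power: "q ^ n = to_fract (monom 1 n)"
proof -
  have "[:0, 1:] ^ n = (monom 1 n :: complex poly)"
    by (metis monom_altdef smult_1_left)
  moreover have "to_fract (p ^ n) = to_fract p ^ n" for p :: "complex poly"
    by (induction n) auto
  ultimately show ?thesis
    by (metis q_def)
qed

lemma q_power_eq_iff: "q ^ i = q ^ j \<longleftrightarrow> i = j"
  by (metis degree_monom_eq q_power to_fract_eq_iff zero_neq_one)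

lemma q_nonzero [simp]: "q \<noteq> 0"
  by (simp add: q_def)

lemma q_power_minus_one_nonzero [simp]: "0 < n \<Longrightarrow> q ^ n - 1 \<noteq> 0"
  using q_power_eq_iff[of n 0] by simp

definition const :: "complex \<Rightarrow> complex poly fract" where
  "const c = to_fract [:c:]"

lemma const_0 [simp]: "const 0 = 0"
  and const_1 [simp]: "const 1 = 1"
  and const_add: "const (x + y) = const x + const y"
  and const_mult: "const (x * y) = const x * const y"
  and const_minus: "const (- x) = - const x"
proof -
  show "const (- x) = - const x"
    by (simp add: const_def flip: to_fract_uminus)
  show "const (x + y) = const x + const y"
    by (simp add: const_def flip: to_fract_add)
  show "const (x * y) = const x * const y"
    by (simp add: const_def flip: to_fract_mult)
qed (simp_all add: const_def flip: one_pCons)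

lemma const_power: "const (x ^ n) = const x ^ n"
  by (induction n) (auto simp: const_mult)

lemma const_sum: "const (\<Sum>x\<in>A. f x) = (\<Sum>x\<in>A. const (f x))"
  by (induction A rule: infinite_finite_induct) (auto simp: const_add)

lemma const_of_nat: "const (of_nat n) = of_nat n"
  by (induction n) (auto simp: const_add)

lemma of_nat_fract_nonzero: "0 < n \<Longrightarrow> (of_nat n :: complex poly fract) \<noteq> 0"
  by (simp add: const_def flip: const_of_nat)

text \<open>Multiplication by the primitive root \<open>w\<close> permutes the roots of unity and
  multiplies the sum by \<open>w ^ n\<close>, which differs from 1 unless \<open>m\<close> divides
  \<open>n\<close>.\<close>

lemma sum_roots_unity_power:
  assumes "0 < m"
  shows "(\<Sum>z::complex | z ^ m = 1. z ^ n) = (if m dvd n then of_nat m else 0)"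
proof (cases "m dvd n")
  case True
  then obtain k where "n = m * k" ..
  then have "(\<Sum>z::complex | z ^ m = 1. z ^ n) = (\<Sum>z::complex | z ^ m = 1. 1)"
    by (intro sum.cong) (auto simp: power_mult)
  then show ?thesis
    using True card_roots_unity_eq[of m] assms by simp
next
  case False
  define w where "w = cis (2 * pi / real m)"
  have w: "w ^ m = 1"
    using assms by (simp add: w_def Complex.DeMoivre)
  have "w ^ n \<noteq> 1"
  proof
    assume "w ^ n = 1"
    then have "cis (2 * pi * (real n / real m)) = 1"
      by (simp add: w_def Complex.DeMoivre mult_ac)
    then have "cos (2 * pi * (real n / real m)) = 1"
      by (metis cis.sel(1) one_complex.sel(1))
    then obtain k :: int where "2 * pi * (real n / real m) = of_int k * 2 * pi"
      using cos_one_2pi_int by auto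
    then have "real n = of_int k * real m"
      using assms by (simp add: field_simps)
    then have "int n = k * int m"
      by (metis of_int_eq_iff of_int_mult of_int_of_nat_eq)
    then show False
      using False by (metis dvd_triv_right int_dvd_int_iff)
  qed
  moreover have "(\<Sum>z::complex | z ^ m = 1. z ^ n) = w ^ n * (\<Sum>z::complex | z ^ m = 1. z ^ n)"
  proof -
    have w0: "w \<noteq> 0"
      by (simp add: w_def)
    have "bij_betw (\<lambda>z. w * z) {z. z ^ m = 1} {z. z ^ m = 1}"
      by (rule bij_betw_byWitness[where f' = "\<lambda>z. z / w"])
        (use w w0 in \<open>auto simp: power_mult_distrib power_divide\<close>)
    then have "(\<Sum>z::complex | z ^ m = 1. (w * z) ^ n) = (\<Sum>z::complex | z ^ m = 1. z ^ n)"
      by (rule sum.reindex_bij_betw)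
    then show ?thesis
      by (simp only: power_mult_distrib sum_distrib_left)
  qed
  moreover have "x = 0" if "a \<noteq> 1" "x = a * x" for a x :: complex
    using that by simp
  ultimately show ?thesis
    using False by (metis (no_types, lifting))
qed

text \<open>A finite form of the Poisson kernel expansion.\<close>

lemma inverse_char_poly_rotation:
  assumes "0 < m" and "z ^ m = 1"
  shows "(q ^ 2 - 1) * (q ^ m - 1) / to_fract (char_poly (dih z 1))
    = (\<Sum>n<m. (q ^ n + q ^ (m - n)) * const (z ^ n))"
proof -
  have z: "norm z = 1" "z * cnj z = 1"
    using assms norm_root_of_unity cnj_root_of_unity by auto
  define x where "x = const z"
  define y where "y = const (cnj z)"
  have xy: "x * y = 1" and xm: "x ^ m = 1"
    using z assms(2) by (simp_all add: x_def y_def flip: const_mult const_power)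
  have cp: "to_fract (char_poly (dih z 1)) = (q - x) * (q - y)"
    by (simp only: char_poly_dih z to_fract_mult) (simp add: q_def x_def y_def const_def flip: to_fract_diff)
  have qx: "q - x \<noteq> 0" "q - y \<noteq> 0"
    by (auto simp: q_def x_def y_def const_def)
  have x0: "x \<noteq> 0"
    using xy by auto
  \<comment> \<open>This geometric sum and the next one close up because \<open>x ^ m = 1\<close>;
    they are the two partial fractions of the inverse of \<open>(q - x) * (q - y)\<close>, where
    \<open>y\<close> is the inverse of \<open>x\<close>.\<close>
  have 1: "(q - x) * (\<Sum>n<m. q ^ (m - n) * x ^ n) = q * (q ^ m - 1)"
  proof -
    have "(\<Sum>n<m. q ^ (m - n) * x ^ n) = q * (\<Sum>n<m. q ^ (m - Suc n) * x ^ n)"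
      unfolding sum_distrib_left
    proof (intro sum.cong refl)
      fix n
      assume "n \<in> {..<m}"
      then have "m - n = Suc (m - Suc n)"
        by auto
      then show "q ^ (m - n) * x ^ n = q * (q ^ (m - Suc n) * x ^ n)"
        by (metis mult.assoc power_Suc)
    qed
    then have "(q - x) * (\<Sum>n<m. q ^ (m - n) * x ^ n)
        = q * ((q - x) * (\<Sum>n<m. q ^ (m - Suc n) * x ^ n))"
      by (simp add: mult.left_commute)
    also have "(q - x) * (\<Sum>n<m. q ^ (m - Suc n) * x ^ n) = q ^ m - 1"
    proof -
      have "x ^ m - q ^ m = (x - q) * (\<Sum>n<m. q ^ (m - Suc n) * x ^ n)"
        by (rule power_diff_sumr2)
      then have "- (x ^ m - q ^ m) = - (x - q) * (\<Sum>n<m. q ^ (m - Suc n) * x ^ n)"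
        by (simp only: mult_minus_left)
      then show ?thesis
        by (simp only: xm minus_diff_eq)
    qed
    finally show ?thesis .
  qed
  have 2: "(q - y) * (\<Sum>n<m. q ^ n * x ^ n) = y * (q ^ m - 1)"
  proof -
    have "q ^ m - 1 = (q * x - 1) * (\<Sum>n<m. (q * x) ^ n)"
      using power_diff_1_eq[of "q * x" m] by (simp only: power_mult_distrib xm mult_1_right)
    also have "q * x - 1 = x * (q - y)"
      by (simp add: right_diff_distrib xy mult.commute)
    finally have "y * (q ^ m - 1) = (x * y) * ((q - y) * (\<Sum>n<m. (q * x) ^ n))"
      by (simp only: mult_ac)
    then show ?thesis
      by (simp only: xy power_mult_distrib mult_1)
  qed
  have "(\<Sum>n<m. (q ^ n + q ^ (m - n)) * const (z ^ n)) * ((q - x) * (q - y))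
      = (q - x) * ((q - y) * (\<Sum>n<m. q ^ n * x ^ n))
        + (q - y) * ((q - x) * (\<Sum>n<m. q ^ (m - n) * x ^ n))"
    by (simp add: const_power x_def[symmetric] distrib_right distrib_left sum.distrib mult_ac)
  also have "\<dots> = (q ^ m - 1) * ((q - x) * y + (q - y) * q)"
    unfolding 1 2 by (simp add: algebra_simps)
  also have "(q - x) * y + (q - y) * q = q ^ 2 - 1"
    using xy by (simp add: algebra_simps power2_eq_square)
  finally show ?thesis
    unfolding cp using qx by (subst divide_eq_eq) (simp add: mult.commute)
qed

text \<open>On a reflection the denominator \<open>q ^ 2 - 1\<close> cancels against the prefactor,
  so only the total of \<open>f\<close> enters. On rotations the kernel expansion produces the
  Fourier coefficients of \<open>f\<close>.\<close>

lemma R_eq_sums: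
  assumes "0 < m"
  shows "R m f = ((\<Sum>n<m. (q ^ n + q ^ (m - n)) * const (\<Sum>z | z ^ m = 1. f (dih z 1) * z ^ n))
    - (q ^ m - 1) * const (\<Sum>z | z ^ m = 1. f (dih z (-1)))) / of_nat (2 * m)"
proof -
  define A where "A = (q ^ 2 - 1) * (q ^ m - 1)"
  have q2: "q ^ 2 - 1 \<noteq> 0"
    using q_power_minus_one_nonzero[of 2] by simp
  have "[:-1, 0, 1:] = [:0, 1:] ^ 2 - (1 :: complex poly)"
    by (simp add: power2_eq_square one_pCons)
  then have sq: "to_fract [:-1, 0, 1:] = q ^ 2 - 1"
    by (simp add: q_def power2_eq_square del: mult_pCons_left mult_pCons_right)
  have "R m f = (\<Sum>w \<in> carrier (dihedral_group m). A * (to_fract [:det w * f w:] / to_fract (char_poly w))) / of_nat (2 * m)"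
    by (simp only: R_def A_def sum_distrib_left[symmetric] times_divide_eq_left)
  also have "(\<Sum>w \<in> carrier (dihedral_group m). A * (to_fract [:det w * f w:] / to_fract (char_poly w)))
     = (\<Sum>z | z ^ m = 1. const (f (dih z 1)) * (A / to_fract (char_poly (dih z 1))))
      + (\<Sum>z | z ^ m = 1. const (- f (dih z (-1))) * (A / to_fract (char_poly (dih z (-1)))))"
    using assms norm_root_of_unity[OF _ assms]
    by (simp add: sum_carrier_dihedral_group const_def mult_ac)
  also have "(\<Sum>z | z ^ m = 1. const (f (dih z 1)) * (A / to_fract (char_poly (dih z 1))))
     = (\<Sum>z | z ^ m = 1. \<Sum>n<m. (q ^ n + q ^ (m - n)) * const (f (dih z 1) * z ^ n))"
  proof (intro sum.cong refl)
    fix z :: complex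
    assume "z \<in> {z. z ^ m = 1}"
    then have "A / to_fract (char_poly (dih z 1)) = (\<Sum>n<m. (q ^ n + q ^ (m - n)) * const (z ^ n))"
      unfolding A_def using assms by (intro inverse_char_poly_rotation) auto
    then show "const (f (dih z 1)) * (A / to_fract (char_poly (dih z 1)))
        = (\<Sum>n<m. (q ^ n + q ^ (m - n)) * const (f (dih z 1) * z ^ n))"
      by (simp add: sum_distrib_left const_mult mult.left_commute)
  qed
  also have "\<dots> = (\<Sum>n<m. (q ^ n + q ^ (m - n)) * const (\<Sum>z | z ^ m = 1. f (dih z 1) * z ^ n))"
    by (subst sum.swap) (simp add: const_sum sum_distrib_left)
  also have "(\<Sum>z | z ^ m = 1. const (- f (dih z (-1))) * (A / to_fract (char_poly (dih z (-1)))))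
     = (\<Sum>z | z ^ m = 1. const (- f (dih z (-1))) * (q ^ m - 1))"
  proof (intro sum.cong refl)
    fix z :: complex
    assume "z \<in> {z. z ^ m = 1}"
    then have "to_fract (char_poly (dih z (-1))) = q ^ 2 - 1"
      using norm_root_of_unity[OF _ assms]
      by (simp add: char_poly_dih sq)
    then show "const (- f (dih z (-1))) * (A / to_fract (char_poly (dih z (-1))))
        = const (- f (dih z (-1))) * (q ^ m - 1)"
      using q2 by (simp add: A_def)
  qed
  also have "\<dots> = - (q ^ m - 1) * const (\<Sum>z | z ^ m = 1. f (dih z (-1)))"
    by (simp only: const_sum const_minus mult_minus_left mult_minus_right sum_negf sum_distrib_left mult.commute)
  finally show ?thesis
    by (simp only: mult_minus_left add_uminus_conv_diff)
qed

text \<open>All characters and all triple products in \<open>Omega\<close> that are needed have this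
  shape. Orthogonality selects the indices congruent to \<open>j\<close> and \<open>- j\<close>; the
  weight \<open>q ^ n + q ^ (m - n)\<close> is the same for both. A nonzero \<open>l\<close> makes
  the reflections cancel.\<close>

lemma R_trigonometric:
  assumes m: "0 < m" and le: "j \<le> m" "k \<le> m" "l < m"
    and rot: "\<And>z. z ^ m = 1 \<Longrightarrow>
      f (dih z 1) = \<alpha> * (z ^ j + cnj z ^ j) + \<beta> * (z ^ k + cnj z ^ k)"
    and rfl: "\<And>z. z ^ m = 1 \<Longrightarrow> f (dih z (-1)) = \<gamma> * z ^ l"
  shows "R m f = const \<alpha> * (q ^ j + q ^ (m - j)) + const \<beta> * (q ^ k + q ^ (m - k))
    - (if l = 0 then const \<gamma> * (q ^ m - 1) / 2 else 0)"
proof -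
  have S: "(\<Sum>z | z ^ m = 1. (z ^ j + cnj z ^ j) * z ^ n)
      = of_nat m * ((if m dvd j + n then 1 else 0) + (if m dvd (m - j) + n then 1 else 0))" 
    if "j \<le> m" for j n
  proof -
    have "(\<Sum>z | z ^ m = 1. (z ^ j + cnj z ^ j) * z ^ n) = (\<Sum>z | z ^ m = 1. z ^ (j + n) + z ^ ((m - j) + n))"
    proof (intro sum.cong refl)
      fix z :: complex
      assume z: "z \<in> {z. z ^ m = 1}"
      then have "z ^ j * cnj z ^ j = 1"
        using cnj_root_of_unity[OF _ m, of z] by (simp flip: power_mult_distrib)
      moreover have "z ^ j * z ^ (m - j) = 1"
        using z that by (simp flip: power_add)
      ultimately have "cnj z ^ j = z ^ (m - j)"
        by (metis mult.left_commute mult.right_neutral)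
      then show "(z ^ j + cnj z ^ j) * z ^ n = z ^ (j + n) + z ^ ((m - j) + n)"
        by (simp add: power_add algebra_simps)
    qed
    then show ?thesis
      using m by (simp add: sum.distrib sum_roots_unity_power)
  qed
  have T: "(\<Sum>n<m. (q ^ n + q ^ (m - n)) * const ((if m dvd j + n then 1 else 0) + (if m dvd (m - j) + n then 1 else 0)))
      = 2 * (q ^ j + q ^ (m - j))" if j: "j \<le> m" for j
  proof -
    have one: "(\<Sum>n<m. (q ^ n + q ^ (m - n)) * const (if m dvd j + n then 1 else 0)) = q ^ j + q ^ (m - j)"
      if "j \<le> m" for j
    proof -
      \<comment> \<open>The residue of \<open>- j\<close> within the range of summation; both
        \<open>j = 0\<close> and \<open>j = m\<close> give 0.\<close>
      define n0 where "n0 = (if j = 0 then 0 else m - j)"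
      have iff: "m dvd j + n \<longleftrightarrow> n = n0" if n: "n < m" for n
      proof
        assume "m dvd j + n"
        then obtain c where c: "j + n = m * c" ..
        with n \<open>j \<le> m\<close> have "m * c < m * 2"
          by linarith
        then have "c = 0 \<or> c = 1"
          by auto
        then show "n = n0"
          using c n by (auto simp: n0_def)
      next
        assume "n = n0"
        then show "m dvd j + n"
          using \<open>j \<le> m\<close> by (auto simp: n0_def)
      qed
      have "(\<Sum>n<m. (q ^ n + q ^ (m - n)) * const (if m dvd j + n then 1 else 0))
         = (\<Sum>n<m. if n = n0 then q ^ n + q ^ (m - n) else 0)"
        using iff by (intro sum.cong) auto
      also have "\<dots> = q ^ n0 + q ^ (m - n0)"
        using m \<open>j \<le> m\<close> by (simp add: n0_def)
      also have "\<dots> = q ^ j + q ^ (m - j)"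
        using \<open>j \<le> m\<close> by (auto simp: n0_def add.commute)
      finally show ?thesis .
    qed
    show ?thesis
      using one[of j] one[of "m - j"] j
      by (simp add: const_add distrib_left sum.distrib add.commute)
  qed
  have rsum: "(\<Sum>z | z ^ m = 1. f (dih z (-1))) = (if l = 0 then \<gamma> * of_nat m else 0)"
  proof -
    have "(\<Sum>z | z ^ m = 1. f (dih z (-1))) = \<gamma> * (\<Sum>z | z ^ m = 1. z ^ l)"
      by (simp add: rfl sum_distrib_left)
    then show ?thesis
      using m le by (auto simp: sum_roots_unity_power dest: nat_dvd_not_less)
  qed
  define U where "U j n = ((if m dvd j + n then 1 else 0) + (if m dvd (m - j) + n then 1 else 0) :: complex)" for j n
  have "(\<Sum>z | z ^ m = 1. f (dih z 1) * z ^ n) = of_nat m * (\<alpha> * U j n + \<beta> * U k n)" for n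
  proof -
    have "(\<Sum>z | z ^ m = 1. f (dih z 1) * z ^ n)
       = \<alpha> * (\<Sum>z | z ^ m = 1. (z ^ j + cnj z ^ j) * z ^ n) + \<beta> * (\<Sum>z | z ^ m = 1. (z ^ k + cnj z ^ k) * z ^ n)"
      by (simp add: rot algebra_simps sum.distrib sum_distrib_left)
    also have "\<dots> = \<alpha> * (of_nat m * U j n) + \<beta> * (of_nat m * U k n)"
      by (simp only: S[OF le(1)] S[OF le(2)] U_def)
    finally show ?thesis
      by (simp add: algebra_simps)
  qed
  then have "(q ^ n + q ^ (m - n)) * const (\<Sum>z | z ^ m = 1. f (dih z 1) * z ^ n)
      = of_nat m * (const \<alpha> * ((q ^ n + q ^ (m - n)) * const (U j n))
          + const \<beta> * ((q ^ n + q ^ (m - n)) * const (U k n)))" for n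
    by (simp add: const_mult const_add const_of_nat) (simp add: algebra_simps)
  then have "(\<Sum>n<m. (q ^ n + q ^ (m - n)) * const (\<Sum>z | z ^ m = 1. f (dih z 1) * z ^ n))
      = of_nat m * (const \<alpha> * (\<Sum>n<m. (q ^ n + q ^ (m - n)) * const (U j n))
          + const \<beta> * (\<Sum>n<m. (q ^ n + q ^ (m - n)) * const (U k n)))"
    by (simp only: sum_distrib_left[symmetric] sum.distrib)
  also have "\<dots> = of_nat m * (const \<alpha> * (2 * (q ^ j + q ^ (m - j))) + const \<beta> * (2 * (q ^ k + q ^ (m - k))))"
    by (simp only: U_def T[OF le(1)] T[OF le(2)])
  also have "\<dots> = of_nat (2 * m) * (const \<alpha> * (q ^ j + q ^ (m - j)) + const \<beta> * (q ^ k + q ^ (m - k)))"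
    by (simp add: distrib_left mult.assoc mult.left_commute)
  finally have "R m f = (of_nat (2 * m) * (const \<alpha> * (q ^ j + q ^ (m - j)) + const \<beta> * (q ^ k + q ^ (m - k)))
      - (q ^ m - 1) * const (if l = 0 then \<gamma> * of_nat m else 0)) / of_nat (2 * m)"
    by (simp only: R_eq_sums[OF m] rsum)
  also have "\<dots> = (const \<alpha> * (q ^ j + q ^ (m - j)) + const \<beta> * (q ^ k + q ^ (m - k)))
      - (q ^ m - 1) * const (if l = 0 then \<gamma> * of_nat m else 0) / of_nat (2 * m)"
    using nonzero_mult_div_cancel_left[OF of_nat_fract_nonzero[of "2 * m"]] m
    by (simp only: diff_divide_distrib)
  also have "(q ^ m - 1) * const (if l = 0 then \<gamma> * of_nat m else 0) / of_nat (2 * m)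
      = (if l = 0 then const \<gamma> * (q ^ m - 1) / 2 else 0)"
    using of_nat_fract_nonzero[OF m] by (simp add: const_mult const_of_nat)
  finally show ?thesis .
qed

section \<open>The irreducible characters\<close>

definition rot_char :: "nat \<Rightarrow> nat \<Rightarrow> complex mat \<Rightarrow> complex" where
  "rot_char m i = (\<lambda>w \<in> carrier (dihedral_group m).
     if det w = 1 then mat_arg w ^ i + cnj (mat_arg w) ^ i else 0)"

text \<open>For even \<open>m\<close> and \<open>s\<close> equal to 1 or -1 these are the two
  remaining linear characters; \<open>s\<close> is the value at \<open>dih 1 (-1)\<close>.\<close>

definition half_char :: "nat \<Rightarrow> complex \<Rightarrow> complex mat \<Rightarrow> complex" where
  "half_char m s = (\<lambda>w \<in> carrier (dihedral_group m).
     if det w = 1 then mat_arg w ^ (m div 2) else s * mat_arg w ^ (m div 2))"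

lemma dih_in_carrier:
  "0 < m \<Longrightarrow> z ^ m = 1 \<Longrightarrow> s = 1 \<or> s = -1 \<Longrightarrow> dih z s \<in> carrier (dihedral_group m)"
  by (auto simp: carrier_dihedral_group)

lemma carrier_dihedral_groupE:
  assumes "w \<in> carrier (dihedral_group m)" and "0 < m"
  obtains z s where "w = dih z s" "z ^ m = 1" "norm z = 1" "s = 1 \<or> s = -1"
  using assms norm_root_of_unity by (auto simp: carrier_dihedral_group)

lemma char_values:
  assumes "0 < m" "z ^ m = 1"
  shows "rot_char m i (dih z 1) = z ^ i + cnj z ^ i"
    and "rot_char m i (dih z (-1)) = 0"
    and "half_char m c (dih z 1) = z ^ (m div 2)"
    and "half_char m c (dih z (-1)) = c * z ^ (m div 2)"
    and "trivial_char m (dih z 1) = 1"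
    and "trivial_char m (dih z (-1)) = 1"
    and "sign_char m (dih z 1) = 1"
    and "sign_char m (dih z (-1)) = -1"
  using assms norm_root_of_unity[OF assms(2,1)]
  by (simp_all add: rot_char_def half_char_def trivial_char_def sign_char_def dih_in_carrier)

lemma reflection_char_eq: "0 < m \<Longrightarrow> reflection_char m = rot_char m 1"
  unfolding reflection_char_def rot_char_def
  by (intro restrict_ext) (auto elim!: carrier_dihedral_groupE simp: mat_trace_dih complex_eq_iff)

section \<open>Matrix representations of the dihedral group\<close>

lemma representationD:
  assumes rep: "representation m n \<rho>" and m: "0 < m"
  shows "w \<in> carrier (dihedral_group m) \<Longrightarrow> \<rho> w \<in> carrier_mat n n"
    and "w \<in> carrier (dihedral_group m) \<Longrightarrow> w' \<in> carrier (dihedral_group m)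
      \<Longrightarrow> \<rho> (w * w') = \<rho> w * \<rho> w'"
    and "\<rho> (dih 1 1) = 1\<^sub>m n"
proof -
  show 1: "\<rho> w \<in> carrier_mat n n" if "w \<in> carrier (dihedral_group m)" for w
    using rep that by (auto simp: representation_def hom_def units_of_def Units_def ring_mat_simps)
  show 2: "\<rho> (w * w') = \<rho> w * \<rho> w'"
    if "w \<in> carrier (dihedral_group m)" "w' \<in> carrier (dihedral_group m)" for w w'
    using rep that by (auto simp: representation_def hom_def units_of_def ring_mat_simps dihedral_group_def)
  have in_c: "dih 1 1 \<in> carrier (dihedral_group m)"
    by (simp add: dih_in_carrier m)
  then have "\<rho> (dih 1 1) \<in> Units (ring_mat TYPE(complex) n ())"
    using rep by (auto simp: representation_def hom_def units_of_def)
  then obtain y where y: "y \<in> carrier_mat n n" "y * \<rho> (dih 1 1) = 1\<^sub>m n"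
    by (auto simp: Units_def ring_mat_simps)
  \<comment> \<open>An idempotent invertible matrix is the identity.\<close>
  have "\<rho> (dih 1 1) * \<rho> (dih 1 1) = \<rho> (dih 1 1)"
    using 2[OF in_c in_c] by (simp add: dih_mult)
  then have "y * \<rho> (dih 1 1) * \<rho> (dih 1 1) = y * \<rho> (dih 1 1)"
    using y(1) 1[OF in_c] by (simp add: assoc_mult_mat[of y n n _ n _ n])
  then show "\<rho> (dih 1 1) = 1\<^sub>m n"
    using y 1[OF in_c] by simp
qed

lemma representationI:
  assumes m: "0 < m"
    and cl: "\<And>z s. z ^ m = 1 \<Longrightarrow> s = 1 \<or> s = -1 \<Longrightarrow> \<rho> (dih z s) \<in> carrier_mat n n"
    and mult: "\<And>z s z' s'. z ^ m = 1 \<Longrightarrow> s = 1 \<or> s = -1 \<Longrightarrow> z' ^ m = 1 \<Longrightarrow> s' = 1 \<or> s' = -1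
      \<Longrightarrow> \<rho> (dih (z * (if s = 1 then z' else cnj z')) (s * s')) = \<rho> (dih z s) * \<rho> (dih z' s')"
    and one: "\<rho> (dih 1 1) = 1\<^sub>m n"
  shows "representation m n \<rho>"
proof -
  have unit: "\<rho> (dih z s) \<in> Units (ring_mat TYPE(complex) n ())"
    if z: "z ^ m = 1" and s: "s = 1 \<or> s = -1" for z s
  proof -
    define z' where "z' = (if s = 1 then cnj z else z)"
    have z': "z' ^ m = 1"
      using z by (auto simp: z'_def simp flip: complex_cnj_power)
    have "\<rho> (dih z s) * \<rho> (dih z' s) = 1\<^sub>m n" "\<rho> (dih z' s) * \<rho> (dih z s) = 1\<^sub>m n"
      using mult[OF z s z' s] mult[OF z' s z s] s one cnj_root_of_unity[OF z m]
      by (auto simp: z'_def mult.commute split: if_splits)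
    then show ?thesis
      using cl[OF z s] cl[OF z' s] by (auto simp: Units_def ring_mat_simps)
  qed
  have hom: "\<rho> (w * w') = \<rho> w * \<rho> w'"
    if w: "w \<in> carrier (dihedral_group m)" and w': "w' \<in> carrier (dihedral_group m)" for w w'
  proof -
    obtain z s where "w = dih z s" "z ^ m = 1" "s = 1 \<or> s = -1"
      using w m by (rule carrier_dihedral_groupE)
    moreover obtain z' s' where "w' = dih z' s'" "z' ^ m = 1" "s' = 1 \<or> s' = -1"
      using w' m by (rule carrier_dihedral_groupE)
    ultimately show ?thesis
      using mult[of z s z' s'] by (simp only: dih_mult)
  qed
  have mult_eq: "mult (dihedral_group m) = (*)"
    by (simp add: dihedral_group_def)
  show ?thesis
    unfolding representation_def hom_def
    using unit hom
    by (auto simp: units_of_def ring_mat_simps mult_eq carrier_dihedral_group[OF m])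
qed

lemma root_of_unity_power_exponent:
  assumes "0 < m" and "\<mu> ^ m = (1::complex)"
  obtains j where "j < m" and "\<mu> = cis (2 * pi / real m) ^ j"
proof -
  have "\<mu> \<in> (\<lambda>k. cis (2 * pi * real k / real m)) ` {..<m}"
    using bij_betw_roots_unity[OF assms(1)] assms(2) by (auto simp: bij_betw_def)
  then show ?thesis
    using that by (auto simp: Complex.DeMoivre mult_ac)
qed

text \<open>Over the complex numbers the generating rotation has an eigenvector, which serves for
  all its powers; as the \<open>m\<close>-th power acts trivially, the eigenvalue is a root of
  unity.\<close>

lemma rotation_eigenvector:
  assumes rep: "representation m n \<rho>" and m: "0 < m" and n: "0 < n"
  obtains v j where "v \<in> carrier_vec n" "v \<noteq> 0\<^sub>v n" "j < m"
    "\<And>z. z ^ m = 1 \<Longrightarrow> \<rho> (dih z 1) *\<^sub>v v = z ^ j \<cdot>\<^sub>v v"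
proof -
  define \<zeta> where "\<zeta> = cis (2 * pi / real m)"
  have \<zeta>m: "\<zeta> ^ m = 1"
    using m by (simp add: \<zeta>_def Complex.DeMoivre)
  note D = representationD[OF rep m]
  note C = dih_in_carrier[OF m]
  have \<zeta>C: "dih \<zeta> 1 \<in> carrier (dihedral_group m)"
    using C \<zeta>m by simp
  from spectrum_non_empty[OF D(1)[OF \<zeta>C] n]
  obtain \<mu> v where "eigenvector (\<rho> (dih \<zeta> 1)) v \<mu>"
    by (auto simp: spectrum_def eigenvalue_def)
  then have v: "v \<in> carrier_vec n" "v \<noteq> 0\<^sub>v n" "\<rho> (dih \<zeta> 1) *\<^sub>v v = \<mu> \<cdot>\<^sub>v v"
    using D(1)[OF \<zeta>C] by (auto simp: eigenvector_def)
  have pow: "\<rho> (dih (\<zeta> ^ k) 1) *\<^sub>v v = \<mu> ^ k \<cdot>\<^sub>v v" for k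
  proof (induction k)
    case 0
    then show ?case
      using v(1) by (simp add: D(3))
  next
    case (Suc k)
    have C': "dih (\<zeta> ^ k) 1 \<in> carrier (dihedral_group m)"
      using \<zeta>m by (intro C) (metis mult.commute power_mult power_one, simp)
    have "\<rho> (dih (\<zeta> ^ Suc k) 1) = \<rho> (dih (\<zeta> ^ k) 1) * \<rho> (dih \<zeta> 1)"
      using D(2)[OF C' \<zeta>C] by (simp add: dih_mult mult.commute)
    then have "\<rho> (dih (\<zeta> ^ Suc k) 1) *\<^sub>v v = \<rho> (dih (\<zeta> ^ k) 1) *\<^sub>v (\<mu> \<cdot>\<^sub>v v)"
      using D(1)[OF C'] D(1)[OF \<zeta>C] v by (simp add: assoc_mult_mat_vec)
    also have "\<dots> = \<mu> \<cdot>\<^sub>v (\<mu> ^ k \<cdot>\<^sub>v v)"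
      using D(1)[OF C'] v(1) Suc by (simp add: mult_mat_vec)
    finally show ?case
      by (simp add: smult_smult_assoc)
  qed
  have "1 \<cdot>\<^sub>v v = \<mu> ^ m \<cdot>\<^sub>v v"
    using pow[of m] D(3) v(1) by (simp add: \<zeta>m)
  moreover obtain i where "i < n" "v $ i \<noteq> 0"
    using v(1,2) by (metis carrier_vecD eq_vecI index_zero_vec(1) index_zero_vec(2))
  ultimately have "\<mu> ^ m = 1"
    using v(1) by (metis carrier_vecD index_smult_vec(1) mult_cancel_right1 mult.left_neutral)
  then obtain j where j: "j < m" "\<mu> = \<zeta> ^ j"
    using root_of_unity_power_exponent[OF m] \<zeta>_def by metis
  show ?thesis
  proof (rule that[OF v(1,2) j(1)])
    fix z :: complex
    assume "z ^ m = 1"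
    then obtain k where "z = \<zeta> ^ k"
      using root_of_unity_power_exponent[OF m] \<zeta>_def by metis
    then show "\<rho> (dih z 1) *\<^sub>v v = z ^ j \<cdot>\<^sub>v v"
      using pow[of k] j by (simp add: power_mult[symmetric] mult.commute)
  qed
qed

text \<open>A nonzero stable subspace must be everything. Taking for \<open>u\<close> the reflected
  eigenvector or the zero vector bounds the dimension by 2 or by 1.\<close>

lemma irreducible_representation_spanI:
  assumes irr: "irreducible_representation m n \<rho>"
    and v: "v \<in> carrier_vec n" "v \<noteq> 0\<^sub>v n" and u: "u \<in> carrier_vec n"
    and inv: "\<And>w. w \<in> carrier (dihedral_group m) \<Longrightarrow>
      (\<exists>a b. \<rho> w *\<^sub>v v = a \<cdot>\<^sub>v v + b \<cdot>\<^sub>v u) \<and> (\<exists>a b. \<rho> w *\<^sub>v u = a \<cdot>\<^sub>v v + b \<cdot>\<^sub>v u)"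
    and rho: "\<And>w. w \<in> carrier (dihedral_group m) \<Longrightarrow> \<rho> w \<in> carrier_mat n n"
    and x: "x \<in> carrier_vec n"
  obtains a b where "x = a \<cdot>\<^sub>v v + b \<cdot>\<^sub>v u"
proof -
  define U where "U = {a \<cdot>\<^sub>v v + b \<cdot>\<^sub>v u | a b. True}"
  interpret vec_space "TYPE(complex)" n .
  have U_comb: "c \<cdot>\<^sub>v (a \<cdot>\<^sub>v v + b \<cdot>\<^sub>v u) + c' \<cdot>\<^sub>v (a' \<cdot>\<^sub>v v + b' \<cdot>\<^sub>v u)
      = (c * a + c' * a') \<cdot>\<^sub>v v + (c * b + c' * b') \<cdot>\<^sub>v u" for a b a' b' c c'
    using v u by (intro eq_vecI) (auto simp: algebra_simps)
  have sub: "subspace class_ring U (module_vec TYPE(complex) n)"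
  proof (rule subspace.intro)
    show "vectorspace class_ring (module_vec TYPE(complex) n)"
      by (rule vec_vs)
    show "submodule class_ring U (module_vec TYPE(complex) n)"
    proof (rule submodule.intro)
      show "module class_ring (module_vec TYPE(complex) n)"
        by (rule vec_module)
    next
      show "U \<subseteq> carrier (module_vec TYPE(complex) n)"
        using v u by (auto simp: U_def module_vec_simps)
    next
      have "0\<^sub>v n = 0 \<cdot>\<^sub>v v + 0 \<cdot>\<^sub>v u"
        using v u by (intro eq_vecI) auto
      then show "\<zero>\<^bsub>module_vec TYPE(complex) n\<^esub> \<in> U"
        by (auto simp: U_def module_vec_simps)
    next
      fix x y
      assume "x \<in> U" "y \<in> U"
      then obtain a b a' b' where xy: "x = a \<cdot>\<^sub>v v + b \<cdot>\<^sub>v u" "y = a' \<cdot>\<^sub>v v + b' \<cdot>\<^sub>v u"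
        by (auto simp: U_def)
      have "x + y = (a + a') \<cdot>\<^sub>v v + (b + b') \<cdot>\<^sub>v u"
        using v u by (intro eq_vecI) (auto simp: algebra_simps xy)
      then show "x \<oplus>\<^bsub>module_vec TYPE(complex) n\<^esub> y \<in> U"
        by (auto simp: U_def module_vec_simps)
    next
      fix c :: complex and x
      assume "x \<in> U"
      then obtain a b where "x = a \<cdot>\<^sub>v v + b \<cdot>\<^sub>v u"
        by (auto simp: U_def)
      then have "c \<cdot>\<^sub>v x = (c * a) \<cdot>\<^sub>v v + (c * b) \<cdot>\<^sub>v u"
        using v u by (intro eq_vecI) (auto simp: algebra_simps)
      then show "c \<odot>\<^bsub>module_vec TYPE(complex) n\<^esub> x \<in> U"
        by (auto simp: U_def module_vec_simps)
    qed
  qed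
  have stable: "\<rho> w *\<^sub>v x \<in> U" if w: "w \<in> carrier (dihedral_group m)" and "x \<in> U" for w x
  proof -
    obtain a b where x: "x = a \<cdot>\<^sub>v v + b \<cdot>\<^sub>v u"
      using \<open>x \<in> U\<close> by (auto simp: U_def)
    obtain a1 b1 a2 b2 where "\<rho> w *\<^sub>v v = a1 \<cdot>\<^sub>v v + b1 \<cdot>\<^sub>v u" "\<rho> w *\<^sub>v u = a2 \<cdot>\<^sub>v v + b2 \<cdot>\<^sub>v u"
      using inv[OF w] by metis
    moreover have "\<rho> w *\<^sub>v x = a \<cdot>\<^sub>v (\<rho> w *\<^sub>v v) + b \<cdot>\<^sub>v (\<rho> w *\<^sub>v u)"
      using rho[OF w] v u by (simp add: x mult_add_distrib_mat_vec[of _ n n] mult_mat_vec[of _ n n])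
    ultimately show ?thesis
      using U_comb by (auto simp: U_def)
  qed
  have "U \<noteq> {0\<^sub>v n}"
  proof -
    have "v = 1 \<cdot>\<^sub>v v + 0 \<cdot>\<^sub>v u"
      using v u by (intro eq_vecI) auto
    then have "v \<in> U"
      unfolding U_def by blast
    then show ?thesis
      using v(2) by auto
  qed
  then have "U = carrier_vec n"
    using irr sub stable unfolding irreducible_representation_def by blast
  then show ?thesis
    using x that by (auto simp: U_def)
qed


lemma dimension_le_one:
  assumes "\<And>x. x \<in> carrier_vec n \<Longrightarrow> \<exists>a::'a::field. x = a \<cdot>\<^sub>v v" and "v \<in> carrier_vec n"
  shows "n \<le> 1"
proof (rule ccontr)
  assume "\<not> n \<le> 1"
  then have n: "0 < n" "1 < n"
    by auto
  obtain a b where ab: "unit_vec n 0 = a \<cdot>\<^sub>v v" "unit_vec n 1 = b \<cdot>\<^sub>v v"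
    using assms(1) by (meson unit_vec_carrier)
  have "a * v $ 0 = 1" "a * v $ 1 = 0" "b * v $ 1 = 1"
    using arg_cong[OF ab(1), of "\<lambda>x. x $ 0"] arg_cong[OF ab(1), of "\<lambda>x. x $ 1"]
      arg_cong[OF ab(2), of "\<lambda>x. x $ 1"] n assms(2)
    by (auto simp: unit_vec_def)
  then show False
    by auto
qed

lemma span_two_vectors:
  assumes span: "\<And>x. x \<in> carrier_vec n \<Longrightarrow> \<exists>a b. x = a \<cdot>\<^sub>v v + b \<cdot>\<^sub>v (u :: 'a :: field vec)"
    and vu: "v \<in> carrier_vec n" "u \<in> carrier_vec n"
  shows "n \<le> 2" and "n = 2 \<Longrightarrow> v $ 0 * u $ 1 - v $ 1 * u $ 0 \<noteq> 0"
proof -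
  have coord: "\<exists>a b. \<forall>j<n. a * v $ j + b * u $ j = (if j = i then 1 else 0)" if "i < n" for i
  proof -
    obtain a b where ab: "unit_vec n i = a \<cdot>\<^sub>v v + b \<cdot>\<^sub>v u"
      using span by (meson unit_vec_carrier)
    have "a * v $ j + b * u $ j = (if j = i then 1 else 0)" if "j < n" for j
      using arg_cong[OF ab, of "\<lambda>x. x $ j"] that \<open>i < n\<close> vu by (auto simp: unit_vec_def)
    then show ?thesis
      by blast
  qed
  have M: "v $ 0 * u $ 1 - v $ 1 * u $ 0 \<noteq> 0" if n1: "1 < n"
  proof -
    have n0: "0 < n"
      using n1 by simp
    obtain a b where "\<forall>j<n. a * v $ j + b * u $ j = (if j = 0 then 1 else 0)"
      using coord[OF n0] by blast
    moreover obtain c d where "\<forall>j<n. c * v $ j + d * u $ j = (if j = 1 then 1 else 0)"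
      using coord[OF n1] by blast
    ultimately have e: "a * v $ 0 + b * u $ 0 = 1" "a * v $ 1 + b * u $ 1 = 0"
       "c * v $ 0 + d * u $ 0 = 0" "c * v $ 1 + d * u $ 1 = 1"
      using n1 n0 by auto
    \<comment> \<open>The determinant of the coefficients times that of \<open>(v, u)\<close>; the
      right-hand side is 1, so neither factor vanishes.\<close>
    have "(a * d - b * c) * (v $ 0 * u $ 1 - v $ 1 * u $ 0)
       = (a * v $ 0 + b * u $ 0) * (c * v $ 1 + d * u $ 1) - (a * v $ 1 + b * u $ 1) * (c * v $ 0 + d * u $ 0)"
      by (simp add: algebra_simps)
    then show ?thesis
      unfolding e by auto
  qed
  show "n = 2 \<Longrightarrow> v $ 0 * u $ 1 - v $ 1 * u $ 0 \<noteq> 0"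
    using M by simp
  show "n \<le> 2"
  proof (rule ccontr)
    assume "\<not> n \<le> 2"
    then have n: "0 < n" "1 < n" "2 < n"
      by auto
    obtain a b where "\<forall>j<n. a * v $ j + b * u $ j = (if j = 2 then 1 else 0)"
      using coord[OF n(3)] by blast
    then have e: "a * v $ 0 + b * u $ 0 = 0" "a * v $ 1 + b * u $ 1 = 0" "a * v $ 2 + b * u $ 2 = 1"
      using n by auto
    \<comment> \<open>Cramer's rule: the first two coordinates of the third unit vector are zero,
      which forces both coefficients to vanish.\<close>
    have "a * (v $ 0 * u $ 1 - v $ 1 * u $ 0) = (a * v $ 0 + b * u $ 0) * u $ 1 - (a * v $ 1 + b * u $ 1) * u $ 0"
      "b * (v $ 0 * u $ 1 - v $ 1 * u $ 0) = (a * v $ 1 + b * u $ 1) * v $ 0 - (a * v $ 0 + b * u $ 0) * v $ 1"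
      by (simp_all add: algebra_simps)
    then have "a = 0" "b = 0"
      unfolding e using M[OF n(2)] by auto
    then show False
      using e(3) by simp
  qed
qed

lemma mult_mat_vec_two:
  assumes "(M :: 'a :: comm_ring_1 mat) \<in> carrier_mat 2 2" "x \<in> carrier_vec 2"
  shows "(M *\<^sub>v x) $ 0 = M $$ (0, 0) * x $ 0 + M $$ (0, 1) * x $ 1"
    and "(M *\<^sub>v x) $ 1 = M $$ (1, 0) * x $ 0 + M $$ (1, 1) * x $ 1"
  using assms by (auto simp: scalar_prod_def numeral_2_eq_2)

text \<open>The trace of \<open>M\<close> times the determinant of \<open>(v, u)\<close> is the derivative at the identity of
  \<open>g \<mapsto> det (g v, g u)\<close> in the direction \<open>M\<close>.\<close>

lemma mat_trace_two:
  assumes "(M :: 'a :: comm_ring_1 mat) \<in> carrier_mat 2 2" "v \<in> carrier_vec 2" "u \<in> carrier_vec 2"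
  shows "mat_trace M * (v $ 0 * u $ 1 - v $ 1 * u $ 0)
    = (M *\<^sub>v v) $ 0 * u $ 1 - (M *\<^sub>v v) $ 1 * u $ 0 + (v $ 0 * (M *\<^sub>v u) $ 1 - v $ 1 * (M *\<^sub>v u) $ 0)"
proof -
  have "mat_trace M = M $$ (0, 0) + M $$ (1, 1)"
    using assms(1) by (auto simp: mat_trace_def numeral_2_eq_2)
  then show ?thesis
    by (simp only: mult_mat_vec_two[OF assms(1,2)] mult_mat_vec_two[OF assms(1,3)]) (simp add: algebra_simps)
qed

lemma dih_decompose: "dih z (-1) = dih z 1 * dih 1 (-1)" "dih 1 (-1) * dih z 1 = dih (cnj z) 1 * dih 1 (-1)"
  by (simp_all add: dih_mult)

section \<open>Completeness of the list of irreducible characters\<close>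

definition dihedral_characters :: "nat \<Rightarrow> (complex mat \<Rightarrow> complex) set" where
  "dihedral_characters m = {trivial_char m, sign_char m} \<union> rot_char m ` {i. 1 \<le> i \<and> 2 * i < m}
     \<union> (if even m then {half_char m 1, half_char m (-1)} else {})"

lemma restrict_charI:
  assumes "0 < m"
    and "\<And>z. z ^ m = 1 \<Longrightarrow> f (dih z 1) = g (dih z 1)" "\<And>z. z ^ m = 1 \<Longrightarrow> f (dih z (-1)) = g (dih z (-1))"
    and "g \<in> extensional (carrier (dihedral_group m))"
  shows "(\<lambda>w\<in>carrier (dihedral_group m). f w) = g"
proof (rule extensionalityI[of _ "carrier (dihedral_group m)"])
  fix w
  assume w: "w \<in> carrier (dihedral_group m)"
  then obtain z s where "w = dih z s" "z ^ m = 1" "s = 1 \<or> s = -1"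
    using assms(1) by (rule carrier_dihedral_groupE)
  then show "(\<lambda>w\<in>carrier (dihedral_group m). f w) w = g w"
    using w assms(2,3) by auto
qed (use assms(4) in auto)

lemma char_extensional [simp]:
  "rot_char m i \<in> extensional (carrier (dihedral_group m))"
  "half_char m s \<in> extensional (carrier (dihedral_group m))"
  "trivial_char m \<in> extensional (carrier (dihedral_group m))"
  "sign_char m \<in> extensional (carrier (dihedral_group m))"
  by (auto simp: rot_char_def half_char_def trivial_char_def sign_char_def)

text \<open>Let \<open>v\<close> be a rotation eigenvector of weight \<open>j\<close> and
  \<open>u\<close> its image under the reflection \<open>B\<close>; then \<open>u\<close> has weight
  \<open>- j\<close>, and the span of both is stable. If \<open>j\<close> and \<open>- j\<close>
  agree modulo \<open>m\<close>, there is a common eigenvector of the whole group, so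
  \<open>n = 1\<close>. Otherwise \<open>n = 2\<close> and the traces are read off in the basis
  \<open>v\<close>, \<open>u\<close>.\<close>

lemma character_in_dihedral_characters:
  assumes irr: "irreducible_representation m n \<rho>" and m: "0 < m"
  shows "(\<lambda>w\<in>carrier (dihedral_group m). mat_trace (\<rho> w)) \<in> dihedral_characters m"
proof -
  have rep: "representation m n \<rho>" and n: "0 < n"
    using irr by (auto simp: irreducible_representation_def)
  note D = representationD[OF rep m]
  obtain v j where v: "v \<in> carrier_vec n" "v \<noteq> 0\<^sub>v n" and j: "j < m"
    and Av: "\<And>z. z ^ m = 1 \<Longrightarrow> \<rho> (dih z 1) *\<^sub>v v = z ^ j \<cdot>\<^sub>v v"
    using rotation_eigenvector[OF rep m n] by blast
  define B where "B = \<rho> (dih 1 (-1))"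
  define u where "u = B *\<^sub>v v"
  have C: "z ^ m = 1 \<Longrightarrow> dih z 1 \<in> carrier (dihedral_group m)"
    "dih 1 (-1) \<in> carrier (dihedral_group m)" for z
    by (simp_all add: dih_in_carrier m)
  have A: "z ^ m = 1 \<Longrightarrow> \<rho> (dih z 1) \<in> carrier_mat n n" for z
    using C D(1) by blast
  have B: "B \<in> carrier_mat n n"
    using C D(1) by (auto simp: B_def)
  have u: "u \<in> carrier_vec n"
    using B v by (simp add: u_def)
  have AB: "z ^ m = 1 \<Longrightarrow> \<rho> (dih z (-1)) = \<rho> (dih z 1) * B" for z
    using D(2)[of "dih z 1" "dih 1 (-1)"] C by (simp add: B_def dih_decompose(1)[of z])
  have BA: "B * \<rho> (dih z 1) = \<rho> (dih (cnj z) 1) * B" if z: "z ^ m = 1" for z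
  proof -
    have "cnj z ^ m = 1"
      using z by (simp flip: complex_cnj_power)
    then show ?thesis
      using D(2)[of "dih 1 (-1)" "dih z 1"] D(2)[of "dih (cnj z) 1" "dih 1 (-1)"] C z
      by (simp add: B_def dih_decompose(2))
  qed
  have BB: "B * B = 1\<^sub>m n"
    using D(2)[of "dih 1 (-1)" "dih 1 (-1)"] C D(3) by (simp add: B_def dih_mult)
  have Bu: "B *\<^sub>v u = v"
    using B v BB by (simp add: u_def flip: assoc_mult_mat_vec)
  have Au: "\<rho> (dih z 1) *\<^sub>v u = cnj z ^ j \<cdot>\<^sub>v u" if z: "z ^ m = 1" for z
  proof -
    have z': "cnj z ^ m = 1"
      using z by (simp flip: complex_cnj_power)
    have "\<rho> (dih z 1) *\<^sub>v u = (\<rho> (dih (cnj (cnj z)) 1) * B) *\<^sub>v v"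
      using A[OF z] B v by (simp add: u_def)
    also have "\<dots> = B *\<^sub>v (\<rho> (dih (cnj z) 1) *\<^sub>v v)"
      using A[OF z'] B v by (simp only: BA[OF z', symmetric]) (simp add: assoc_mult_mat_vec)
    also have "\<dots> = cnj z ^ j \<cdot>\<^sub>v u"
      using B v by (simp add: Av z' u_def mult_mat_vec)
    finally show ?thesis .
  qed
  show ?thesis
  proof (cases "j = 0 \<or> 2 * j = m")
    case True
    have zj: "cnj z ^ j = z ^ j" if z: "z ^ m = 1" for z
    proof (cases "j = 0")
      case False
      with True have "z ^ j * z ^ j = 1"
        using z by (simp flip: power_add) (simp add: mult_2)
      moreover have "z ^ j * cnj z ^ j = 1"
        using cnj_root_of_unity[OF z m] by (simp flip: power_mult_distrib)
      ultimately show ?thesis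
        by (metis inverse_unique)
    qed auto
    \<comment> \<open>Either \<open>v + u\<close> is a nonzero vector fixed by \<open>B\<close>, or
      it vanishes and \<open>B\<close> acts on \<open>v\<close> by -1.\<close>
    obtain w s where w: "w \<in> carrier_vec n" "w \<noteq> 0\<^sub>v n" and s: "s = 1 \<or> s = -1"
      and Aw: "\<And>z. z ^ m = 1 \<Longrightarrow> \<rho> (dih z 1) *\<^sub>v w = z ^ j \<cdot>\<^sub>v w" and Bw: "B *\<^sub>v w = s \<cdot>\<^sub>v w"
    proof (cases "v + u = 0\<^sub>v n")
      case True
      then have "u = (-1) \<cdot>\<^sub>v v"
      proof (intro eq_vecI)
        fix i
        assume "i < dim_vec ((-1) \<cdot>\<^sub>v v)"
        then show "u $ i = ((-1) \<cdot>\<^sub>v v) $ i"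
          using arg_cong[OF True, of "\<lambda>x. x $ i"] u v by (simp add: add_eq_0_iff)
      qed (use u v in simp)
      then show ?thesis
        using that[of v "-1"] v Av by (auto simp: u_def)
    next
      case False
      have "B *\<^sub>v (v + u) = v + u"
        using B v u Bu by (simp add: mult_add_distrib_mat_vec u_def[symmetric] comm_add_vec)
      moreover have "\<rho> (dih z 1) *\<^sub>v (v + u) = z ^ j \<cdot>\<^sub>v (v + u)" if z: "z ^ m = 1" for z
        using A[OF z] v u Av[OF z] Au[OF z] zj[OF z] by (simp add: mult_add_distrib_mat_vec smult_add_distrib_vec)
      ultimately show ?thesis
        using that[of "v + u" 1] False u v by auto
    qed
    have ABw: "\<rho> (dih z (-1)) *\<^sub>v w = (s * z ^ j) \<cdot>\<^sub>v w" if z: "z ^ m = 1" for z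
      using A[OF z] B w by (simp add: AB z Bw mult_mat_vec Aw smult_smult_assoc)
    have "\<exists>a. x = a \<cdot>\<^sub>v w" if x: "x \<in> carrier_vec n" for x
    proof -
      have "\<exists>a b. \<rho> g *\<^sub>v w = a \<cdot>\<^sub>v w + b \<cdot>\<^sub>v 0\<^sub>v n" if g: "g \<in> carrier (dihedral_group m)" for g
      proof -
        obtain z t where "g = dih z t" "z ^ m = 1" "t = 1 \<or> t = -1"
          using g m by (rule carrier_dihedral_groupE)
        then have "\<exists>a. \<rho> g *\<^sub>v w = a \<cdot>\<^sub>v w"
          using Aw ABw by auto
        moreover have "a \<cdot>\<^sub>v w = a \<cdot>\<^sub>v w + 0 \<cdot>\<^sub>v 0\<^sub>v n" for a
          using w by (intro eq_vecI) auto
        ultimately show ?thesis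
          by metis
      qed
      moreover have "\<exists>a b. \<rho> g *\<^sub>v 0\<^sub>v n = a \<cdot>\<^sub>v w + b \<cdot>\<^sub>v 0\<^sub>v n" if "g \<in> carrier (dihedral_group m)" for g
      proof -
        have "\<rho> g *\<^sub>v 0\<^sub>v n = 0 \<cdot>\<^sub>v w + 0 \<cdot>\<^sub>v 0\<^sub>v n"
          using D(1)[OF that] w by (intro eq_vecI) (auto simp: scalar_prod_def)
        then show ?thesis
          by blast
      qed
      ultimately obtain a b where "x = a \<cdot>\<^sub>v w + b \<cdot>\<^sub>v 0\<^sub>v n"
        using irreducible_representation_spanI[OF irr w zero_carrier_vec _ D(1) x] by blast
      moreover have "a \<cdot>\<^sub>v w + b \<cdot>\<^sub>v 0\<^sub>v n = a \<cdot>\<^sub>v w" for a b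
        using w by (intro eq_vecI) auto
      ultimately show ?thesis
        by metis
    qed
    then have n1: "n = 1"
      using dimension_le_one[of n w] w(1) n by force
    have w0: "w $ 0 \<noteq> 0"
      using w n1 by (metis One_nat_def carrier_vecD eq_vecI index_zero_vec(1) index_zero_vec(2) less_Suc0)
    have tr: "mat_trace M = c" if "M \<in> carrier_mat n n" "M *\<^sub>v w = c \<cdot>\<^sub>v w" for M c
    proof -
      have "(M *\<^sub>v w) $ 0 = M $$ (0, 0) * w $ 0"
        using that(1) w(1) n1 by (auto simp: scalar_prod_def)
      then show ?thesis
        using that w w0 n1 by (simp add: mat_trace_def)
    qed
    have t1: "mat_trace (\<rho> (dih z 1)) = z ^ j" if "z ^ m = 1" for z
      using tr A Aw that by blast
    have t2: "mat_trace (\<rho> (dih z (-1))) = s * z ^ j" if z: "z ^ m = 1" for z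
    proof -
      have "\<rho> (dih z (-1)) \<in> carrier_mat n n"
        using A[OF z] B AB[OF z] by simp
      then show ?thesis
        using tr ABw[OF z] by blast
    qed
    note eq = restrict_charI[OF m, of "\<lambda>w. mat_trace (\<rho> w)"]
    show ?thesis
    proof (cases "j = 0")
      case True
      have "(\<lambda>w\<in>carrier (dihedral_group m). mat_trace (\<rho> w)) = trivial_char m" if "s = 1"
        using that True m by (intro eq) (simp_all add: t1 t2 char_values)
      moreover have "(\<lambda>w\<in>carrier (dihedral_group m). mat_trace (\<rho> w)) = sign_char m" if "s = -1"
        using that True m by (intro eq) (simp_all add: t1 t2 char_values)
      ultimately show ?thesis
        using s by (auto simp: dihedral_characters_def)
    next
      case False
      with \<open>j = 0 \<or> 2 * j = m\<close> have "even m" "m div 2 = j"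
        by auto
      then have "(\<lambda>w\<in>carrier (dihedral_group m). mat_trace (\<rho> w)) = half_char m s"
        using m by (intro eq) (simp_all add: t1 t2 char_values)
      then show ?thesis
        using s \<open>even m\<close> by (auto simp: dihedral_characters_def)
    qed
  next
    case False
    define \<zeta> where "\<zeta> = cis (2 * pi / real m)"
    have \<zeta>m: "\<zeta> ^ m = 1"
      using m by (simp add: \<zeta>_def Complex.DeMoivre)
    \<comment> \<open>Equality would make \<open>2 * j\<close> a multiple of \<open>m\<close>
      strictly between 0 and \<open>2 * m\<close>, hence equal to \<open>m\<close>, which is
      excluded in this branch.\<close>
    have \<zeta>j: "\<zeta> ^ j \<noteq> cnj \<zeta> ^ j"
    proof
      assume "\<zeta> ^ j = cnj \<zeta> ^ j"
      then have "\<zeta> ^ (2 * j) = \<zeta> ^ j * cnj \<zeta> ^ j"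
        by (simp add: mult_2 power_add)
      also have "\<dots> = 1"
        using cnj_root_of_unity[OF \<zeta>m m] by (simp flip: power_mult_distrib)
      finally have "cis (2 * pi * (real (2 * j) / real m)) = 1"
        by (simp add: \<zeta>_def Complex.DeMoivre mult_ac)
      then have "cos (2 * pi * (real (2 * j) / real m)) = 1"
        by (metis cis.sel(1) one_complex.sel(1))
      then obtain k :: int where "2 * pi * (real (2 * j) / real m) = of_int k * 2 * pi"
        using cos_one_2pi_int by auto
      then have "real (2 * j) = of_int k * real m"
        using m by (simp add: field_simps)
      then have k: "int (2 * j) = k * int m"
        by (metis of_int_eq_iff of_int_mult of_int_of_nat_eq)
      moreover have "0 < int (2 * j)" "int (2 * j) < 2 * int m"
        using j False by auto
      ultimately have "0 < k" "k < 2"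
        using m by (auto simp: zero_less_mult_iff)
      then have "k = 1"
        by simp
      then show False
        using k False by simp
    qed
    have Bv: "B *\<^sub>v v = u"
      by (simp add: u_def)
    have refl_v: "\<rho> (dih z (-1)) *\<^sub>v v = cnj z ^ j \<cdot>\<^sub>v u" "\<rho> (dih z (-1)) *\<^sub>v u = z ^ j \<cdot>\<^sub>v v"
      if z: "z ^ m = 1" for z
      using A[OF z] B v u by (simp_all add: AB z Bu Bv Au Av)
    have span: "\<exists>a b. x = a \<cdot>\<^sub>v v + b \<cdot>\<^sub>v u" if x: "x \<in> carrier_vec n" for x
    proof -
      have e: "c \<cdot>\<^sub>v v = c \<cdot>\<^sub>v v + 0 \<cdot>\<^sub>v u" "c \<cdot>\<^sub>v u = 0 \<cdot>\<^sub>v v + c \<cdot>\<^sub>v u" for c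
        using v u by (auto intro!: eq_vecI)
      have "(\<exists>a b. \<rho> g *\<^sub>v v = a \<cdot>\<^sub>v v + b \<cdot>\<^sub>v u) \<and> (\<exists>a b. \<rho> g *\<^sub>v u = a \<cdot>\<^sub>v v + b \<cdot>\<^sub>v u)"
        if g: "g \<in> carrier (dihedral_group m)" for g
      proof -
        obtain z t where "g = dih z t" "z ^ m = 1" "t = 1 \<or> t = -1"
          using g m by (rule carrier_dihedral_groupE)
        then show ?thesis
          using Av Au refl_v e by metis
      qed
      then show ?thesis
        using irreducible_representation_spanI[OF irr v u _ D(1) x] by metis
    qed
    have "n \<noteq> 1"
    proof
      assume n1: "n = 1"
      have eig: "M $$ (0, 0) = (c :: complex)" if "M \<in> carrier_mat n n" "M *\<^sub>v x = c \<cdot>\<^sub>v x" "x \<in> carrier_vec n" "x \<noteq> 0\<^sub>v n" for M c x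
      proof -
        have "(M *\<^sub>v x) $ 0 = M $$ (0, 0) * x $ 0"
          using that(1,3) n1 by (auto simp: scalar_prod_def)
        moreover have "x $ 0 \<noteq> 0"
          using that n1 by (metis One_nat_def carrier_vecD eq_vecI index_zero_vec(1) index_zero_vec(2) less_Suc0)
        moreover have "(M *\<^sub>v x) $ 0 = c * x $ 0"
          using that n1 by simp
        ultimately show ?thesis
          by simp
      qed
      have "u \<noteq> 0\<^sub>v n"
      proof
        assume "u = 0\<^sub>v n"
        then have "B *\<^sub>v u = 0\<^sub>v n"
          using B by (intro eq_vecI) (auto simp: scalar_prod_def)
        then show False
          using Bu v by simp
      qed
      then show False
        using eig[OF A[OF \<zeta>m] Av[OF \<zeta>m] v] eig[OF A[OF \<zeta>m] Au[OF \<zeta>m] u] \<zeta>j by simp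
    qed
    moreover have "n \<le> 2"
      using span v(1) u by (rule span_two_vectors(1))
    ultimately have n2: "n = 2"
      using n by simp
    have det: "v $ 0 * u $ 1 - v $ 1 * u $ 0 \<noteq> 0"
      using span_two_vectors(2)[OF span v(1) u n2] by simp
    have v2: "v \<in> carrier_vec 2" "u \<in> carrier_vec 2"
      using v u n2 by auto
    have t1: "mat_trace (\<rho> (dih z 1)) = z ^ j + cnj z ^ j" if z: "z ^ m = 1" for z
    proof -
      have "mat_trace (\<rho> (dih z 1)) * (v $ 0 * u $ 1 - v $ 1 * u $ 0)
          = (z ^ j + cnj z ^ j) * (v $ 0 * u $ 1 - v $ 1 * u $ 0)"
        using A[OF z] v2 n2
        by (subst mat_trace_two) (auto simp: Av Au z algebra_simps)
      then show ?thesis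
        using det by simp
    qed
    have t2: "mat_trace (\<rho> (dih z (-1))) = 0" if z: "z ^ m = 1" for z
    proof -
      have "\<rho> (dih z (-1)) \<in> carrier_mat 2 2"
        using A[OF z] B AB[OF z] n2 by simp
      then have "mat_trace (\<rho> (dih z (-1))) * (v $ 0 * u $ 1 - v $ 1 * u $ 0) = 0"
        using v2 by (subst mat_trace_two) (auto simp: refl_v z algebra_simps)
      then show ?thesis
        using det by simp
    qed
    note eq = restrict_charI[OF m, of "\<lambda>w. mat_trace (\<rho> w)"]
    show ?thesis
    proof (cases "2 * j < m")
      case True
      then have "(\<lambda>w\<in>carrier (dihedral_group m). mat_trace (\<rho> w)) = rot_char m j"
        using m by (intro eq) (simp_all add: t1 t2 char_values)
      then show ?thesis
        using True False by (auto simp: dihedral_characters_def)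
    next
      case False
      \<comment> \<open>The weights \<open>j\<close> and \<open>- j\<close> occur together, so
        \<open>j\<close> may be replaced by \<open>m - j\<close>, which lies below
        \<open>m / 2\<close>.\<close>
      have "z ^ j + cnj z ^ j = z ^ (m - j) + cnj z ^ (m - j)" if z: "z ^ m = 1" for z
      proof -
        have a: "z ^ j * z ^ (m - j) = 1"
          using z j by (simp flip: power_add)
        then have a': "cnj z ^ j * cnj z ^ (m - j) = 1"
          by (metis complex_cnj_mult complex_cnj_one complex_cnj_power)
        have "z ^ j * cnj z ^ j = 1"
          using cnj_root_of_unity[OF z m] by (simp flip: power_mult_distrib)
        then have "z ^ (m - j) = cnj z ^ j" "cnj z ^ (m - j) = z ^ j"
          using a a' by (metis inverse_unique mult.commute)+
        then show ?thesis
          by simp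
      qed
      then have "(\<lambda>w\<in>carrier (dihedral_group m). mat_trace (\<rho> w)) = rot_char m (m - j)"
        using m by (intro eq) (simp_all add: t1 t2 char_values)
      then show ?thesis
        using False \<open>\<not> (j = 0 \<or> 2 * j = m)\<close> j by (auto simp: dihedral_characters_def)
    qed
  qed
qed


section \<open>Irreducibility of the listed characters\<close>

lemma subspace_vecD:
  assumes "subspace class_ring U (module_vec TYPE(complex) n)"
  shows "U \<subseteq> carrier_vec n" and "0\<^sub>v n \<in> U" and "x \<in> U \<Longrightarrow> c \<cdot>\<^sub>v x \<in> U"
    and "x \<in> U \<Longrightarrow> y \<in> U \<Longrightarrow> x + y \<in> U"
proof -
  have sub: "submodule class_ring U (module_vec TYPE(complex) n)"
    using assms by (simp add: subspace_def)
  show "U \<subseteq> carrier_vec n"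
    using submodule.subset[OF sub] by (simp add: module_vec_simps)
  show "0\<^sub>v n \<in> U"
    using submodule.zero_closed[OF sub] by (simp add: module_vec_simps)
  show "x \<in> U \<Longrightarrow> y \<in> U \<Longrightarrow> x + y \<in> U"
    using submodule.m_closed[OF sub] by (simp add: module_vec_simps)
  show "x \<in> U \<Longrightarrow> c \<cdot>\<^sub>v x \<in> U"
    using submodule.smult_closed[OF sub, of c x] by (simp add: module_vec_simps class_ring_simps)
qed

lemma linear_character_in_Irr:
  assumes m: "0 < m"
    and mult: "\<And>z s z' s'. z ^ m = 1 \<Longrightarrow> s = 1 \<or> s = -1 \<Longrightarrow> z' ^ m = 1 \<Longrightarrow> s' = 1 \<or> s' = -1
      \<Longrightarrow> c (dih (z * (if s = 1 then z' else cnj z')) (s * s')) = c (dih z s) * c (dih z' s')"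
    and one: "c (dih 1 1) = 1" and ext: "c \<in> extensional (carrier (dihedral_group m))"
  shows "c \<in> Irr m"
proof -
  define \<rho> where "\<rho> w = mat 1 1 (\<lambda>_. c w)" for w
  have "representation m 1 \<rho>"
    using one by (intro representationI[OF m])
      (auto simp: \<rho>_def mult scalar_prod_def intro!: eq_matI)
  moreover have "U = {0\<^sub>v 1} \<or> U = carrier_vec 1"
    if U: "subspace class_ring U (module_vec TYPE(complex) 1)" for U
  proof (cases "U \<subseteq> {0\<^sub>v 1}")
    case True
    then show ?thesis
      using subspace_vecD(2)[OF U] by auto
  next
    case False
    then obtain x where x: "x \<in> U" "x \<noteq> 0\<^sub>v 1"
      by auto
    then have xc: "x \<in> carrier_vec 1"
      using subspace_vecD(1)[OF U] by auto
    then have x0: "x $ 0 \<noteq> 0"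
      using x(2) by (auto intro!: eq_vecI)
    have "y \<in> U" if "y \<in> carrier_vec 1" for y
    proof -
      have "y = (y $ 0 / x $ 0) \<cdot>\<^sub>v x"
        using that xc x0 by (intro eq_vecI) auto
      then show ?thesis
        using subspace_vecD(3)[OF U x(1)] by metis
    qed
    then show ?thesis
      using subspace_vecD(1)[OF U] by auto
  qed
  ultimately have "irreducible_representation m 1 \<rho>"
    by (auto simp: irreducible_representation_def)
  moreover have "(\<lambda>w\<in>carrier (dihedral_group m). mat_trace (\<rho> w)) = c"
    using ext by (intro restrict_charI[OF m]) (auto simp: \<rho>_def mat_trace_def)
  ultimately show ?thesis
    unfolding Irr_def by (intro CollectI exI[of _ 1] exI[of _ \<rho>]) auto
qed

text \<open>In a basis of rotation eigenvectors, rotations are diagonal and reflections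
  antidiagonal. Since \<open>0 < 2 * i < m\<close>, the generating rotation separates the two axes,
  so a nonzero stable subspace contains one basis vector, and the swap yields the other.\<close>

lemma rot_char_in_Irr:
  assumes m: "0 < m" and i: "1 \<le> i" "2 * i < m"
  shows "rot_char m i \<in> Irr m"
proof -
  define \<rho> :: "complex mat \<Rightarrow> complex mat" where "\<rho> w = (let z = mat_arg w ^ i in
    if det w = 1 then mat_of_rows_list 2 [[z, 0], [0, cnj z]] else mat_of_rows_list 2 [[0, z], [cnj z, 0]])" for w
  have \<rho>: "\<rho> (dih z 1) = mat_of_rows_list 2 [[z ^ i, 0], [0, cnj z ^ i]]"
    "\<rho> (dih z (-1)) = mat_of_rows_list 2 [[0, z ^ i], [cnj z ^ i, 0]]" if "z ^ m = 1" for z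
    using norm_root_of_unity[OF that m] by (auto simp: \<rho>_def)
  have \<rho>_dim: "dim_row (\<rho> w) = 2" "dim_col (\<rho> w) = 2" for w
    by (auto simp: \<rho>_def mat_of_rows_list_def Let_def)
  have prod: "(z * z') ^ m = 1" "(z * cnj z') ^ m = 1" if "z ^ m = 1" "z' ^ m = 1" for z z' :: complex
    using that by (simp_all add: power_mult_distrib flip: complex_cnj_power)
  have "representation m 2 \<rho>"
  proof (rule representationI[OF m])
    show "\<rho> (dih z s) \<in> carrier_mat 2 2" for z s
      using \<rho>_dim by auto
    show "\<rho> (dih 1 1) = 1\<^sub>m 2"
      by (rule eq_matI) (auto simp: \<rho> mat_of_rows_list_def dest!: less_two_cases)
    fix z s z' s' :: complex
    assume z: "z ^ m = 1" "s = 1 \<or> s = -1" "z' ^ m = 1" "s' = 1 \<or> s' = -1"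
    show "\<rho> (dih (z * (if s = 1 then z' else cnj z')) (s * s')) = \<rho> (dih z s) * \<rho> (dih z' s')"
    proof (rule eq_matI)
      fix k l
      assume "k < dim_row (\<rho> (dih z s) * \<rho> (dih z' s'))" "l < dim_col (\<rho> (dih z s) * \<rho> (dih z' s'))"
      then have "k = 0 \<or> k = Suc 0" "l = 0 \<or> l = Suc 0"
        by (auto simp: \<rho>_dim)
      then show "\<rho> (dih (z * (if s = 1 then z' else cnj z')) (s * s')) $$ (k, l)
          = (\<rho> (dih z s) * \<rho> (dih z' s')) $$ (k, l)"
        using z(2,4) prod[OF z(1,3)]
        by (elim disjE; simp add: \<rho> z mat_of_rows_list_def scalar_prod_def numeral_2_eq_2 power_mult_distrib)
    qed (auto simp: \<rho>_dim)
  qed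
  moreover have "U = {0\<^sub>v 2} \<or> U = carrier_vec 2"
    if U: "subspace class_ring U (module_vec TYPE(complex) 2)"
      and stable: "\<And>w u. w \<in> carrier (dihedral_group m) \<Longrightarrow> u \<in> U \<Longrightarrow> \<rho> w *\<^sub>v u \<in> U" for U
  proof (cases "U \<subseteq> {0\<^sub>v 2}")
    case True
    then show ?thesis
      using subspace_vecD(2)[OF U] by auto
  next
    case False
    note US = subspace_vecD[OF U]
    have vec2: "x = y \<longleftrightarrow> x $ 0 = y $ 0 \<and> x $ 1 = y $ 1"
      if "x \<in> carrier_vec 2" "y \<in> carrier_vec 2" for x y :: "complex vec"
      using that by (auto intro!: eq_vecI dest!: less_two_cases)
    define swap :: "complex vec \<Rightarrow> complex vec" where "swap x = \<rho> (dih 1 (-1)) *\<^sub>v x" for x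
    have swap: "swap x $ 0 = x $ 1" "swap x $ 1 = x $ 0" "swap x \<in> carrier_vec 2"
      if "x \<in> carrier_vec 2" for x
      using that \<rho>_dim[of "dih 1 (-1)"] unfolding swap_def carrier_vec_def
      by (auto simp: \<rho> mat_of_rows_list_def scalar_prod_def numeral_2_eq_2)
    have swapU: "swap x \<in> U" if "x \<in> U" for x
      unfolding swap_def using stable dih_in_carrier[OF m, of 1 "-1"] that by simp
    obtain x where x: "x \<in> U" "x $ 0 \<noteq> 0"
    proof -
      obtain x where x: "x \<in> U" "x \<noteq> 0\<^sub>v 2"
        using False by auto
      then have xc: "x \<in> carrier_vec 2"
        using US(1) by auto
      then have "x $ 0 \<noteq> 0 \<or> x $ 1 \<noteq> 0"
        using x(2) vec2[of x "0\<^sub>v 2"] by auto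
      then show ?thesis
        using that[of x] that[of "swap x"] x swapU swap(1)[OF xc] by auto
    qed
    have xc: "x \<in> carrier_vec 2"
      using x US(1) by auto
    define \<zeta> where "\<zeta> = cis (2 * pi / real m)"
    have \<zeta>m: "\<zeta> ^ m = 1"
      using m by (simp add: \<zeta>_def Complex.DeMoivre)
    have \<zeta>i: "\<zeta> ^ i \<noteq> cnj \<zeta> ^ i"
    proof -
      have "Im (\<zeta> ^ i) = sin (2 * pi * real i / real m)"
        by (simp add: \<zeta>_def Complex.DeMoivre mult_ac)
      also have "\<dots> > 0"
      proof (rule sin_gt_zero)
        show "0 < 2 * pi * real i / real m"
          using i m by simp
        have "2 * real i < real m"
          using i(2) by linarith
        then show "2 * pi * real i / real m < pi"
          using m by (simp add: divide_simps)
      qed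
      finally have "Im (\<zeta> ^ i) \<noteq> Im (cnj (\<zeta> ^ i))"
        by (simp del: complex_cnj_power)
      then show ?thesis
        by (metis complex_cnj_power)
    qed
    \<comment> \<open>Subtracting the second eigenvalue annihilates the second coordinate of
      \<open>x\<close>; the scalar normalises the first one to 1.\<close>
    define e0 where "e0 = inverse ((\<zeta> ^ i - cnj \<zeta> ^ i) * x $ 0) \<cdot>\<^sub>v (\<rho> (dih \<zeta> 1) *\<^sub>v x + (- (cnj \<zeta> ^ i)) \<cdot>\<^sub>v x)"
    have e0U: "e0 \<in> U"
      unfolding e0_def using stable[OF _ x(1)] dih_in_carrier[OF m \<zeta>m, of 1] x(1) by (intro US(3) US(4)) auto
    have \<zeta>x: "(\<rho> (dih \<zeta> 1) *\<^sub>v x) $ 0 = \<zeta> ^ i * x $ 0" "(\<rho> (dih \<zeta> 1) *\<^sub>v x) $ 1 = cnj \<zeta> ^ i * x $ 1"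
      "\<rho> (dih \<zeta> 1) *\<^sub>v x \<in> carrier_vec 2"
      using xc \<rho>_dim[of "dih \<zeta> 1"] unfolding carrier_vec_def
      by (auto simp: \<rho> \<zeta>m mat_of_rows_list_def scalar_prod_def numeral_2_eq_2)
    have e0c: "e0 \<in> carrier_vec 2"
      using e0U US(1) by auto
    have "e0 $ 0 = inverse ((\<zeta> ^ i - cnj \<zeta> ^ i) * x $ 0) * ((\<zeta> ^ i - cnj \<zeta> ^ i) * x $ 0)"
      using \<zeta>x xc by (simp add: e0_def algebra_simps)
    also have "\<dots> = 1"
      using x(2) \<zeta>i by (intro left_inverse) auto
    finally have e00: "e0 $ 0 = 1" .
    have e01: "e0 $ 1 = 0"
      using \<zeta>x xc by (simp add: e0_def)
    have "y \<in> U" if y: "y \<in> carrier_vec 2" for y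
    proof -
      have "y = y $ 0 \<cdot>\<^sub>v e0 + y $ 1 \<cdot>\<^sub>v swap e0"
        using y e0c swap[OF e0c] e00 e01 by (subst vec2) auto
      then show ?thesis
        using US(3,4) e0U swapU by metis
    qed
    then show ?thesis
      using US(1) by auto
  qed
  ultimately have "irreducible_representation m 2 \<rho>"
    by (auto simp: irreducible_representation_def)
  moreover have "(\<lambda>w\<in>carrier (dihedral_group m). mat_trace (\<rho> w)) = rot_char m i"
    using m by (intro restrict_charI)
      (auto simp: \<rho> \<rho>_dim char_values mat_trace_def mat_of_rows_list_def numeral_2_eq_2)
  ultimately show ?thesis
    unfolding Irr_def by (intro CollectI exI[of _ 2] exI[of _ \<rho>]) auto
qed

theorem Irr_eq:
  assumes m: "0 < m"
  shows "Irr m = dihedral_characters m"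
proof
  show "Irr m \<subseteq> dihedral_characters m"
    using character_in_dihedral_characters[OF _ m] by (auto simp: Irr_def)
  have prod: "(z * z') ^ m = 1" "(z * cnj z') ^ m = 1" if "z ^ m = 1" "z' ^ m = 1" for z z' :: complex
    using that by (simp_all add: power_mult_distrib flip: complex_cnj_power)
  have "trivial_char m \<in> Irr m"
    by (rule linear_character_in_Irr[OF m]) (use m prod in \<open>auto simp: char_values\<close>)
  moreover have "sign_char m \<in> Irr m"
    by (rule linear_character_in_Irr[OF m]) (use m prod in \<open>auto simp: char_values\<close>)
  moreover have "half_char m c \<in> Irr m" if "even m" and c: "c = 1 \<or> c = -1" for c
  proof (rule linear_character_in_Irr[OF m])
    have cnj: "cnj z ^ (m div 2) = z ^ (m div 2)" if z: "z ^ m = 1" for z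
    proof -
      have "z ^ (m div 2) * z ^ (m div 2) = 1"
        using z \<open>even m\<close> by (metis dvd_mult_div_cancel mult_2 power_add)
      moreover have "z ^ (m div 2) * cnj z ^ (m div 2) = 1"
        using cnj_root_of_unity[OF z m] by (simp flip: power_mult_distrib)
      ultimately show ?thesis
        by (metis inverse_unique)
    qed
    fix z s z' s' :: complex
    assume z: "z ^ m = 1" "s = 1 \<or> s = -1" "z' ^ m = 1" "s' = 1 \<or> s' = -1"
    show "half_char m c (dih (z * (if s = 1 then z' else cnj z')) (s * s'))
        = half_char m c (dih z s) * half_char m c (dih z' s')"
      using z(2,4) c prod[OF z(1,3)]
      by (elim disjE; simp add: char_values m z power_mult_distrib cnj)
  qed (use m in \<open>auto simp: char_values\<close>)
  ultimately show "dihedral_characters m \<subseteq> Irr m"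
    using rot_char_in_Irr[OF m] by (auto simp: dihedral_characters_def)
qed

section \<open>The matrix of fake degrees\<close>

lemma const_uminus_one [simp]: "const (-1) = -1"
  by (simp add: const_minus)

lemma numeral_fract_nonzero [simp]: "(numeral n :: complex poly fract) \<noteq> 0"
  using of_nat_fract_nonzero[of "numeral n"] by simp

lemma const_half [simp]: "const (1/2) = 1/2"
proof -
  have "2 * const (1/2) = const (2 * (1/2))"
    by (simp only: const_mult) (use const_of_nat[of 2] in simp)
  then have "2 * const (1/2) = 1"
    by simp
  then show ?thesis
    by (simp add: field_simps)
qed

lemma add_halves: "x / 2 + x / 2 = (x :: complex poly fract)"
  by (metis mult_2 nonzero_mult_div_cancel_left add_divide_distrib numeral_fract_nonzero)

lemma R_trivial_char: "0 < m \<Longrightarrow> R m (trivial_char m) = 1"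
  using R_trigonometric[of m 0 0 0 "trivial_char m" "1/2" 0 1]
  by (simp add: char_values field_simps)

lemma R_sign_char: "0 < m \<Longrightarrow> R m (sign_char m) = q ^ m"
  using R_trigonometric[of m 0 0 0 "sign_char m" "1/2" 0 "-1"]
  by (simp add: char_values field_simps)

lemma R_rot_char: "0 < m \<Longrightarrow> i \<le> m \<Longrightarrow> R m (rot_char m i) = q ^ i + q ^ (m - i)"
  using R_trigonometric[of m i 0 0 "rot_char m i" 1 0 0]
  by (simp add: char_values)

lemma half_power_cnj:
  assumes "z ^ (2 * r) = 1" and "0 < r"
  shows "cnj z ^ r = z ^ r" and "z ^ r * z ^ r = (1 :: complex)"
proof -
  show "z ^ r * z ^ r = 1"
    using assms(1) by (metis mult_2 power_add)
  moreover have "z ^ r * cnj z ^ r = 1"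
    using cnj_root_of_unity[OF assms(1)] assms(2) by (simp flip: power_mult_distrib)
  ultimately show "cnj z ^ r = z ^ r"
    by (metis inverse_unique)
qed

text \<open>As \<open>z ^ r\<close> is real, it is half the sum of itself and its conjugate. Over
  the reflections it sums to zero, so \<open>s\<close> drops out.\<close>

lemma R_half_char:
  assumes "0 < r"
  shows "R (2 * r) (half_char (2 * r) s) = q ^ r"
  using R_trigonometric[of "2 * r" r 0 r "half_char (2 * r) s" "1/2" 0 s] assms
  by (simp add: char_values half_power_cnj add_halves)

text \<open>Up to the factors \<open>q ^ m - 1\<close> and \<open>q ^ b m \<chi>\<close>, the Schur complement of the sign character in
  \<open>Omega\<close> is the covariance matrix of a random walk whose value at level \<open>i\<close> has variance
  \<open>1 + q ^ (m - 2 * i)\<close>. At level \<open>m / 2\<close> it splits into two independent summands of variance \<open>1\<close>.\<close>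

definition kappa :: "nat \<Rightarrow> (complex mat \<Rightarrow> complex) \<Rightarrow> complex poly fract" where
  "kappa m \<chi> = (if 2 * b m \<chi> = m then 1 else 1 + q ^ (m - 2 * b m \<chi>))"

text \<open>The covariance of two variables of the walk is the variance of the later one, their
  difference being independent of it. Apart from the sign character, distinct characters share a
  b-value only at level \<open>m / 2\<close>, where they stand for independent variables; hence the
  0.\<close>

definition tree_kernel :: "nat \<Rightarrow> (complex mat \<Rightarrow> complex) \<Rightarrow> (complex mat \<Rightarrow> complex) \<Rightarrow> complex poly fract" where
  "tree_kernel m \<chi> \<chi>' = (if b m \<chi> < b m \<chi>' then kappa m \<chi>' else if b m \<chi>' < b m \<chi> then kappa m \<chi>
     else if \<chi> = \<chi>' then kappa m \<chi> else 0)"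

lemma b_eqI:
  assumes "R m \<chi> = q ^ i * to_fract p" and "poly p 0 \<noteq> 0"
  shows "b m \<chi> = i"
  unfolding b_def
proof (rule Greatest_equality)
  show "divisible_by_q_power i (R m \<chi>)"
    using assms(1) by (auto simp: divisible_by_q_power_def)
  fix k
  assume "divisible_by_q_power k (R m \<chi>)"
  then obtain f where f: "q ^ i * to_fract p = q ^ k * to_fract f"
    using assms(1) by (auto simp: divisible_by_q_power_def)
  show "k \<le> i"
  proof (rule ccontr)
    assume "\<not> k \<le> i"
    then have "k = i + Suc (k - Suc i)"
      by simp
    then have "q ^ k = q ^ i * q ^ Suc (k - Suc i)"
      by (metis power_add)
    then have "to_fract p = q ^ Suc (k - Suc i) * to_fract f"
      using f by (simp only: mult.assoc mult_left_cancel[OF power_not_zero[OF q_nonzero]])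
    then have "p = monom 1 (Suc (k - Suc i)) * f"
      by (metis q_power to_fract_eq_iff to_fract_mult)
    then show False
      using assms(2) by (simp add: poly_monom)
  qed
qed

lemma b_values:
  assumes "0 < m"
  shows "b m (trivial_char m) = 0" and "b m (sign_char m) = m"
    and "2 * i < m \<Longrightarrow> b m (rot_char m i) = i"
    and "even m \<Longrightarrow> b m (half_char m s) = m div 2"
proof -
  show "b m (trivial_char m) = 0"
    by (rule b_eqI[of _ _ _ 1]) (use assms in \<open>auto simp: R_trivial_char\<close>)
  show "b m (sign_char m) = m"
    by (rule b_eqI[of _ _ _ 1]) (use assms in \<open>auto simp: R_sign_char\<close>)
  show "b m (rot_char m i) = i" if "2 * i < m"
  proof (rule b_eqI)
    have "m - i = i + (m - 2 * i)"
      using that by simp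
    then have "q ^ (m - i) = q ^ i * q ^ (m - 2 * i)"
      by (metis power_add)
    then show "R m (rot_char m i) = q ^ i * to_fract (1 + monom 1 (m - 2 * i))"
      using assms that by (simp add: R_rot_char distrib_left flip: q_power)
    show "poly (1 + monom 1 (m - 2 * i) :: complex poly) 0 \<noteq> 0"
      using that by (simp add: poly_monom zero_power)
  qed
  show "b m (half_char m s) = m div 2" if even: "even m"
  proof -
    obtain r where "m = 2 * r"
      using even by blast
    then show ?thesis
      using assms by (intro b_eqI[of _ _ _ 1]) (auto simp: R_half_char)
  qed
qed

lemma power_mult_power_inverse:
  assumes "x * y = (1 :: 'a :: comm_monoid_mult)" and "i \<le> j"
  shows "x ^ i * y ^ j = y ^ (j - i)"
proof -
  have "y ^ j = y ^ i * y ^ (j - i)"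
    using assms(2) by (simp flip: power_add)
  moreover have "x ^ i * y ^ i = 1"
    using assms(1) by (simp flip: power_mult_distrib)
  ultimately show ?thesis
    by (simp flip: mult.assoc)
qed

section \<open>Entries of the matrix \<open>Omega\<close>\<close>

lemma Omega_sym: "Omega m \<chi> \<chi>' = Omega m \<chi>' \<chi>"
  by (simp add: Omega_def mult_ac)

lemma Omega_trivial_trivial: "0 < m \<Longrightarrow> Omega m (trivial_char m) (trivial_char m) = q ^ m * q ^ m"
  using R_trigonometric[of m 0 0 0 "\<lambda>w. trivial_char m w * trivial_char m w * sign_char m w" "1/2" 0 "-1"]
  by (simp add: char_values Omega_def field_simps)

text \<open>Tensoring twice with the sign does nothing. Since the sign character itself has fake
  degree \<open>q ^ m\<close>, eliminating it from \<open>Omega\<close> subtracts exactly the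
  product of the two fake degrees.\<close>

lemma Omega_sign:
  assumes m: "0 < m" and "\<chi> \<in> Irr m"
  shows "Omega m \<chi> (sign_char m) = q ^ m * R m \<chi>"
proof -
  have "R m (\<lambda>w. \<chi> w * sign_char m w * sign_char m w) = R m \<chi>"
    using m by (simp add: R_eq_sums char_values)
  then show ?thesis
    by (simp add: Omega_def)
qed

lemma Omega_trivial_rot: "0 < m \<Longrightarrow> i \<le> m \<Longrightarrow> Omega m (trivial_char m) (rot_char m i) = q ^ m * (q ^ i + q ^ (m - i))"
  using R_trigonometric[of m i 0 0 "\<lambda>w. trivial_char m w * rot_char m i w * sign_char m w" 1 0 0]
  by (simp add: char_values Omega_def)

lemma Omega_trivial_half:
  assumes "0 < r"
  shows "Omega (2 * r) (trivial_char (2 * r)) (half_char (2 * r) s) = q ^ (2 * r) * q ^ r"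
  using R_trigonometric[of "2 * r" r 0 r
      "\<lambda>w. trivial_char (2 * r) w * half_char (2 * r) s w * sign_char (2 * r) w" "1/2" 0 "-s"] assms
  by (simp add: char_values Omega_def half_power_cnj add_halves)

text \<open>Product-to-sum formula for cosines; the reflections contribute nothing because rotation
  characters vanish there.\<close>

lemma Omega_rot_rot:
  assumes m: "0 < m" and "i + j \<le> m" "i \<le> j"
  shows "Omega m (rot_char m i) (rot_char m j)
    = q ^ m * (q ^ (i + j) + q ^ (m - (i + j)) + (q ^ (j - i) + q ^ (m - (j - i))))"
proof -
  have "(z ^ i + cnj z ^ i) * (z ^ j + cnj z ^ j)
     = 1 * (z ^ (i + j) + cnj z ^ (i + j)) + 1 * (z ^ (j - i) + cnj z ^ (j - i))" if z: "z ^ m = 1" for z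
  proof -
    have "z ^ i * cnj z ^ j = cnj z ^ (j - i)" "cnj z ^ i * z ^ j = z ^ (j - i)"
      using power_mult_power_inverse[of z "cnj z" i j] power_mult_power_inverse[of "cnj z" z i j]
        cnj_root_of_unity[OF z m] \<open>i \<le> j\<close> by (simp_all add: mult.commute[of "cnj z" z])
    then show ?thesis
      by (simp add: power_add algebra_simps)
  qed
  then show ?thesis
    using R_trigonometric[of m "i + j" "j - i" 0 "\<lambda>w. rot_char m i w * rot_char m j w * sign_char m w" 1 1 0] assms
    by (simp add: char_values Omega_def)
qed

lemma Omega_rot_half:
  assumes "i \<le> r" "0 < r"
  shows "Omega (2 * r) (rot_char (2 * r) i) (half_char (2 * r) s) = q ^ (2 * r) * (q ^ (r + i) + q ^ (r - i))"
proof -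
  have "(z ^ i + cnj z ^ i) * z ^ r
     = 1/2 * (z ^ (r + i) + cnj z ^ (r + i)) + 1/2 * (z ^ (r - i) + cnj z ^ (r - i))" if z: "z ^ (2 * r) = 1" for z
  proof -
    have 2: "cnj z ^ r = z ^ r"
      using half_power_cnj(1)[OF z] assms by simp
    have 3: "z ^ i * cnj z ^ r = cnj z ^ (r - i)" "cnj z ^ i * z ^ r = z ^ (r - i)"
      using power_mult_power_inverse[of z "cnj z" i r] power_mult_power_inverse[of "cnj z" z i r]
        cnj_root_of_unity[OF z] assms by (simp_all add: mult.commute[of "cnj z" z])
    have "1/2 * (z ^ (r + i) + cnj z ^ (r + i)) + 1/2 * (z ^ (r - i) + cnj z ^ (r - i))
        = 1/2 * (z ^ i * z ^ r + cnj z ^ i * cnj z ^ r + cnj z ^ i * z ^ r + z ^ i * cnj z ^ r)"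
      unfolding 3[symmetric] by (simp add: power_add algebra_simps)
    also have "\<dots> = (z ^ i + cnj z ^ i) * z ^ r"
      unfolding 2 by (simp add: algebra_simps)
    finally show ?thesis ..
  qed
  then have "R (2 * r) (\<lambda>w. rot_char (2 * r) i w * half_char (2 * r) s w * sign_char (2 * r) w)
      = 1/2 * (q ^ (r + i) + q ^ (2 * r - (r + i))) + 1/2 * (q ^ (r - i) + q ^ (2 * r - (r - i)))"
    using R_trigonometric[of "2 * r" "r + i" "r - i" 0
      "\<lambda>w. rot_char (2 * r) i w * half_char (2 * r) s w * sign_char (2 * r) w" "1/2" "1/2" 0] assms
    by (simp add: char_values)
  moreover have "2 * r - (r + i) = r - i" "2 * r - (r - i) = r + i"
    using assms by auto
  moreover have "1/2 * (q ^ (r + i) + q ^ (r - i)) + 1/2 * (q ^ (r - i) + q ^ (r + i)) = q ^ (r + i) + q ^ (r - i)"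
    by (simp add: field_simps)
  ultimately show ?thesis
    by (simp add: Omega_def)
qed

lemma Omega_half_half:
  assumes "0 < r" "s = 1 \<or> s = -1" "s' = 1 \<or> s' = -1"
  shows "Omega (2 * r) (half_char (2 * r) s) (half_char (2 * r) s')
    = q ^ (2 * r) * (if s = s' then q ^ (2 * r) else 1)"
proof -
  have "R (2 * r) (\<lambda>w. half_char (2 * r) s w * half_char (2 * r) s' w * sign_char (2 * r) w)
      = (if s = s' then q ^ (2 * r) else 1)"
    using R_trigonometric[of "2 * r" 0 0 0
      "\<lambda>w. half_char (2 * r) s w * half_char (2 * r) s' w * sign_char (2 * r) w" "1/2" 0
      "if s = s' then -1 else 1"] assms
    by (auto simp: char_values half_power_cnj field_simps)
  then show ?thesis
    by (simp add: Omega_def)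
qed

lemma half_char_neq: "0 < m \<Longrightarrow> half_char m 1 \<noteq> half_char m (-1)"
  using char_values(4)[of m 1 1] char_values(4)[of m 1 "-1"] by force

lemma Irr_cases:
  assumes m: "0 < m" and "\<chi> \<in> Irr m" "\<chi> \<noteq> sign_char m"
  obtains "\<chi> = trivial_char m" "b m \<chi> = 0"
  | i where "\<chi> = rot_char m i" "1 \<le> i" "2 * i < m" "b m \<chi> = i"
  | r s where "m = 2 * r" "0 < r" "\<chi> = half_char m s" "s = 1 \<or> s = -1" "b m \<chi> = r"
proof -
  have "\<chi> \<in> dihedral_characters m"
    using assms by (simp add: Irr_eq)
  then consider "\<chi> = trivial_char m" | i where "\<chi> = rot_char m i" "1 \<le> i" "2 * i < m"
    | s where "even m" "\<chi> = half_char m s" "s = 1 \<or> s = -1"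
    using assms(3) by (auto simp: dihedral_characters_def split: if_splits)
  then show ?thesis
  proof cases
    case 3
    then show ?thesis
      using m that(3)[of "m div 2" s] by (auto simp: b_values)
  qed (use m that in \<open>auto simp: b_values\<close>)
qed

definition kernel_formula :: "nat \<Rightarrow> (complex mat \<Rightarrow> complex) \<Rightarrow> (complex mat \<Rightarrow> complex) \<Rightarrow> bool" where
  "kernel_formula m \<chi> \<chi>' \<longleftrightarrow>
     Omega m \<chi> \<chi>' = R m \<chi> * R m \<chi>' + (q ^ m - 1) * q ^ (b m \<chi> + b m \<chi>') * tree_kernel m \<chi> \<chi>'"

lemma tree_kernel_sym: "tree_kernel m \<chi> \<chi>' = tree_kernel m \<chi>' \<chi>"
  by (auto simp: tree_kernel_def)

lemma kernel_formula_sym: "kernel_formula m \<chi> \<chi>' \<longleftrightarrow> kernel_formula m \<chi>' \<chi>"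
  by (simp add: kernel_formula_def Omega_sym[of m \<chi>] tree_kernel_sym[of m \<chi>] mult.commute add.commute)

lemma kernel_formula_trivial_rot:
  assumes "1 \<le> i" "2 * i < m"
  shows "kernel_formula m (trivial_char m) (rot_char m i)"
proof -
  \<comment> \<open>Expressing all exponents through \<open>i\<close> and \<open>d\<close> removes
    truncated subtraction and leaves an identity between monomials.\<close>
  obtain d where d: "m = 2 * i + d" "0 < d"
    using assms(2) less_imp_add_positive by blast
  have m: "0 < m"
    using assms by simp
  have K: "kernel_formula m (trivial_char m) (rot_char m i) \<longleftrightarrow>
      q ^ m * (q ^ i + q ^ (m - i)) = q ^ i + q ^ (m - i) + (q ^ m - 1) * q ^ i * (1 + q ^ (m - 2 * i))"
    using assms m
    by (simp add: kernel_formula_def b_values tree_kernel_def kappa_def Omega_trivial_rot R_trivial_char R_rot_char)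
  have eqs: "m - i = i + d" "m - 2 * i = d"
    using d by auto
  show ?thesis
    unfolding K eqs unfolding d(1) by (simp add: power_add mult_2 mult_2_right algebra_simps)
qed

lemma kernel_formula_rot_rot:
  assumes "1 \<le> i" "2 * j < m" "i \<le> j"
  shows "kernel_formula m (rot_char m i) (rot_char m j)"
proof -
  obtain d where d: "m = 2 * j + d" "0 < d"
    using assms(2) less_imp_add_positive by blast
  obtain e where e: "j = i + e"
    using assms(3) nat_le_iff_add by blast
  have m: "0 < m" "i + j \<le> m" "2 * i < m"
    using assms by auto
  have K: "kernel_formula m (rot_char m i) (rot_char m j) \<longleftrightarrow>
      q ^ m * (q ^ (i + j) + q ^ (m - (i + j)) + (q ^ (j - i) + q ^ (m - (j - i))))
      = (q ^ i + q ^ (m - i)) * (q ^ j + q ^ (m - j)) + (q ^ m - 1) * q ^ (i + j) * (1 + q ^ (m - 2 * j))"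
    using assms m
    by (auto simp: kernel_formula_def b_values tree_kernel_def kappa_def Omega_rot_rot R_rot_char)
  have eqs: "m - (i + j) = d + e" "j - i = e" "m - (j - i) = 2 * i + e + d" "m - i = i + 2 * e + d"
      "m - j = i + e + d" "m - 2 * j = d"
    using d e by auto
  show ?thesis
    unfolding K eqs unfolding d(1) e by (simp add: power_add mult_2 mult_2_right algebra_simps)
qed

lemma kernel_formula_rot_half:
  assumes "1 \<le> i" "i < r"
  shows "kernel_formula (2 * r) (rot_char (2 * r) i) (half_char (2 * r) s)"
proof -
  obtain e where e: "r = i + e"
    using assms(2) nat_le_iff_add less_imp_le by metis
  have K: "kernel_formula (2 * r) (rot_char (2 * r) i) (half_char (2 * r) s) \<longleftrightarrow>
      q ^ (2 * r) * (q ^ (r + i) + q ^ (r - i)) = (q ^ i + q ^ (2 * r - i)) * q ^ r + (q ^ (2 * r) - 1) * q ^ (i + r)"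
    using assms
    by (auto simp: kernel_formula_def b_values tree_kernel_def kappa_def Omega_rot_half R_rot_char R_half_char)
  have eqs: "r - i = e" "2 * r - i = i + 2 * e"
    using e by auto
  show ?thesis
    unfolding K eqs unfolding e by (simp add: power_add mult_2 mult_2_right algebra_simps)
qed

theorem Omega_kernel:
  assumes m: "0 < m" and chi: "\<chi> \<in> Irr m" "\<chi> \<noteq> sign_char m" and chi': "\<chi>' \<in> Irr m" "\<chi>' \<noteq> sign_char m"
  shows "Omega m \<chi> \<chi>' = R m \<chi> * R m \<chi>' + (q ^ m - 1) * q ^ (b m \<chi> + b m \<chi>') * tree_kernel m \<chi> \<chi>'"
proof -
  have TT: "kernel_formula m (trivial_char m) (trivial_char m)"
    using m by (simp add: kernel_formula_def Omega_trivial_trivial R_trivial_char b_values tree_kernel_def kappa_def algebra_simps)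
  have TH: "kernel_formula (2 * r) (trivial_char (2 * r)) (half_char (2 * r) s)" if "0 < r" for r s
    using that by (simp add: kernel_formula_def Omega_trivial_half R_trivial_char R_half_char b_values tree_kernel_def
        kappa_def left_diff_distrib)
  have HH: "kernel_formula (2 * r) (half_char (2 * r) s) (half_char (2 * r) s')"
    if "0 < r" "s = 1 \<or> s = -1" "s' = 1 \<or> s' = -1" for r s s'
  proof -
    have "q ^ (2 * r) = q ^ r * q ^ r" "q ^ (r + r) = q ^ r * q ^ r"
      by (simp_all add: mult_2 power_add)
    then show ?thesis
      using that half_char_neq[of "2 * r"]
      by (auto simp: kernel_formula_def Omega_half_half R_half_char b_values tree_kernel_def kappa_def left_diff_distrib)
  qed
  have "kernel_formula m \<chi> \<chi>'"
    using m chi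
  proof (cases rule: Irr_cases)
    case 1
    from m chi' show ?thesis
      by (cases rule: Irr_cases) (use 1 TT TH kernel_formula_trivial_rot in auto)
  next
    case (2 i)
    note * = this
    from m chi' show ?thesis
    proof (cases rule: Irr_cases)
      case 1
      then show ?thesis
        using * kernel_formula_trivial_rot kernel_formula_sym by metis
    next
      case (2 j)
      then show ?thesis
        using * kernel_formula_rot_rot kernel_formula_sym by (metis nat_le_linear)
    next
      case (3 r s)
      then show ?thesis
        using * kernel_formula_rot_half[of i r s] by simp
    qed
  next
    case (3 r s)
    note * = this
    from m chi' show ?thesis
    proof (cases rule: Irr_cases)
      case 1
      then show ?thesis
        using * TH kernel_formula_sym by metis
    next
      case (2 j)
      then show ?thesis
        using * kernel_formula_rot_half[of j r s] by (simp add: kernel_formula_sym)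
    next
      case (3 r' s')
      then show ?thesis
        using * HH[of r s s'] by simp
    qed
  qed
  then show ?thesis
    by (simp add: kernel_formula_def)
qed

section \<open>Green functions as regression coefficients\<close>

locale dihedral =
  fixes m :: nat
  assumes m_ge_3: "3 \<le> m"
begin

definition J :: "(complex mat \<Rightarrow> complex) set" where
  "J = Irr m - {sign_char m}"

lemma m_pos: "0 < m"
  using m_ge_3 by simp

lemma finite_Irr: "finite (Irr m)"
proof -
  have "finite {i. 1 \<le> i \<and> 2 * i < m}"
    by (rule finite_subset[of _ "{..m}"]) auto
  then show ?thesis
    by (simp add: Irr_eq m_pos dihedral_characters_def)
qed

lemma sign_in_Irr: "sign_char m \<in> Irr m"
  by (simp add: Irr_eq m_pos dihedral_characters_def)

lemma b_sign: "b m (sign_char m) = m"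
  by (simp add: b_values m_pos)

lemma Irr_insert: "Irr m = insert (sign_char m) J" "sign_char m \<notin> J" "finite J"
  using sign_in_Irr finite_Irr by (auto simp: J_def)

lemma J_in_Irr: "\<chi> \<in> J \<Longrightarrow> \<chi> \<in> Irr m"
  by (simp add: J_def)

lemma b_J: "\<chi> \<in> J \<Longrightarrow> 2 * b m \<chi> \<le> m"
  by (auto simp: J_def m_pos elim: Irr_cases[OF m_pos])

lemma J_eqI:
  assumes "\<chi> \<in> J" "\<chi>' \<in> J" "b m \<chi> = b m \<chi>'" "2 * b m \<chi> < m"
  shows "\<chi> = \<chi>'"
proof -
  have "\<chi> = (if b m \<chi> = 0 then trivial_char m else rot_char m (b m \<chi>))"
    if "\<chi> \<in> J" "2 * b m \<chi> < m" for \<chi>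
  proof -
    have "\<chi> \<in> Irr m" "\<chi> \<noteq> sign_char m"
      using that(1) by (auto simp: J_def)
    with m_pos show ?thesis
      by (cases rule: Irr_cases) (use that(2) in auto)
  qed
  then show ?thesis
    using assms by metis
qed

lemma J_exists:
  assumes "2 * i < m"
  shows "\<exists>\<chi>\<in>J. b m \<chi> = i"
proof (cases "i = 0")
  case True
  have "trivial_char m \<in> Irr m"
    by (simp add: Irr_eq m_pos dihedral_characters_def)
  moreover have "trivial_char m \<noteq> sign_char m"
    using b_values(1,2)[OF m_pos] m_ge_3 by auto
  ultimately show ?thesis
    using True b_values(1)[OF m_pos] by (auto simp: J_def)
next
  case False
  have "rot_char m i \<in> Irr m"
    using False assms by (auto simp: Irr_eq m_pos dihedral_characters_def)
  moreover have "rot_char m i \<noteq> sign_char m"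
    using b_values(2)[OF m_pos] b_values(3)[OF m_pos assms] assms by (metis less_not_refl mult_2 not_add_less1)
  ultimately show ?thesis
    using b_values(3)[OF m_pos assms] by (auto simp: J_def)
qed

lemma trivial_in_J: "trivial_char m \<in> J" and b_trivial: "b m (trivial_char m) = 0"
proof -
  show b: "b m (trivial_char m) = 0"
    by (simp add: b_values m_pos)
  have "trivial_char m \<noteq> sign_char m"
    using b b_sign m_ge_3 by auto
  then show "trivial_char m \<in> J"
    by (simp add: J_def Irr_eq m_pos dihedral_characters_def)
qed

lemma reflection_in_J: "reflection_char m \<in> J" and b_reflection: "b m (reflection_char m) = 1"
proof -
  have "2 * 1 < m"
    using m_ge_3 by simp
  then show b: "b m (reflection_char m) = 1"
    using b_values(3)[OF m_pos] reflection_char_eq[OF m_pos] by metis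
  have "reflection_char m \<noteq> sign_char m"
    using b b_sign m_ge_3 by (metis numeral_le_one_iff semiring_norm(70))
  moreover have "reflection_char m \<in> dihedral_characters m"
    using m_ge_3 by (auto simp: reflection_char_eq m_pos dihedral_characters_def)
  ultimately show "reflection_char m \<in> J"
    by (simp add: J_def Irr_eq m_pos)
qed

lemma J_half_partner:
  assumes "\<chi> \<in> J" "2 * b m \<chi> = m"
  obtains \<chi>' where "\<chi>' \<in> J" "\<chi>' \<noteq> \<chi>" "2 * b m \<chi>' = m" "\<And>\<psi>. \<psi> \<in> J \<Longrightarrow> 2 * b m \<psi> = m \<Longrightarrow> \<psi> = \<chi> \<or> \<psi> = \<chi>'"
proof -
  have half: "\<exists>s. (s = 1 \<or> s = -1) \<and> \<psi> = half_char m s" if "\<psi> \<in> J" "2 * b m \<psi> = m" for \<psi>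
  proof -
    have "\<psi> \<in> Irr m" "\<psi> \<noteq> sign_char m"
      using that(1) by (auto simp: J_def)
    with m_pos show ?thesis
      by (cases rule: Irr_cases) (use that(2) m_pos in auto)
  qed
  have even: "even m"
    using assms(2) by (metis dvd_triv_left)
  have in_J: "half_char m s \<in> J" "2 * b m (half_char m s) = m" if "s = 1 \<or> s = -1" for s
  proof -
    show 1: "2 * b m (half_char m s) = m"
      using even by (simp add: b_values m_pos)
    then have "half_char m s \<noteq> sign_char m"
      using b_sign m_pos by (metis add_eq_self_zero mult_2 not_gr_zero)
    then show "half_char m s \<in> J"
      using that even by (auto simp: J_def Irr_eq m_pos dihedral_characters_def)
  qed
  obtain s where s: "s = 1 \<or> s = -1" "\<chi> = half_char m s"
    using half assms by blast
  have "half_char m (- s) \<noteq> half_char m s"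
    using s(1) half_char_neq[OF m_pos] by auto
  then show ?thesis
    using that[of "half_char m (- s)"] in_J[of "- s"] s half by fastforce
qed

lemma R_sign: "R m (sign_char m) = q ^ m"
  by (simp add: R_sign_char m_pos)

lemma supp_properties:
  assumes "partition_on (Irr m) X" "\<chi> \<in> Irr m"
  shows "supp X \<chi> \<in> X" and "\<chi> \<in> supp X \<chi>" and "C \<in> X \<Longrightarrow> \<chi> \<in> C \<Longrightarrow> supp X \<chi> = C"
proof -
  obtain D where D: "D \<in> X" "\<chi> \<in> D"
    using assms by (auto simp: partition_on_def)
  have uniq: "C = D" if "C \<in> X" "\<chi> \<in> C" for C
    using disjointD[OF partition_onD2[OF assms(1)], of C D] D that by blast
  have *: "supp X \<chi> = D"
    unfolding supp_def
  proof (rule the_equality)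
    show "C = D" if "C \<in> X \<and> \<chi> \<in> C" for C
      using uniq that by blast
  qed (use D in blast)
  show "supp X \<chi> \<in> X" "\<chi> \<in> supp X \<chi>"
    using * D by auto
  show "C \<in> X \<Longrightarrow> \<chi> \<in> C \<Longrightarrow> supp X \<chi> = C"
    using * uniq by auto
qed

text \<open>Write \<open>z = P y\<close> with \<open>y = \<Lambda> t\<close> and \<open>t\<close>
  the product of the transpose of \<open>P\<close> with \<open>w\<close>. The support of
  \<open>w\<close> and the triangularity of \<open>P\<close> make \<open>t\<close> and
  \<open>y\<close> vanish on classes above \<open>C\<close>; the vanishing of \<open>z\<close> makes
  \<open>y\<close> vanish below \<open>C\<close> and on \<open>C\<close> except at \<open>l\<close>.
  So \<open>z\<close> is a multiple of column \<open>l\<close>, and the diagonal entry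
  \<open>q ^ a C\<close> fixes the factor.\<close>

lemma green_functions_dual_vector:
  assumes datum: "lusztig_shoji_datum m X lt a" and G: "green_functions m X lt a P \<Lambda>"
    and C: "C \<in> X" and w: "\<And>\<chi>. \<chi> \<in> Irr m \<Longrightarrow> w \<chi> \<noteq> 0 \<Longrightarrow> supp X \<chi> = C \<or> (supp X \<chi>, C) \<in> lt"
    and z: "\<And>\<chi>. z \<chi> = (\<Sum>\<chi>'\<in>Irr m. Omega m \<chi> \<chi>' * w \<chi>')"
    and low: "\<And>\<chi>. \<chi> \<in> Irr m \<Longrightarrow> (supp X \<chi>, C) \<in> lt \<Longrightarrow> z \<chi> = 0"
    and l: "l \<in> C" and C0: "\<And>\<chi>. \<chi> \<in> C \<Longrightarrow> \<chi> \<noteq> l \<Longrightarrow> z \<chi> = 0"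
    and i: "i \<in> Irr m"
  shows "q ^ a C * z i = P i l * z l"
proof -
  have part: "partition_on (Irr m) X" and ltX: "lt \<subseteq> X \<times> X" and tr: "trans lt" and irr: "irrefl lt" and tot: "total_on X lt"
    using datum by (auto simp: lusztig_shoji_datum_def strict_linear_order_on_def)
  note S = supp_properties[OF part]
  have total: "A = B \<or> (A, B) \<in> lt \<or> (B, A) \<in> lt" if "A \<in> X" "B \<in> X" for A B
    using tot that by (auto simp: total_on_def)
  have P0: "P \<chi> \<psi> = 0" if "\<chi> \<in> Irr m" "\<psi> \<in> Irr m" "(supp X \<chi>, supp X \<psi>) \<in> lt" for \<chi> \<psi>
    using G that by (auto simp: green_functions_def)
  have P1: "P \<chi> \<psi> = (if \<chi> = \<psi> then q ^ a (supp X \<chi>) else 0)"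
    if "\<chi> \<in> Irr m" "\<psi> \<in> Irr m" "supp X \<chi> = supp X \<psi>" for \<chi> \<psi>
    using G that unfolding green_functions_def by blast
  have L0: "\<Lambda> \<chi> \<psi> = 0" if "\<chi> \<in> Irr m" "\<psi> \<in> Irr m" "supp X \<chi> \<noteq> supp X \<psi>" for \<chi> \<psi>
    using G that by (auto simp: green_functions_def)
  have Om: "Omega m \<chi> \<chi>' = (\<Sum>\<psi> \<in> Irr m. \<Sum>\<psi>' \<in> Irr m. P \<chi> \<psi> * \<Lambda> \<psi> \<psi>' * P \<chi>' \<psi>')"
    if "\<chi> \<in> Irr m" "\<chi>' \<in> Irr m" for \<chi> \<chi>'
    using G that by (auto simp: green_functions_def)
  define t where "t \<psi> = (\<Sum>\<chi>\<in>Irr m. P \<chi> \<psi> * w \<chi>)" for \<psi>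
  define y where "y \<psi> = (\<Sum>\<psi>'\<in>Irr m. \<Lambda> \<psi> \<psi>' * t \<psi>')" for \<psi>
  have zy: "z \<chi> = (\<Sum>\<psi>\<in>Irr m. P \<chi> \<psi> * y \<psi>)" if "\<chi> \<in> Irr m" for \<chi>
  proof -
    have "z \<chi> = (\<Sum>\<chi>'\<in>Irr m. \<Sum>\<psi>\<in>Irr m. \<Sum>\<psi>'\<in>Irr m. P \<chi> \<psi> * \<Lambda> \<psi> \<psi>' * P \<chi>' \<psi>' * w \<chi>')"
      unfolding z using that by (intro sum.cong refl) (simp add: Om sum_distrib_right)
    also have "\<dots> = (\<Sum>\<psi>\<in>Irr m. \<Sum>\<chi>'\<in>Irr m. \<Sum>\<psi>'\<in>Irr m. P \<chi> \<psi> * \<Lambda> \<psi> \<psi>' * P \<chi>' \<psi>' * w \<chi>')"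
      by (rule sum.swap)
    also have "\<dots> = (\<Sum>\<psi>\<in>Irr m. \<Sum>\<psi>'\<in>Irr m. \<Sum>\<chi>'\<in>Irr m. P \<chi> \<psi> * \<Lambda> \<psi> \<psi>' * P \<chi>' \<psi>' * w \<chi>')"
      by (intro sum.cong refl sum.swap)
    also have "\<dots> = (\<Sum>\<psi>\<in>Irr m. P \<chi> \<psi> * y \<psi>)"
      by (simp add: y_def t_def sum_distrib_left mult.assoc)
    finally show ?thesis .
  qed
  have t0: "t \<psi> = 0" if "\<psi> \<in> Irr m" "(C, supp X \<psi>) \<in> lt" for \<psi>
    unfolding t_def
  proof (intro sum.neutral ballI)
    fix \<chi>
    assume \<chi>: "\<chi> \<in> Irr m"
    show "P \<chi> \<psi> * w \<chi> = 0"
    proof (cases "w \<chi> = 0")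
      case False
      then have "(supp X \<chi>, supp X \<psi>) \<in> lt"
        using w[OF \<chi>] that tr by (auto dest: transD)
      then show ?thesis
        using P0 \<chi> that by simp
    qed simp
  qed
  have y0: "y \<psi> = 0" if "\<psi> \<in> Irr m" "(C, supp X \<psi>) \<in> lt" for \<psi>
    unfolding y_def
  proof (intro sum.neutral ballI)
    fix \<psi>'
    assume "\<psi>' \<in> Irr m"
    then show "\<Lambda> \<psi> \<psi>' * t \<psi>' = 0"
      using L0[of \<psi> \<psi>'] t0[of \<psi>'] that by (cases "supp X \<psi> = supp X \<psi>'") auto
  qed
  have diag: "z \<psi> = q ^ a (supp X \<psi>) * y \<psi>"
    if \<psi>: "\<psi> \<in> Irr m" and lower: "\<And>\<phi>. \<phi> \<in> Irr m \<Longrightarrow> (supp X \<phi>, supp X \<psi>) \<in> lt \<Longrightarrow> y \<phi> = 0" for \<psi>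
  proof -
    have "z \<psi> = (\<Sum>\<phi>\<in>Irr m. if \<psi> = \<phi> then q ^ a (supp X \<psi>) * y \<phi> else 0)"
      unfolding zy[OF \<psi>]
    proof (intro sum.cong refl)
      fix \<phi>
      assume \<phi>: "\<phi> \<in> Irr m"
      from total[OF S(1)[OF \<psi>] S(1)[OF \<phi>]]
      show "P \<psi> \<phi> * y \<phi> = (if \<psi> = \<phi> then q ^ a (supp X \<psi>) * y \<phi> else 0)"
        using P0[OF \<psi> \<phi>] P1[OF \<psi> \<phi>] lower[OF \<phi>] irr by (auto simp: irrefl_def)
    qed
    then show ?thesis
      using \<psi> finite_Irr by simp
  qed
  have "finite X"
    using part finite_Irr by (metis finite_UnionD partition_onD1)
  then have "wf lt"
    using ltX tr irr by (metis acyclic_irrefl finite_SigmaI finite_acyclic_wf finite_subset trancl_id)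
  \<comment> \<open>Forward substitution from the lowest class upwards, as a well-founded induction
    along \<open>lt\<close>.\<close>
  then have y_low: "\<forall>\<psi>\<in>Irr m. supp X \<psi> = D \<longrightarrow> (D, C) \<in> lt \<longrightarrow> y \<psi> = 0" for D
  proof (induction D)
    case (less D)
    show ?case
    proof (intro ballI impI)
      fix \<psi>
      assume \<psi>: "\<psi> \<in> Irr m" "supp X \<psi> = D" "(D, C) \<in> lt"
      have "z \<psi> = q ^ a (supp X \<psi>) * y \<psi>"
        using less \<psi> tr by (intro diag) (auto dest: transD)
      then show "y \<psi> = 0"
        using low[OF \<psi>(1)] \<psi> by simp
    qed
  qed
  have CIrr: "\<psi> \<in> Irr m" "supp X \<psi> = C" if "\<psi> \<in> C" for \<psi>
  proof -
    show "\<psi> \<in> Irr m"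
      using part C that by (auto simp: partition_on_def)
    then show "supp X \<psi> = C"
      using S(3) C that by blast
  qed
  have yC: "z \<psi> = q ^ a C * y \<psi>" if "\<psi> \<in> C" for \<psi>
    using diag[OF CIrr(1)[OF that]] CIrr(2)[OF that] y_low by blast
  have "z i = (\<Sum>\<psi>\<in>Irr m. if \<psi> = l then P i l * y l else 0)"
    unfolding zy[OF i]
  proof (intro sum.cong refl)
    fix \<psi>
    assume \<psi>: "\<psi> \<in> Irr m"
    have "y \<psi> = 0" if "\<psi> \<noteq> l"
      using total[OF S(1)[OF \<psi>] C]
    proof (elim disjE)
      assume "supp X \<psi> = C"
      then have "\<psi> \<in> C"
        using S(2)[OF \<psi>] by simp
      then show ?thesis
        using yC C0 that by simp
    qed (use y_low y0 \<psi> in auto)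
    then show "P i \<psi> * y \<psi> = (if \<psi> = l then P i l * y l else 0)"
      by auto
  qed
  also have "\<dots> = P i l * y l"
    using CIrr(1)[OF l] finite_Irr by simp
  finally show ?thesis
    using yC[OF l] by (simp add: mult_ac)
qed

text \<open>Column operations remove the sign character, leaving the tree kernel.\<close>

lemma green_functions_kernel:
  assumes datum: "lusztig_shoji_datum m X lt a" and G: "green_functions m X lt a P \<Lambda>"
    and C: "C \<in> X" and E: "supp X (sign_char m) = C \<or> (supp X (sign_char m), C) \<in> lt"
    and v: "\<And>\<chi>. \<chi> \<in> J \<Longrightarrow> v \<chi> \<noteq> 0 \<Longrightarrow> supp X \<chi> = C \<or> (supp X \<chi>, C) \<in> lt"
    and y: "\<And>\<chi>. \<chi> \<in> J \<Longrightarrow> y \<chi> = (\<Sum>\<chi>'\<in>J. tree_kernel m \<chi> \<chi>' * v \<chi>')"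
    and y0: "\<And>\<chi>. \<chi> \<in> J \<Longrightarrow> supp X \<chi> = C \<or> (supp X \<chi>, C) \<in> lt \<Longrightarrow> \<chi> \<noteq> l \<Longrightarrow> y \<chi> = 0"
    and l: "l \<in> C" "l \<in> J" and i: "i \<in> J"
  shows "q ^ (a C + b m i) * y i = P i l * (q ^ b m l * y l)"
proof -
  have part: "partition_on (Irr m) X"
    using datum by (auto simp: lusztig_shoji_datum_def)
  \<comment> \<open>The division absorbs the column factor \<open>q ^ b m \<chi>\<close> with which
    the tree kernel occurs in \<open>Omega\<close>.\<close>
  define w0 where "w0 \<chi> = v \<chi> / q ^ b m \<chi>" for \<chi>
  define T where "T = (\<Sum>\<chi>\<in>J. R m \<chi> * w0 \<chi>)"
  \<comment> \<open>The entry at the sign character is the one that makes the image under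
    \<open>Omega\<close> vanish there; the products of fake degrees then cancel in all other rows as
    well.\<close>
  define w where "w \<chi> = (if \<chi> = sign_char m then - T / q ^ m else w0 \<chi>)" for \<chi>
  define z where "z \<chi> = (\<Sum>\<chi>'\<in>Irr m. Omega m \<chi> \<chi>' * w \<chi>')" for \<chi>
  have z_eq: "z \<chi> = (\<Sum>\<chi>'\<in>J. Omega m \<chi> \<chi>' * w0 \<chi>') - Omega m \<chi> (sign_char m) * (T / q ^ m)" for \<chi>
  proof -
    have "(\<Sum>\<chi>'\<in>J. Omega m \<chi> \<chi>' * w \<chi>') = (\<Sum>\<chi>'\<in>J. Omega m \<chi> \<chi>' * w0 \<chi>')"
      using Irr_insert(2) by (intro sum.cong) (auto simp: w_def)
    then show ?thesis
      using Irr_insert by (simp add: z_def w_def)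
  qed
  have zE: "z (sign_char m) = 0"
  proof -
    have "(\<Sum>\<chi>'\<in>J. Omega m (sign_char m) \<chi>' * w0 \<chi>') = q ^ m * T"
      unfolding T_def sum_distrib_left
      by (intro sum.cong refl)
        (simp add: Omega_sym[of m "sign_char m"] Omega_sign m_pos J_in_Irr mult.assoc)
    then show ?thesis
      by (simp add: z_eq Omega_sign m_pos sign_in_Irr R_sign)
  qed
  have zJ: "z \<chi> = (q ^ m - 1) * q ^ b m \<chi> * y \<chi>" if \<chi>: "\<chi> \<in> J" for \<chi>
  proof -
    have "Omega m \<chi> \<chi>' * w0 \<chi>'
        = R m \<chi> * (R m \<chi>' * w0 \<chi>') + (q ^ m - 1) * q ^ b m \<chi> * (tree_kernel m \<chi> \<chi>' * v \<chi>')" if \<chi>': "\<chi>' \<in> J" for \<chi>'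
    proof -
      have v: "v \<chi>' = q ^ b m \<chi>' * w0 \<chi>'"
        by (simp add: w0_def)
      have Om: "Omega m \<chi> \<chi>' = R m \<chi> * R m \<chi>' + (q ^ m - 1) * q ^ (b m \<chi> + b m \<chi>') * tree_kernel m \<chi> \<chi>'"
        using \<chi> \<chi>' by (intro Omega_kernel m_pos) (auto simp: J_def)
      show ?thesis
        unfolding v Om power_add by (simp add: algebra_simps)
    qed
    then have "(\<Sum>\<chi>'\<in>J. Omega m \<chi> \<chi>' * w0 \<chi>') = R m \<chi> * T + (q ^ m - 1) * q ^ b m \<chi> * y \<chi>"
      by (simp add: sum.distrib T_def y \<chi> flip: sum_distrib_left)
    then show ?thesis
      by (simp add: z_eq Omega_sign m_pos J_in_Irr \<chi>)
  qed
  have "q ^ a C * z i = P i l * z l"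
  proof (rule green_functions_dual_vector[OF datum G C _ z_def])
    show "supp X \<chi> = C \<or> (supp X \<chi>, C) \<in> lt" if "\<chi> \<in> Irr m" "w \<chi> \<noteq> 0" for \<chi>
      using that E v[of \<chi>] by (auto simp: w_def w0_def J_def split: if_splits)
    show "z \<chi> = 0" if "\<chi> \<in> Irr m" "(supp X \<chi>, C) \<in> lt" for \<chi>
    proof -
      have "\<chi> \<noteq> l"
        using that l(1) C datum supp_properties(3)[OF part] 
        by (auto simp: lusztig_shoji_datum_def strict_linear_order_on_def irrefl_def)
      then show ?thesis
        using zE zJ[of \<chi>] y0[of \<chi>] that by (cases "\<chi> = sign_char m") (auto simp: J_def)
    qed
    show "z \<chi> = 0" if "\<chi> \<in> C" "\<chi> \<noteq> l" for \<chi>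
    proof -
      have "\<chi> \<in> Irr m"
        using part C that(1) by (auto simp: partition_on_def)
      moreover from this have "supp X \<chi> = C"
        using supp_properties(3)[OF part] C that(1) by blast
      ultimately show ?thesis
        using zE zJ[of \<chi>] y0[of \<chi>] that by (cases "\<chi> = sign_char m") (auto simp: J_def)
    qed
  qed (use l i in \<open>auto simp: J_def\<close>)
  then have "(q ^ m - 1) * (q ^ (a C + b m i) * y i) = (q ^ m - 1) * (P i l * (q ^ b m l * y l))"
    using l i by (simp add: zJ power_add mult_ac)
  then show ?thesis
    using q_power_minus_one_nonzero[OF m_pos] by simp
qed

end

section \<open>Constraints on Springer correspondences\<close>

lemma poly_equation_at:
  assumes "q ^ k * to_fract f = to_fract p * (q ^ l * to_fract g)"
  shows "z ^ k * poly f z = poly p z * (z ^ l * poly g z)"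
proof -
  have "monom 1 k * f = p * (monom 1 l * g)"
    using assms by (simp only: q_power to_fract_mult[symmetric] to_fract_eq_iff)
  from arg_cong[OF this, of "\<lambda>p. poly p z"] show ?thesis
    by (simp add: poly_monom)
qed

lemma cis_eq_one_imp:
  assumes "cis t = 1" "0 < t" "t < 2 * pi"
  shows False
proof -
  have "cos t = 1"
    using assms(1) by (metis cis.sel(1) one_complex.sel(1))
  then obtain k :: int where k: "t = of_int k * 2 * pi"
    using cos_one_2pi_int by auto
  then have "0 < k" "k < 1"
    using assms(2,3) by (auto simp: zero_less_mult_iff)
  then show False
    by simp
qed

text \<open>At \<open>z = cis (pi / real (u - l))\<close> the right-hand side vanishes because
  \<open>z ^ (2 * (u - l)) = 1\<close>, whereas \<open>z ^ (2 * (u - i))\<close> differs from 1 for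
  \<open>l < i < u\<close>. The quotient is the regression coefficient between two neighbours in a
  class.\<close>

lemma bridge_not_polynomial:
  assumes "l < i" "i < u" "2 * u \<le> m"
  shows "q ^ k * (q ^ (m - 2 * i) - q ^ (m - 2 * u)) \<noteq> to_fract p * (q ^ l * (q ^ (m - 2 * l) - q ^ (m - 2 * u)))"
proof
  assume eq: "q ^ k * (q ^ (m - 2 * i) - q ^ (m - 2 * u)) = to_fract p * (q ^ l * (q ^ (m - 2 * l) - q ^ (m - 2 * u)))"
  define z where "z = cis (pi / real (u - l))"
  have z: "z ^ k * (z ^ (m - 2 * i) - z ^ (m - 2 * u)) = poly p z * (z ^ l * (z ^ (m - 2 * l) - z ^ (m - 2 * u)))"
    using poly_equation_at[of k "monom 1 (m - 2 * i) - monom 1 (m - 2 * u)" p l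
        "monom 1 (m - 2 * l) - monom 1 (m - 2 * u)" z] eq
    by (simp add: q_power[symmetric] poly_monom)
  have "m - 2 * l = (m - 2 * u) + 2 * (u - l)" "m - 2 * i = (m - 2 * u) + 2 * (u - i)"
    using assms by auto
  moreover have "z ^ (2 * (u - l)) = 1"
  proof -
    have "z ^ (u - l) = -1"
      using assms by (simp add: z_def Complex.DeMoivre del: of_nat_diff)
    then show ?thesis
      by (simp add: power_even_eq)
  qed
  ultimately have "z ^ k * z ^ (m - 2 * u) * (z ^ (2 * (u - i)) - 1) = 0"
    using z by (simp add: power_add right_diff_distrib)
  then have "z ^ (2 * (u - i)) = 1"
    by (simp add: z_def)
  then have "cis (2 * pi * (real (u - i) / real (u - l))) = 1"
    using assms by (simp add: z_def Complex.DeMoivre mult_ac)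
  then show False
    by (rule cis_eq_one_imp) (use assms in \<open>auto simp: field_simps\<close>)
qed

text \<open>At a point with \<open>z ^ (m - 2 * l) = -1\<close> the right-hand side vanishes but the
  left one does not, the exponent \<open>m - 2 * i\<close> being smaller. The quotient is the
  regression coefficient when there is a neighbour only on the side of smaller b-values.\<close>

lemma cap_not_polynomial:
  assumes "l < i" "2 * i \<le> m"
  shows "q ^ k * (if 2 * i = m then 1 else 1 + q ^ (m - 2 * i)) \<noteq> to_fract p * (q ^ l * (1 + q ^ (m - 2 * l)))"
proof
  assume eq: "q ^ k * (if 2 * i = m then 1 else 1 + q ^ (m - 2 * i)) = to_fract p * (q ^ l * (1 + q ^ (m - 2 * l)))"
  define z where "z = cis (pi / real (m - 2 * l))"
  have "z ^ k * (if 2 * i = m then 1 else 1 + z ^ (m - 2 * i)) = poly p z * (z ^ l * (1 + z ^ (m - 2 * l)))"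
    using poly_equation_at[of k "if 2 * i = m then 1 else 1 + monom 1 (m - 2 * i)" p l
        "1 + monom 1 (m - 2 * l)" z] eq
    by (auto simp: q_power[symmetric] poly_monom)
  moreover have "z ^ (m - 2 * l) = -1"
    using assms by (simp add: z_def Complex.DeMoivre)
  ultimately have 0: "(if 2 * i = m then 1 else 1 + z ^ (m - 2 * i)) = 0"
    by (auto simp: z_def split: if_splits)
  then have "2 * i \<noteq> m" "z ^ (m - 2 * i) = -1"
    by (auto simp: add_eq_0_iff split: if_splits)
  then have "cis (pi * (real (m - 2 * i) / real (m - 2 * l))) = -1"
    by (simp add: z_def Complex.DeMoivre mult_ac)
  then have "cis (pi * (real (m - 2 * i) / real (m - 2 * l)) + pi) = 1"
    by (simp flip: cis_mult)
  then show False
  proof (rule cis_eq_one_imp)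
    have "real (m - 2 * i) / real (m - 2 * l) < 1"
      using assms by (simp add: divide_simps)
    then have "pi * (real (m - 2 * i) / real (m - 2 * l)) < pi * 1"
      by (intro mult_strict_left_mono) auto
    then show "pi * (real (m - 2 * i) / real (m - 2 * l)) + pi < 2 * pi"
      by simp
  qed (use assms in \<open>auto intro!: add_nonneg_pos\<close>)
qed

text \<open>Evaluation at 1 turns the left side into a sum of natural numbers and the right side
  into -1.\<close>

lemma nonneg_not_negative_power:
  assumes "x \<in> nonneg_integer_coeff_polys"
  shows "x * q ^ k \<noteq> - (q ^ l)"
proof
  assume eq: "x * q ^ k = - (q ^ l)"
  obtain f :: "nat poly" where f: "x = to_fract (map_poly of_nat f)"
    using assms by (auto simp: nonneg_integer_coeff_polys_def)
  have "to_fract (map_poly of_nat f * monom 1 k) = to_fract (- monom 1 l :: complex poly)"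
    using eq by (simp add: f q_power)
  then have "map_poly of_nat f * monom 1 k = (- monom 1 l :: complex poly)"
    by (simp only: to_fract_eq_iff)
  from arg_cong[OF this, of "\<lambda>p. poly p 1"] have "poly (map_poly of_nat f) 1 = (-1 :: complex)"
    by (simp add: poly_monom)
  then have "(\<Sum>i\<le>degree (map_poly of_nat f :: complex poly). of_nat (coeff f i)) = (-1 :: complex)"
    by (simp add: poly_altdef coeff_map_poly)
  then have "of_nat (\<Sum>i\<le>degree (map_poly of_nat f :: complex poly). coeff f i) + 1 = (0 :: complex)"
    by simp
  then have "of_nat (Suc (\<Sum>i\<le>degree (map_poly of_nat f :: complex poly). coeff f i)) = (0 :: complex)"
    by (simp add: add.commute)
  then show False
    by (simp only: of_nat_eq_0_iff)
qed

lemma power_le_if_divisible: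
  assumes "q ^ k = q ^ l * to_fract f"
  shows "l \<le> k"
proof (rule ccontr)
  assume "\<not> l \<le> k"
  then have "q ^ l = q ^ k * q ^ (l - k)"
    by (simp flip: power_add)
  then have "q ^ k * 1 = q ^ k * (q ^ (l - k) * to_fract f)"
    using assms by (metis mult.assoc mult_1_right)
  then have "1 = q ^ (l - k) * to_fract f"
    by (simp only: mult_left_cancel[OF power_not_zero[OF q_nonzero]])
  then have "1 = monom 1 (l - k) * f"
    by (metis q_power to_fract_1 to_fract_eq_iff to_fract_mult)
  from arg_cong[OF this, of "\<lambda>p. poly p 0"] show False
    using \<open>\<not> l \<le> k\<close> by (simp add: poly_monom zero_power)
qed

lemma ex_max_image:
  fixes f :: "'a \<Rightarrow> nat"
  assumes "finite B" "x \<in> B"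
  shows "\<exists>y\<in>B. \<forall>z\<in>B. f z \<le> f y"
proof -
  have "Max (f ` B) \<in> f ` B"
    using assms by (intro Max_in) auto
  then obtain y where "y \<in> B" "f y = Max (f ` B)"
    by auto
  then show ?thesis
    using assms(1) by (intro bexI[of _ y]) auto
qed

lemma ex_min_image:
  fixes f :: "'a \<Rightarrow> nat"
  assumes "finite B" "x \<in> B"
  shows "\<exists>y\<in>B. \<forall>z\<in>B. f y \<le> f z"
proof -
  have "Min (f ` B) \<in> f ` B"
    using assms by (intro Min_in) auto
  then obtain y where "y \<in> B" "f y = Min (f ` B)"
    by auto
  then show ?thesis
    using assms(1) by (intro bexI[of _ y]) auto
qed

lemma (in dihedral) sum_tree_kernel_indicator:
  "x \<in> J \<Longrightarrow> (\<Sum>\<chi>'\<in>J. tree_kernel m \<chi> \<chi>' * (if \<chi>' = x then c else 0)) = tree_kernel m \<chi> x * c"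
  using Irr_insert(3) by (simp add: if_distrib cong: if_cong)

lemma (in dihedral) kappa_strict:
  assumes "b m p < b m l" "2 * b m l < m"
  shows "kappa m p \<noteq> kappa m l"
proof
  assume "kappa m p = kappa m l"
  then have "q ^ (m - 2 * b m p) = q ^ (m - 2 * b m l)"
    using assms by (simp add: kappa_def)
  then show False
    using assms by (simp add: q_power_eq_iff)
qed

section \<open>Columns of the Green functions of an arbitrary Springer correspondence\<close>

locale springer = dihedral +
  fixes S X lt a P \<Lambda>
  assumes corr: "springer_correspondence_with_reps m S X lt a"
    and green: "green_functions m X lt a P \<Lambda>"
    and P_nonneg: "\<And>\<chi> \<chi>'. \<chi> \<in> Irr m \<Longrightarrow> \<chi>' \<in> Irr m \<Longrightarrow> P \<chi> \<chi>' \<in> nonneg_integer_coeff_polys"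
    and P_div: "\<And>C \<chi> \<chi>'. C \<in> X \<Longrightarrow> \<chi> \<in> C \<Longrightarrow> \<chi>' \<in> Irr m \<Longrightarrow> divisible_by_q_power (a C) (P \<chi> \<chi>')"
begin

lemma datum: "lusztig_shoji_datum m X lt a"
  using corr by (simp add: springer_correspondence_with_reps_def springer_correspondence_def)

lemma part: "partition_on (Irr m) X"
  using datum by (simp add: lusztig_shoji_datum_def)

lemmas supp_in = supp_properties(1)[OF part] and in_supp = supp_properties(2)[OF part]
  and supp_eq = supp_properties(3)[OF part]

lemma class_subset: "C \<in> X \<Longrightarrow> C \<subseteq> Irr m"
  using part by (auto simp: partition_on_def)

definition A :: "(complex mat \<Rightarrow> complex) \<Rightarrow> nat" where
  "A \<chi> = a (supp X \<chi>)"

definition rep :: "(complex mat \<Rightarrow> complex) \<Rightarrow> (complex mat \<Rightarrow> complex)" where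
  "rep \<chi> = springer_rep m (supp X \<chi>)"

lemma springer_rep_unique:
  assumes "C \<in> X"
  shows "springer_rep m C \<in> C" and "b m (springer_rep m C) = a C"
    and "\<chi> \<in> C \<Longrightarrow> b m \<chi> = a C \<Longrightarrow> springer_rep m C = \<chi>" and "\<chi> \<in> C \<Longrightarrow> a C \<le> b m \<chi>"
proof -
  have aC: "a C = Min (b m ` C)" and ex: "\<exists>!\<chi>. \<chi> \<in> C \<and> b m \<chi> = Min (b m ` C)"
    using corr assms by (auto simp: springer_correspondence_with_reps_def springer_correspondence_def)
  have fin: "finite C"
    using class_subset[OF assms] finite_Irr finite_subset by blast
  from theI'[OF ex] show "springer_rep m C \<in> C" "b m (springer_rep m C) = a C"
    unfolding aC springer_rep_def by auto
  show "springer_rep m C = \<chi>" if "\<chi> \<in> C" "b m \<chi> = a C"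
    unfolding springer_rep_def using ex that aC by (intro the1_equality) auto
  show "a C \<le> b m \<chi>" if "\<chi> \<in> C"
    unfolding aC using fin that by auto
qed

lemma rep_properties:
  assumes "\<chi> \<in> Irr m"
  shows "rep \<chi> \<in> supp X \<chi>" and "rep \<chi> \<in> Irr m" and "b m (rep \<chi>) = A \<chi>"
    and "supp X (rep \<chi>) = supp X \<chi>" and "rep \<chi> \<in> S" and "A \<chi> \<le> b m \<chi>"
    and "A \<chi> = b m \<chi> \<Longrightarrow> rep \<chi> = \<chi>"
proof -
  show 1: "rep \<chi> \<in> supp X \<chi>"
    unfolding rep_def using springer_rep_unique(1) supp_in assms by blast
  then show 2: "rep \<chi> \<in> Irr m"
    using class_subset supp_in assms by blast
  show "b m (rep \<chi>) = A \<chi>"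
    unfolding rep_def A_def using springer_rep_unique(2) supp_in assms by blast
  show "supp X (rep \<chi>) = supp X \<chi>"
    using supp_eq 1 2 supp_in assms by blast
  show "rep \<chi> \<in> S"
    using corr supp_in[OF assms] by (auto simp: springer_correspondence_with_reps_def rep_def)
  show "A \<chi> \<le> b m \<chi>"
    unfolding A_def using springer_rep_unique(4) supp_in in_supp assms by blast
  show "A \<chi> = b m \<chi> \<Longrightarrow> rep \<chi> = \<chi>"
    unfolding A_def rep_def using springer_rep_unique(3) supp_in in_supp assms by metis
qed

lemma S_properties:
  assumes "s \<in> S"
  shows "s \<in> Irr m" and "rep s = s" and "A s = b m s"
proof -
  obtain C where C: "C \<in> X" "s = springer_rep m C"
    using corr assms by (auto simp: springer_correspondence_with_reps_def)
  then have "s \<in> C"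
    using springer_rep_unique by blast
  then show "s \<in> Irr m"
    using class_subset C by blast
  then have "supp X s = C"
    using supp_eq C \<open>s \<in> C\<close> by blast
  then show "rep s = s" "A s = b m s"
    using C springer_rep_unique(2) by (auto simp: rep_def A_def)
qed

lemma lt_props: "lt \<subseteq> X \<times> X" "trans lt" "irrefl lt" "total_on X lt"
  using datum by (auto simp: lusztig_shoji_datum_def strict_linear_order_on_def)

lemma A_antimono: "(supp X \<chi>, supp X \<chi>') \<in> lt \<Longrightarrow> A \<chi>' \<le> A \<chi>"
  using datum by (auto simp: lusztig_shoji_datum_def A_def)

lemma A_less_imp_lt:
  assumes "\<chi> \<in> Irr m" "\<chi>' \<in> Irr m" "A \<chi>' < A \<chi>"
  shows "(supp X \<chi>, supp X \<chi>') \<in> lt"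
proof -
  have "supp X \<chi> \<noteq> supp X \<chi>'"
    using assms(3) by (auto simp: A_def)
  then show ?thesis
    using lt_props(4) supp_in[OF assms(1)] supp_in[OF assms(2)] A_antimono[of \<chi>' \<chi>] assms(3)
    unfolding total_on_def by force
qed

lemma special_in_S: "trivial_char m \<in> S" "reflection_char m \<in> S" "sign_char m \<in> S"
  using corr by (auto simp: springer_correspondence_with_reps_def springer_correspondence_def special_chars_def)

text \<open>Condition (3) places the middle family at or below the class of the reflection
  character, whose weight is 1, and \<open>a\<close> reverses the order. This is how families enter
  the lower bounds.\<close>

lemma A_ge_one:
  assumes "\<chi> \<in> J" "\<chi> \<noteq> trivial_char m"
  shows "1 \<le> A \<chi>"
proof (cases "\<chi> = reflection_char m")
  case True
  then show ?thesis
    using S_properties(3)[OF special_in_S(2)] b_reflection by simp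
next
  case False
  have 1: "Irr m - {trivial_char m, sign_char m} \<in> families m"
    by (simp add: families_def)
  have 2: "reflection_char m \<in> (Irr m - {trivial_char m, sign_char m}) \<inter> special_chars m"
    using reflection_in_J b_reflection b_trivial by (auto simp: J_def special_chars_def)
  have 3: "\<chi> \<in> (Irr m - {trivial_char m, sign_char m}) - special_chars m"
    using assms False by (auto simp: J_def special_chars_def)
  have "\<forall>F \<in> families m. \<forall>\<chi> \<in> F \<inter> special_chars m. \<forall>\<chi>' \<in> F - special_chars m.
        supp X \<chi>' = supp X \<chi> \<or> (supp X \<chi>', supp X \<chi>) \<in> lt"
    using corr by (simp add: springer_correspondence_with_reps_def springer_correspondence_def)
  from this[rule_format, OF 1 2 3]
  have "supp X \<chi> = supp X (reflection_char m) \<or> (supp X \<chi>, supp X (reflection_char m)) \<in> lt" .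
  then have "A (reflection_char m) \<le> A \<chi>"
    using A_antimono by (auto simp: A_def)
  then show ?thesis
    using S_properties(3)[OF special_in_S(2)] b_reflection by simp
qed

text \<open>The class of \<open>l\<close> together with the characters on which the regression for
  this class is conditioned; the sign character has been eliminated.\<close>

definition below :: "(complex mat \<Rightarrow> complex) \<Rightarrow> (complex mat \<Rightarrow> complex) set" where
  "below l = {\<chi> \<in> J. supp X \<chi> = supp X l \<or> (supp X \<chi>, supp X l) \<in> lt}"

lemma below_in_J: "\<chi> \<in> below l \<Longrightarrow> \<chi> \<in> J"
  and self_below: "l \<in> J \<Longrightarrow> l \<in> below l"
  and below_A: "\<chi> \<in> below l \<Longrightarrow> A l \<le> A \<chi>"
  using A_antimono by (auto simp: below_def A_def)

lemma belowI: "\<chi> \<in> J \<Longrightarrow> l \<in> J \<Longrightarrow> A l < A \<chi> \<Longrightarrow> \<chi> \<in> below l"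
  using A_less_imp_lt by (auto simp: below_def J_def)

lemma finite_below: "finite (below l)"
  using Irr_insert(3) by (simp add: below_def)

lemma below_max:
  assumes "x \<in> below l" "b m x < k"
  shows "\<exists>p\<in>below l. b m p < k \<and> (\<forall>d\<in>below l. b m d < k \<longrightarrow> b m d \<le> b m p)"
proof -
  have "finite {d \<in> below l. b m d < k}" "x \<in> {d \<in> below l. b m d < k}"
    using assms finite_below by auto
  from ex_max_image[OF this, of "b m"] obtain p
    where "p \<in> below l" "b m p < k" "\<forall>d\<in>{d \<in> below l. b m d < k}. b m d \<le> b m p"
    by blast
  then show ?thesis
    by (intro bexI[of _ p]) auto
qed

text \<open>The sign character has weight \<open>m\<close>, larger than any b-value in
  \<open>J\<close>, so its class is below that of \<open>l\<close> and the elimination in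
  \<open>green_functions_kernel\<close> applies to every column.\<close>

lemma P_dual_vector:
  assumes l: "l \<in> J" and i: "i \<in> J"
    and v: "\<And>\<chi>. \<chi> \<in> J \<Longrightarrow> v \<chi> \<noteq> 0 \<Longrightarrow> \<chi> \<in> below l"
    and y: "\<And>\<chi>. \<chi> \<in> J \<Longrightarrow> y \<chi> = (\<Sum>\<chi>'\<in>J. tree_kernel m \<chi> \<chi>' * v \<chi>')"
    and y0: "\<And>\<chi>. \<chi> \<in> below l \<Longrightarrow> \<chi> \<noteq> l \<Longrightarrow> y \<chi> = 0"
  shows "q ^ (A l + b m i) * y i = P i l * (q ^ b m l * y l)"
proof -
  have lI: "l \<in> Irr m"
    using l by (rule J_in_Irr)
  have "A l \<le> b m l"
    using rep_properties(6)[OF lI] .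
  also have "\<dots> < m"
    using b_J[OF l] m_pos by linarith
  finally have "A l < A (sign_char m)"
    using S_properties(3)[OF special_in_S(3)] b_sign by simp
  then have "(supp X (sign_char m), supp X l) \<in> lt"
    using A_less_imp_lt lI sign_in_Irr by blast
  then show ?thesis
    unfolding A_def
    by (intro green_functions_kernel[OF datum green supp_in[OF lI] _ _ y _ in_supp[OF lI] l i])
      (use v y0 in \<open>auto simp: below_def\<close>)
qed

lemma P_polynomial:
  assumes "i \<in> J" "l \<in> J"
  obtains p where "P i l = to_fract p"
  using P_nonneg[of i l] J_in_Irr assms by (auto simp: nonneg_integer_coeff_polys_def)

text \<open>The values of the dual vector below \<open>l\<close> are all equal to its value at \<open>l\<close>, and can be
  cancelled by a vector supported on \<open>l\<close> and its predecessor.\<close>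

lemma P_dual_vector_above:
  assumes l: "l \<in> J" "2 * b m l < m" and i: "i \<in> J" "b m l < b m i"
    and v: "\<And>\<chi>. \<chi> \<in> J \<Longrightarrow> v \<chi> \<noteq> 0 \<Longrightarrow> \<chi> \<in> below l \<and> b m l \<le> b m \<chi>"
    and y: "\<And>\<chi>. \<chi> \<in> J \<Longrightarrow> y \<chi> = (\<Sum>\<chi>'\<in>J. tree_kernel m \<chi> \<chi>' * v \<chi>')"
    and y0: "\<And>\<chi>. \<chi> \<in> below l \<Longrightarrow> b m l < b m \<chi> \<Longrightarrow> y \<chi> = 0"
  shows "q ^ (A l + b m i) * y i = P i l * (q ^ b m l * y l)"
proof (cases "{d \<in> below l. b m d < b m l} = {}")
  case True
  show ?thesis
  proof (rule P_dual_vector[OF l(1) i(1) _ y])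
    fix \<chi>
    assume "\<chi> \<in> below l" "\<chi> \<noteq> l"
    then show "y \<chi> = 0"
      using True y0 J_eqI[OF below_in_J l(1)] l(2) by (metis (mono_tags, lifting) empty_iff mem_Collect_eq nat_neq_iff)
  qed (use v in auto)
next
  case False
  then obtain p where p: "p \<in> below l" "b m p < b m l"
    and p_max: "\<And>d. d \<in> below l \<Longrightarrow> b m d < b m l \<Longrightarrow> b m d \<le> b m p"
    using below_max[of _ l "b m l"] by blast
  have pJ: "p \<in> J"
    using p below_in_J by blast
  have d0: "kappa m p - kappa m l \<noteq> 0"
    using kappa_strict[OF p(2) l(2)] by simp
  \<comment> \<open>Adding \<open>c\<close> at \<open>l\<close> and subtracting it at
    \<open>p\<close> changes nothing from the level of \<open>l\<close> upwards, and shifts the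
    values at levels up to that of \<open>p\<close> by \<open>(kappa m l - kappa m p) * c\<close>.
    This choice of \<open>c\<close> cancels the common value \<open>y l\<close> there.\<close>
  define c where "c = y l / (kappa m p - kappa m l)"
  define v' where "v' \<chi> = v \<chi> + (if \<chi> = p then - c else 0) + (if \<chi> = l then c else 0)" for \<chi>
  define y' where "y' \<chi> = y \<chi> + (tree_kernel m \<chi> l - tree_kernel m \<chi> p) * c" for \<chi>
  have y'_sum: "y' \<chi> = (\<Sum>\<chi>'\<in>J. tree_kernel m \<chi> \<chi>' * v' \<chi>')" if "\<chi> \<in> J" for \<chi>
    using that l(1) pJ
    by (simp add: v'_def distrib_left sum.distrib sum_tree_kernel_indicator y'_def y algebra_simps)
  have same: "y' \<chi> = y \<chi>" if "b m l < b m \<chi> \<or> \<chi> = l" for \<chi>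
    using that p(2) by (auto simp: y'_def tree_kernel_def)
  have low: "y d = y l" if d: "d \<in> J" "b m d < b m l" for d
    unfolding y[OF d(1)] y[OF l(1)]
  proof (intro sum.cong refl)
    fix \<psi>
    assume \<psi>: "\<psi> \<in> J"
    show "tree_kernel m d \<psi> * v \<psi> = tree_kernel m l \<psi> * v \<psi>"
    proof (cases "v \<psi> = 0")
      case False
      then have "b m l \<le> b m \<psi>"
        using v \<psi> by blast
      moreover have "b m l = b m \<psi> \<Longrightarrow> \<psi> = l"
        using J_eqI[OF l(1) \<psi>] l(2) by auto
      ultimately show ?thesis
        using d by (auto simp: tree_kernel_def)
    qed simp
  qed
  have "q ^ (A l + b m i) * y' i = P i l * (q ^ b m l * y' l)"
  proof (rule P_dual_vector[OF l(1) i(1) _ y'_sum])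
    show "\<chi> \<in> below l" if "\<chi> \<in> J" "v' \<chi> \<noteq> 0" for \<chi>
      using that v[of \<chi>] p(1) self_below[OF l(1)] by (auto simp: v'_def split: if_splits)
    fix \<chi>
    assume \<chi>: "\<chi> \<in> below l" "\<chi> \<noteq> l"
    have \<chi>J: "\<chi> \<in> J"
      using \<chi> below_in_J by blast
    have neq: "b m \<chi> \<noteq> b m l"
      using J_eqI[OF \<chi>J l(1)] l(2) \<chi>(2) by auto
    show "y' \<chi> = 0"
    proof (cases "b m l < b m \<chi>")
      case True
      then show ?thesis
        using same y0 \<chi> by simp
    next
      case False
      then have less: "b m \<chi> < b m l"
        using neq by simp
      then have "b m \<chi> \<le> b m p"
        using p_max \<chi> by blast
      moreover have "b m \<chi> = b m p \<Longrightarrow> \<chi> = p"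
        using J_eqI[OF \<chi>J pJ] less l(2) by auto
      ultimately have "tree_kernel m \<chi> p = kappa m p"
        by (auto simp: tree_kernel_def)
      moreover have "tree_kernel m \<chi> l = kappa m l"
        using less by (simp add: tree_kernel_def)
      ultimately have "y' \<chi> = y l - (kappa m p - kappa m l) * c"
        using low[OF \<chi>J less] by (simp add: y'_def algebra_simps)
      then show ?thesis
        using d0 by (simp add: c_def)
    qed
  qed
  then show ?thesis
    using same i(2) by simp
qed


text \<open>The dual vector is the variable of \<open>l\<close> minus those of its upper neighbours
  in \<open>below l\<close>; by the Markov property it is uncorrelated with the rest of
  \<open>below l\<close> above \<open>l\<close>. In the applications \<open>T\<close> is empty, a
  single neighbour, or both characters of level \<open>m / 2\<close>.\<close>

lemma P_signed_vector:
  assumes l: "l \<in> J" "2 * b m l < m" and i: "i \<in> J" "b m l < b m i"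
    and T: "\<And>t. t \<in> T \<Longrightarrow> t \<in> below l \<and> b m l < b m t"
    and zero: "\<And>\<chi>. \<chi> \<in> below l \<Longrightarrow> b m l < b m \<chi> \<Longrightarrow>
      tree_kernel m \<chi> l = (\<Sum>t\<in>T. tree_kernel m \<chi> t)"
  shows "q ^ (A l + b m i) * (tree_kernel m i l - (\<Sum>t\<in>T. tree_kernel m i t))
    = P i l * (q ^ b m l * (tree_kernel m l l - (\<Sum>t\<in>T. tree_kernel m l t)))"
proof (rule P_dual_vector_above[OF l i])
  define v where "v \<chi> = (if \<chi> = l then 1 else 0) + (if \<chi> \<in> T then - 1 else (0 :: complex poly fract))" for \<chi>
  show "\<chi> \<in> below l \<and> b m l \<le> b m \<chi>" if "\<chi> \<in> J" "v \<chi> \<noteq> 0" for \<chi>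
    using that T[of \<chi>] self_below[OF l(1)] by (auto simp: v_def split: if_splits)
  show "tree_kernel m \<chi> l - (\<Sum>t\<in>T. tree_kernel m \<chi> t) = (\<Sum>\<chi>'\<in>J. tree_kernel m \<chi> \<chi>' * v \<chi>')" for \<chi>
  proof -
    have "J \<inter> T = T"
      using T below_in_J by blast
    then have "(\<Sum>\<chi>'\<in>J. tree_kernel m \<chi> \<chi>' * (if \<chi>' \<in> T then - 1 else 0)) = - (\<Sum>t\<in>T. tree_kernel m \<chi> t)"
      using Irr_insert(3) sum.inter_restrict[of J "\<lambda>t. - tree_kernel m \<chi> t" T]
      by (simp add: if_distrib sum_negf cong: if_cong)
    then show ?thesis
      by (simp add: v_def distrib_left sum.distrib sum_tree_kernel_indicator l(1))
  qed
qed (use zero in simp)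

text \<open>Here \<open>l\<close> is the last element of \<open>below l\<close> before the level of
  \<open>i\<close>. What follows \<open>l\<close> in \<open>below l\<close> determines
  \<open>P i l\<close>, and every configuration but one gives an expression that is not a
  polynomial.\<close>

lemma gap_above_half:
  assumes l: "l \<in> J" and i: "i \<in> J" "b m l < b m i" "i \<notin> below l"
    and gap: "\<And>d. d \<in> below l \<Longrightarrow> b m d < b m i \<Longrightarrow> b m d \<le> b m l"
  obtains \<rho> where "\<rho> \<in> below l" "2 * b m \<rho> = m" "\<And>d. d \<in> below l \<Longrightarrow> b m l < b m d \<Longrightarrow> d = \<rho>"
    "A i + b m i \<le> A l + b m l"
proof -
  have l2: "2 * b m l < m"
    using i(2) b_J[OF i(1)] by linarith
  obtain p where p: "P i l = to_fract p"
    using P_polynomial i(1) l by blast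
  define Up where "Up = {d \<in> below l. b m l < b m d}"
  have UpJ: "d \<in> J" if "d \<in> Up" for d
    using that below_in_J by (auto simp: Up_def)
  have Up_i: "b m i \<le> b m d" "d \<noteq> i" if "d \<in> Up" for d
    using that gap[of d] i(3) by (force simp: Up_def)+
  have fin: "finite Up"
    using finite_below by (simp add: Up_def)
  note signed = P_signed_vector[OF l l2 i(1,2)]
  \<comment> \<open>An upper neighbour \<open>u\<close> of level less than \<open>m / 2\<close>
    leads to the quotient of \<open>bridge_not_polynomial\<close>.\<close>
  have low: "2 * b m d = m" if d: "d \<in> Up" for d
  proof (rule ccontr)
    assume "2 * b m d \<noteq> m"
    then have d2: "2 * b m d < m"
      using b_J[OF UpJ[OF d]] by simp
    obtain u where u: "u \<in> Up" and u_min: "\<And>d. d \<in> Up \<Longrightarrow> b m u \<le> b m d"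
      using ex_min_image[OF fin d, of "b m"] by blast
    have u2: "2 * b m u < m"
      using u_min[OF d] d2 by linarith
    have uJ: "u \<in> J" and lu: "b m l < b m u"
      using u UpJ by (auto simp: Up_def)
    have iu: "b m i < b m u"
      using Up_i[OF u] J_eqI[OF uJ i(1)] u2 by (metis le_neq_implies_less)
    have "q ^ (A l + b m i) * (tree_kernel m i l - (\<Sum>t\<in>{u}. tree_kernel m i t))
        = P i l * (q ^ b m l * (tree_kernel m l l - (\<Sum>t\<in>{u}. tree_kernel m l t)))"
    proof (rule signed)
      show "tree_kernel m \<chi> l = (\<Sum>t\<in>{u}. tree_kernel m \<chi> t)"
        if \<chi>: "\<chi> \<in> below l" "b m l < b m \<chi>" for \<chi>
      proof -
        have "\<chi> \<in> Up"
          using \<chi> by (simp add: Up_def)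
        then have "b m u \<le> b m \<chi>" "b m u = b m \<chi> \<Longrightarrow> \<chi> = u"
          using u_min UpJ J_eqI[OF _ uJ] u2 by metis+
        then show ?thesis
          using lu by (auto simp: tree_kernel_def)
      qed
    qed (use u in \<open>auto simp: Up_def\<close>)
    moreover have "tree_kernel m i l - (\<Sum>t\<in>{u}. tree_kernel m i t) = q ^ (m - 2 * b m i) - q ^ (m - 2 * b m u)"
      "tree_kernel m l l - (\<Sum>t\<in>{u}. tree_kernel m l t) = q ^ (m - 2 * b m l) - q ^ (m - 2 * b m u)"
      using lu iu i(2) u2 by (auto simp: tree_kernel_def kappa_def)
    ultimately show False
      using bridge_not_polynomial[OF i(2) iu] u2 p by simp
  qed
  \<comment> \<open>Without an upper neighbour the quotient is that of
    \<open>cap_not_polynomial\<close>.\<close>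
  have nonempty: "Up \<noteq> {}"
  proof
    assume Up: "Up = {}"
    have "q ^ (A l + b m i) * tree_kernel m i l = P i l * (q ^ b m l * tree_kernel m l l)"
      using signed[of "{}"] Up by (auto simp: Up_def)
    moreover have "tree_kernel m i l = (if 2 * b m i = m then 1 else 1 + q ^ (m - 2 * b m i))"
      "tree_kernel m l l = 1 + q ^ (m - 2 * b m l)"
      using i(2) l2 by (auto simp: tree_kernel_def kappa_def)
    ultimately show False
      using cap_not_polynomial[OF i(2) b_J[OF i(1)]] p by simp
  qed
  then obtain \<rho> where \<rho>: "\<rho> \<in> Up"
    by blast
  have \<rho>J: "\<rho> \<in> J" and l\<rho>: "b m l < b m \<rho>"
    using \<rho> UpJ by (auto simp: Up_def)
  \<comment> \<open>Both characters of level \<open>m / 2\<close> together act like one neighbour of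
    variance 2, that is, \<open>1 + q ^ 0\<close>, so the bridge quotient returns.\<close>
  have unique: "d = \<rho>" if d: "d \<in> Up" for d
  proof (rule ccontr)
    assume neq: "d \<noteq> \<rho>"
    have dJ: "d \<in> J" and ld: "b m l < b m d"
      using d UpJ by (auto simp: Up_def)
    obtain \<rho>' where \<rho>': "\<And>\<psi>. \<psi> \<in> J \<Longrightarrow> 2 * b m \<psi> = m \<Longrightarrow> \<psi> = \<rho> \<or> \<psi> = \<rho>'"
      using J_half_partner[OF \<rho>J low[OF \<rho>]] by metis
    have halves: "\<psi> = \<rho> \<or> \<psi> = d" if "\<psi> \<in> J" "2 * b m \<psi> = m" for \<psi>
      using \<rho>' that neq dJ low[OF d] by metis
    have i2: "2 * b m i < m"
      using halves[OF i(1)] Up_i(2) d \<rho> b_J[OF i(1)] by (metis le_neq_implies_less)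
    have b_eq: "b m d = b m \<rho>" "2 * b m \<rho> = m"
      using low[OF d] low[OF \<rho>] by auto
    have "q ^ (A l + b m i) * (tree_kernel m i l - (\<Sum>t\<in>{\<rho>, d}. tree_kernel m i t))
        = P i l * (q ^ b m l * (tree_kernel m l l - (\<Sum>t\<in>{\<rho>, d}. tree_kernel m l t)))"
    proof (rule signed)
      show "tree_kernel m \<chi> l = (\<Sum>t\<in>{\<rho>, d}. tree_kernel m \<chi> t)"
        if \<chi>: "\<chi> \<in> below l" "b m l < b m \<chi>" for \<chi>
      proof -
        have "\<chi> = \<rho> \<or> \<chi> = d"
          using halves low \<chi> below_in_J by (auto simp: Up_def)
        then show ?thesis
          using neq l\<rho> b_eq by (auto simp: tree_kernel_def kappa_def)
      qed
    qed (use \<rho> d in \<open>auto simp: Up_def\<close>)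
    moreover have "tree_kernel m i l - (\<Sum>t\<in>{\<rho>, d}. tree_kernel m i t) = q ^ (m - 2 * b m i) - q ^ (m - 2 * b m \<rho>)"
      "tree_kernel m l l - (\<Sum>t\<in>{\<rho>, d}. tree_kernel m l t) = q ^ (m - 2 * b m l) - q ^ (m - 2 * b m \<rho>)"
      using neq l\<rho> b_eq i(2) i2 l2 by (auto simp: tree_kernel_def kappa_def)
    moreover have "b m i < b m \<rho>"
      using i2 b_eq by linarith
    ultimately show False
      using bridge_not_polynomial[OF i(2), of "b m \<rho>" m] b_eq p by simp
  qed
  show ?thesis
  proof (rule that[OF _ low[OF \<rho>]])
    show "\<rho> \<in> below l"
      using \<rho> by (simp add: Up_def)
    show "d = \<rho>" if "d \<in> below l" "b m l < b m d" for d
      using unique[of d] that by (simp add: Up_def)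
    \<comment> \<open>With a single upper neighbour of level \<open>m / 2\<close>, of variance 1,
      the differences of kernels become monomials and \<open>P i l\<close> is a power of
      \<open>q\<close>. Its divisibility by \<open>q ^ A i\<close> is the claimed
      inequality.\<close>
    have "q ^ (A l + b m i) * (tree_kernel m i l - (\<Sum>t\<in>{\<rho>}. tree_kernel m i t))
        = P i l * (q ^ b m l * (tree_kernel m l l - (\<Sum>t\<in>{\<rho>}. tree_kernel m l t)))"
    proof (rule signed)
      show "tree_kernel m \<chi> l = (\<Sum>t\<in>{\<rho>}. tree_kernel m \<chi> t)"
        if \<chi>: "\<chi> \<in> below l" "b m l < b m \<chi>" for \<chi>
        using unique[of \<chi>] \<chi> l\<rho> by (simp add: Up_def tree_kernel_def)
    qed (use \<rho> in \<open>auto simp: Up_def\<close>)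
    moreover have "tree_kernel m i l - (\<Sum>t\<in>{\<rho>}. tree_kernel m i t) = q ^ (m - 2 * b m i)"
      using i(2) l\<rho> low[OF \<rho>] b_J[OF i(1)] Up_i(2)[OF \<rho>]
      by (auto simp: tree_kernel_def kappa_def)
    moreover have "tree_kernel m l l - (\<Sum>t\<in>{\<rho>}. tree_kernel m l t) = q ^ (m - 2 * b m l)"
      using l\<rho> low[OF \<rho>] l2 by (auto simp: tree_kernel_def kappa_def)
    ultimately have eq: "q ^ (A l + b m i + (m - 2 * b m i)) = P i l * q ^ (b m l + (m - 2 * b m l))"
      by (simp add: power_add mult.assoc)
    have "divisible_by_q_power (A i) (P i l)"
      unfolding A_def using P_div[OF supp_in in_supp] J_in_Irr i(1) l by blast
    then obtain f where "P i l = q ^ A i * to_fract f"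
      by (auto simp: divisible_by_q_power_def)
    then have "q ^ (A l + b m i + (m - 2 * b m i)) = q ^ (A i + (b m l + (m - 2 * b m l))) * to_fract f"
      using eq by (simp add: power_add mult_ac)
    then have "A i + (b m l + (m - 2 * b m l)) \<le> A l + b m i + (m - 2 * b m i)"
      by (rule power_le_if_divisible)
    then show "A i + b m i \<le> A l + b m l"
      using l2 b_J[OF i(1)] by linarith
  qed
qed

text \<open>Otherwise the coefficient of \<open>P\<close> between the two characters would be the negative of a power of \<open>q\<close>.\<close>

lemma halves_same_class:
  assumes h: "\<rho> \<in> J" "\<rho>' \<in> J" "2 * b m \<rho> = m" "2 * b m \<rho>' = m" and S: "\<rho> \<notin> S" "\<rho>' \<notin> S"
  shows "supp X \<rho> = supp X \<rho>'"
proof -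
  have False if lt: "(supp X \<rho>, supp X \<rho>') \<in> lt" and h: "\<rho> \<in> J" "\<rho>' \<in> J" "2 * b m \<rho> = m" "2 * b m \<rho>' = m"
    and S: "\<rho> \<notin> S" for \<rho> \<rho>'
  proof -
    have neq: "\<rho> \<noteq> \<rho>'"
      using lt lt_props(3) by (auto simp: irrefl_def)
    have not_below: "\<rho>' \<notin> below \<rho>"
      using lt lt_props(2,3) by (auto simp: below_def irrefl_def dest: transD)
    have halves: "\<psi> = \<rho> \<or> \<psi> = \<rho>'" if "\<psi> \<in> J" "2 * b m \<psi> = m" for \<psi>
      using J_half_partner[OF h(1,3)] h neq that by metis
    note rp = rep_properties[OF J_in_Irr[OF h(1)]]
    have Ar: "A \<rho> < b m \<rho>"
      using rp S by (metis le_neq_implies_less)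
    \<comment> \<open>Since \<open>\<rho>\<close> is not a Springer representation, that of its
      class has a smaller b-value; this provides the predecessor \<open>p\<close>.\<close>
    have "rep \<rho> \<noteq> sign_char m"
      using rp(3) Ar h(3) b_sign m_pos by auto
    then have "rep \<rho> \<in> below \<rho>"
      using rp by (simp add: below_def J_def)
    then obtain p where p: "p \<in> below \<rho>" "b m p < b m \<rho>"
      and p_max: "\<And>d. d \<in> below \<rho> \<Longrightarrow> b m d < b m \<rho> \<Longrightarrow> b m d \<le> b m p"
      using below_max[of "rep \<rho>" \<rho> "b m \<rho>"] rp(3) Ar by force
    have pJ: "p \<in> J"
      using p below_in_J by blast
    \<comment> \<open>The variable of \<open>p\<close> contains the sum of the two independent
      variables of level \<open>m / 2\<close>, so conditioning on it makes these negatively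
      correlated. The weights \<open>1 + c\<close> at \<open>\<rho>\<close> and \<open>- c\<close>
      at \<open>p\<close> annihilate all smaller levels of \<open>below \<rho>\<close> and leave the
      values 1 at \<open>\<rho>\<close> and \<open>- c\<close> at \<open>\<rho>'\<close>.\<close>
    define c where "c = 1 / q ^ (m - 2 * b m p)"
    define v where "v \<chi> = (if \<chi> = \<rho> then 1 + c else 0) + (if \<chi> = p then - c else 0)" for \<chi>
    define y where "y \<chi> = tree_kernel m \<chi> \<rho> * (1 + c) - tree_kernel m \<chi> p * c" for \<chi>
    have \<kappa>: "kappa m \<rho> = 1" "kappa m \<rho>' = 1" "kappa m p = 1 + q ^ (m - 2 * b m p)"
      using h p by (auto simp: kappa_def)
    have "q ^ (A \<rho> + b m \<rho>') * y \<rho>' = P \<rho>' \<rho> * (q ^ b m \<rho> * y \<rho>)"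
    proof (rule P_dual_vector[OF h(1,2)])
      show "\<chi> \<in> below \<rho>" if "\<chi> \<in> J" "v \<chi> \<noteq> 0" for \<chi>
        using that p self_below[OF h(1)] by (auto simp: v_def split: if_splits)
      show "y \<chi> = (\<Sum>\<chi>'\<in>J. tree_kernel m \<chi> \<chi>' * v \<chi>')" if "\<chi> \<in> J" for \<chi>
        using h pJ by (simp add: v_def distrib_left sum.distrib sum_tree_kernel_indicator y_def)
      fix \<chi>
      assume \<chi>: "\<chi> \<in> below \<rho>" "\<chi> \<noteq> \<rho>"
      have \<chi>J: "\<chi> \<in> J"
        using \<chi> below_in_J by blast
      then have "2 * b m \<chi> < m"
        using halves[OF \<chi>J] \<chi> not_below b_J[OF \<chi>J] by (metis le_neq_implies_less)
      then have "b m \<chi> < b m \<rho>"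
        using h by linarith
      moreover from this have "b m \<chi> \<le> b m p"
        using p_max \<chi> by blast
      moreover have "b m \<chi> = b m p \<Longrightarrow> \<chi> = p"
        using J_eqI[OF \<chi>J pJ] \<open>2 * b m \<chi> < m\<close> by auto
      ultimately have "y \<chi> = 1 + c - (1 + q ^ (m - 2 * b m p)) * c"
        by (auto simp: y_def tree_kernel_def \<kappa>)
      also have "\<dots> = 0"
        by (simp add: c_def add_divide_distrib)
      finally show "y \<chi> = 0" .
    qed
    moreover have "y \<rho> = 1"
      using p by (simp add: y_def tree_kernel_def \<kappa>)
    moreover have "y \<rho>' = - c"
      using p h neq by (auto simp: y_def tree_kernel_def \<kappa>)
    moreover have "b m \<rho>' = b m \<rho>"
      using h by linarith
    ultimately have "q ^ b m \<rho> * (q ^ A \<rho> * - c) = q ^ b m \<rho> * P \<rho>' \<rho>"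
      by (simp add: power_add mult_ac)
    then have P_eq: "q ^ A \<rho> * - c = P \<rho>' \<rho>"
      by (simp only: mult_left_cancel[OF power_not_zero[OF q_nonzero]])
    have "P \<rho>' \<rho> * q ^ (m - 2 * b m p) = - (q ^ A \<rho>)"
      by (subst P_eq[symmetric]) (simp add: c_def)
    then show False
      using nonneg_not_negative_power P_nonneg h J_in_Irr by blast
  qed
  then show ?thesis
    using lt_props(4) supp_in J_in_Irr h S unfolding total_on_def by metis
qed


section \<open>Lower bounds for the weights\<close>

text \<open>Among the characters of smaller level but larger weight than \<open>i\<close>, such as
  \<open>s\<close>, take the one of largest level. Then \<open>i\<close> is outside
  \<open>below l\<close>, and nothing in \<open>below l\<close> lies between \<open>l\<close> and
  \<open>i\<close>, so \<open>gap_above_half\<close> applies.\<close>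

lemma A_lower_bound_aux:
  assumes i: "i \<in> J" and s: "s \<in> S" "s \<in> J" "b m s < b m i" "A i < b m s"
  obtains l \<rho> where "l \<in> J" "b m l < b m i" "A i < A l" "\<rho> \<in> below l" "2 * b m \<rho> = m"
    "\<And>d. d \<in> below l \<Longrightarrow> b m l < b m d \<Longrightarrow> d = \<rho>"
proof -
  define B where "B = {\<chi> \<in> J. b m \<chi> < b m i \<and> A i < A \<chi>}"
  have "finite B" "s \<in> B"
    using s S_properties(3)[OF s(1)] Irr_insert(3) by (auto simp: B_def)
  from ex_max_image[OF this, of "b m"] obtain l where lB: "l \<in> B" and l_max: "\<And>d. d \<in> B \<Longrightarrow> b m d \<le> b m l"
    by blast
  have l: "l \<in> J" "b m l < b m i" "A i < A l"
    using lB by (auto simp: B_def)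
  obtain \<rho> where "\<rho> \<in> below l" "2 * b m \<rho> = m" "\<And>d. d \<in> below l \<Longrightarrow> b m l < b m d \<Longrightarrow> d = \<rho>"
  proof (rule gap_above_half[OF l(1) i l(2)])
    show "i \<notin> below l"
      using below_A[of i l] l(3) by auto
    show "b m d \<le> b m l" if "d \<in> below l" "b m d < b m i" for d
    proof -
      have "d \<in> B"
        using that below_in_J below_A[OF that(1)] l(3) by (auto simp: B_def)
      then show ?thesis
        by (rule l_max)
    qed
  qed blast
  then show ?thesis
    using that l by blast
qed

text \<open>If one character of level \<open>m / 2\<close> is in \<open>below l\<close>, so is the
  other: if both are in \<open>S\<close>, their weight \<open>m / 2\<close> exceeds
  \<open>A l\<close>; if neither is, they share a class. This contradicts the uniqueness of
  \<open>\<rho>\<close>.\<close>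

lemma A_lower_bound:
  assumes i: "i \<in> J" and s: "s \<in> S" "s \<in> J" "b m s < b m i"
    and halves: "\<And>\<rho> \<rho>'. \<rho> \<in> J \<Longrightarrow> \<rho>' \<in> J \<Longrightarrow> 2 * b m \<rho> = m \<Longrightarrow> 2 * b m \<rho>' = m \<Longrightarrow> \<rho> \<in> S \<Longrightarrow> \<rho>' \<in> S"
  shows "b m s \<le> A i"
proof (rule ccontr)
  assume "\<not> b m s \<le> A i"
  then obtain l \<rho> where l: "l \<in> J" "b m l < b m i" "A i < A l" and \<rho>: "\<rho> \<in> below l" "2 * b m \<rho> = m"
    and unique: "\<And>d. d \<in> below l \<Longrightarrow> b m l < b m d \<Longrightarrow> d = \<rho>"
    using A_lower_bound_aux[OF i s] by (metis not_le)
  have \<rho>J: "\<rho> \<in> J"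
    using \<rho> below_in_J by blast
  obtain \<rho>' where \<rho>': "\<rho>' \<in> J" "\<rho>' \<noteq> \<rho>" "2 * b m \<rho>' = m"
    using J_half_partner[OF \<rho>J \<rho>(2)] by metis
  have l_less: "b m l < b m \<rho>'"
    using l(2) b_J[OF i] \<rho>'(3) by linarith
  have "\<rho>' \<in> below l"
  proof (cases "\<rho> \<in> S")
    case True
    then have "A \<rho>' = b m \<rho>'"
      using halves \<rho>J \<rho>' \<rho>(2) S_properties(3) by blast
    moreover have "A l \<le> b m l"
      using rep_properties(6) J_in_Irr l(1) by blast
    ultimately show ?thesis
      using belowI \<rho>' l l_less by simp
  next
    case False
    then have "\<rho>' \<notin> S"
      using halves \<rho>J \<rho>' \<rho>(2) by blast
    then have "supp X \<rho>' = supp X \<rho>"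
      using halves_same_class \<rho>J \<rho>' \<rho>(2) False by metis
    then show ?thesis
      using \<rho>(1) \<rho>'(1) by (simp add: below_def)
  qed
  then show False
    using unique l_less \<rho>'(2) by blast
qed

lemma A_lower_bound_below:
  assumes i: "i \<in> J" and s: "s \<in> S" "s \<in> J" "b m s < b m i"
    and t: "t \<in> S" "t \<in> J" "b m i < b m t" "2 * b m t < m"
  shows "b m s \<le> A i"
proof (rule ccontr)
  assume "\<not> b m s \<le> A i"
  then obtain l \<rho> where l: "l \<in> J" "b m l < b m i" "A i < A l" and \<rho>: "\<rho> \<in> below l" "2 * b m \<rho> = m"
    and unique: "\<And>d. d \<in> below l \<Longrightarrow> b m l < b m d \<Longrightarrow> d = \<rho>"
    using A_lower_bound_aux[OF i s] by (metis not_le)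
  have "A l \<le> b m l"
    using rep_properties(6) J_in_Irr l(1) by blast
  then have "t \<in> below l"
    using belowI t l S_properties(3)[OF t(1)] by simp
  then have "t = \<rho>"
    using unique t l by simp
  then show False
    using \<rho>(2) t(4) by simp
qed

text \<open>If the weight of \<open>i\<close> were too small, the gap at \<open>i\<close> would
  leave only \<open>\<rho>\<close> in \<open>below s\<close> past \<open>i\<close>. Then
  \<open>\<rho>'\<close> is outside, and the gap at \<open>\<rho>'\<close>, of weight at least 1,
  forces the class of \<open>s\<close> to reach at least the level of \<open>i\<close>, a
  contradiction.\<close>

lemma A_lower_bound_exceptional:
  assumes \<rho>: "\<rho> \<in> S" "\<rho> \<in> J" "2 * b m \<rho> = m" and \<rho>': "\<rho>' \<in> J" "\<rho>' \<notin> S" "2 * b m \<rho>' = m"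
    and s: "s \<in> S" "s \<in> J" "2 * b m s < m"
    and s_max: "\<And>t. t \<in> S \<Longrightarrow> t \<in> J \<Longrightarrow> 2 * b m t < m \<Longrightarrow> b m t \<le> b m s"
    and i: "i \<in> J" "b m s < b m i" "b m i + b m s \<le> b m \<rho> + 1"
  shows "b m s \<le> A i"
proof (rule ccontr)
  assume "\<not> b m s \<le> A i"
  then have Ai: "A i < b m s"
    by simp
  have As: "A s = b m s"
    using S_properties(3)[OF s(1)] .
  have i_not: "i \<notin> below s"
    using below_A[of i s] Ai As by auto
  \<comment> \<open>As \<open>s\<close> has the largest level among the Springer representations
    before \<open>m / 2\<close>, members of \<open>below s\<close> of level less than
    \<open>m / 2\<close> all lie in the class of \<open>s\<close> itself.\<close>
  have same: "A d = A s \<and> below d = below s" if d: "d \<in> below s" "2 * b m d < m" for d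
  proof -
    have dI: "d \<in> Irr m"
      using d below_in_J J_in_Irr by blast
    note r = rep_properties[OF dI]
    have r2: "2 * b m (rep d) < m"
      using r(3,6) d(2) by linarith
    then have rJ: "rep d \<in> J"
      using r(2) b_sign m_pos by (auto simp: J_def)
    have "b m (rep d) \<le> b m s"
      using s_max r(5) rJ r2 by blast
    then have Ad: "A d = A s"
      using below_A[OF d(1)] As r(3) by simp
    then have "rep d = s"
      using J_eqI[OF rJ s(2)] r(3) As r2 by simp
    then have "supp X d = supp X s"
      using r(4) by metis
    then show ?thesis
      using Ad by (simp add: below_def)
  qed
  have \<rho>_below: "\<rho> \<in> below s"
    using belowI \<rho> s S_properties(3)[OF \<rho>(1)] As by simp
  obtain l0 where l0: "l0 \<in> below s" "b m l0 < b m i"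
    and l0_max: "\<And>d. d \<in> below s \<Longrightarrow> b m d < b m i \<Longrightarrow> b m d \<le> b m l0"
    using below_max[OF self_below[OF s(2)] i(2)] by blast
  have l0_2: "2 * b m l0 < m"
    using l0(2) b_J[OF i(1)] by linarith
  have l0_same: "A l0 = A s" "below l0 = below s"
    using same[OF l0(1) l0_2] by auto
  have "\<exists>\<rho>0. \<forall>d\<in>below l0. b m l0 < b m d \<longrightarrow> d = \<rho>0"
  proof (rule gap_above_half[OF below_in_J[OF l0(1)] i(1) l0(2)])
    show "i \<notin> below l0" "\<And>d. d \<in> below l0 \<Longrightarrow> b m d < b m i \<Longrightarrow> b m d \<le> b m l0"
      using i_not l0_max unfolding l0_same by auto
  qed blast
  then obtain \<rho>0 where Up0: "\<And>d. d \<in> below l0 \<Longrightarrow> b m l0 < b m d \<Longrightarrow> d = \<rho>0"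
    by blast
  have \<rho>_unique: "d = \<rho>" if "d \<in> below s" "b m l0 < b m d" for d
    using Up0[of d] Up0[of \<rho>] that \<rho>_below l0_2 \<rho>(3) unfolding l0_same by simp
  have \<rho>'_not: "\<rho>' \<notin> below s"
    using \<rho>_unique[of \<rho>'] \<rho> \<rho>' l0_2 by auto
  have "b m s < b m \<rho>'"
    using s(3) \<rho>'(3) by linarith
  then obtain l where l: "l \<in> below s" "b m l < b m \<rho>'"
    and l_max: "\<And>d. d \<in> below s \<Longrightarrow> b m d < b m \<rho>' \<Longrightarrow> b m d \<le> b m l"
    using below_max[OF self_below[OF s(2)]] by blast
  have l_2: "2 * b m l < m"
    using l(2) \<rho>'(3) by linarith
  have l_same: "A l = A s" "below l = below s"
    using same[OF l(1) l_2] by auto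
  have "A \<rho>' + b m \<rho>' \<le> A l + b m l"
  proof (rule gap_above_half[OF below_in_J[OF l(1)] \<rho>'(1) l(2)])
    show "\<rho>' \<notin> below l" "\<And>d. d \<in> below l \<Longrightarrow> b m d < b m \<rho>' \<Longrightarrow> b m d \<le> b m l"
      using \<rho>'_not l_max unfolding l_same by auto
  qed
  moreover have "1 \<le> A \<rho>'"
  proof (rule A_ge_one[OF \<rho>'(1)])
    show "\<rho>' \<noteq> trivial_char m"
      using b_trivial \<rho>'(3) m_pos by (metis mult_zero_right less_irrefl)
  qed
  moreover have "b m \<rho>' = b m \<rho>"
    using \<rho> \<rho>' by linarith
  \<comment> \<open>The gap at \<open>\<rho>'\<close> gives
    \<open>b m \<rho> + 1 \<le> b m s + b m l\<close>, the hypothesis on \<open>i\<close> gives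
    \<open>b m i + b m s \<le> b m \<rho> + 1\<close>.\<close>
  ultimately have "b m i \<le> b m l"
    using i(3) l_same(1) As by linarith
  then have "l = \<rho>"
    using \<rho>_unique[OF l(1)] l0(2) by simp
  then show False
    using l_2 \<rho>(3) by simp
qed

end

section \<open>The maximal Springer correspondence\<close>

text \<open>A function on \<open>J\<close> stands for a linear combination of the variables of the
  walk, and \<open>cov\<close> for the covariance of two such combinations.\<close>

definition (in dihedral) cov :: "((complex mat \<Rightarrow> complex) \<Rightarrow> complex poly fract) \<Rightarrow>
    ((complex mat \<Rightarrow> complex) \<Rightarrow> complex poly fract) \<Rightarrow> complex poly fract" where
  "cov f g = (\<Sum>x\<in>J. \<Sum>y\<in>J. f x * tree_kernel m x y * g y)"

definition ind :: "'a \<Rightarrow> 'a \<Rightarrow> complex poly fract" where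
  "ind x y = (if y = x then 1 else 0)"

context dihedral
begin

lemma cov_sym: "cov f g = cov g f"
  unfolding cov_def by (subst sum.swap) (simp add: tree_kernel_sym[of m] mult_ac)

lemma cov_diff: "cov (\<lambda>x. f x - g x) h = cov f h - cov g h"
  "cov h (\<lambda>x. f x - g x) = cov h f - cov h g"
  by (simp_all add: cov_def algebra_simps sum_subtractf)

lemma cov_scale: "cov (\<lambda>x. c * f x) h = c * cov f h" "cov h (\<lambda>x. c * f x) = c * cov h f"
  by (simp_all add: cov_def sum_distrib_left mult_ac)

lemma cov_sum: "cov (\<lambda>x. \<Sum>i\<in>B. f i x) h = (\<Sum>i\<in>B. cov (f i) h)" "cov h (\<lambda>x. \<Sum>i\<in>B. f i x) = (\<Sum>i\<in>B. cov h (f i))"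
proof -
  show 1: "cov (\<lambda>x. \<Sum>i\<in>B. f i x) h = (\<Sum>i\<in>B. cov (f i) h)" for h
  proof (induction B rule: infinite_finite_induct)
    case (insert i B)
    then show ?case
      by (simp add: cov_def distrib_right sum.distrib)
  qed (simp_all add: cov_def)
  show "cov h (\<lambda>x. \<Sum>i\<in>B. f i x) = (\<Sum>i\<in>B. cov h (f i))"
    using 1[of h] by (simp add: cov_sym[of h])
qed

lemma cov_ind: "x \<in> J \<Longrightarrow> y \<in> J \<Longrightarrow> cov (ind x) (ind y) = tree_kernel m x y"
proof -
  assume xy: "x \<in> J" "y \<in> J"
  have "cov (ind x) (ind y) = (\<Sum>c\<in>J. if c = x then \<Sum>d\<in>J. if d = y then tree_kernel m c d else 0 else 0)"
    unfolding cov_def by (intro sum.cong refl) (auto simp: ind_def intro!: sum.cong)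
  then show ?thesis
    using xy Irr_insert(3) by simp
qed

end

section \<open>The candidate for the maximal correspondence\<close>

locale springer_reps = dihedral +
  fixes S
  assumes S_Irr: "S \<subseteq> Irr m" and S_special: "trivial_char m \<in> S" "reflection_char m \<in> S" "sign_char m \<in> S"
begin

text \<open>This set has two elements if the next level consists of both characters with \<open>b\<close>-value \<open>m / 2\<close>.\<close>

definition N :: "(complex mat \<Rightarrow> complex) \<Rightarrow> (complex mat \<Rightarrow> complex) set" where
  "N \<chi> = {\<psi> \<in> S \<inter> J. b m \<chi> < b m \<psi> \<and> (\<forall>\<phi>\<in>S \<inter> J. b m \<chi> < b m \<phi> \<longrightarrow> b m \<psi> \<le> b m \<phi>)}"

lemma N_subset: "N \<chi> \<subseteq> S \<inter> J" "N \<chi> \<subseteq> J" "finite (N \<chi>)"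
  using Irr_insert(3) by (auto simp: N_def)

lemma N_nonempty:
  assumes "\<phi> \<in> S" "\<phi> \<in> J" "b m \<chi> < b m \<phi>"
  obtains \<psi> where "\<psi> \<in> N \<chi>" "b m \<psi> \<le> b m \<phi>"
proof -
  have "finite {\<phi> \<in> S \<inter> J. b m \<chi> < b m \<phi>}" "\<phi> \<in> {\<phi> \<in> S \<inter> J. b m \<chi> < b m \<phi>}"
    using assms Irr_insert(3) by auto
  from ex_min_image[OF this, of "b m"] obtain \<psi> where "\<psi> \<in> {\<phi> \<in> S \<inter> J. b m \<chi> < b m \<phi>}"
    "\<forall>z\<in>{\<phi> \<in> S \<inter> J. b m \<chi> < b m \<phi>}. b m \<psi> \<le> b m z"
    by blast
  then show ?thesis
    using that[of \<psi>] assms by (auto simp: N_def)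
qed

lemma N_singleton:
  assumes "\<nu> \<in> N \<chi>" "2 * b m \<nu> < m"
  shows "N \<chi> = {\<nu>}"
proof -
  have "\<psi> = \<nu>" if "\<psi> \<in> N \<chi>" for \<psi>
  proof -
    have "b m \<psi> = b m \<nu>"
      using assms(1) that by (auto simp: N_def intro!: antisym)
    then show ?thesis
      using J_eqI[of \<psi> \<nu>] assms that by (auto simp: N_def)
  qed
  then show ?thesis
    using assms(1) by blast
qed

lemma N_half: "2 * b m \<chi> = m \<Longrightarrow> N \<chi> = {}"
  using b_J by (force simp: N_def)

text \<open>The residual of \<open>\<chi>\<close>, seen as an element of the random walk, after regression on the classes
  below it; \<open>eta\<close> below corrects it for the characters above the level \<open>L\<close>, which are regressed on
  \<open>chi_L\<close> as well.\<close>

definition eta0 :: "(complex mat \<Rightarrow> complex) \<Rightarrow> (complex mat \<Rightarrow> complex) \<Rightarrow> complex poly fract" where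
  "eta0 \<chi> = (\<lambda>x. ind \<chi> x - (\<Sum>y\<in>N \<chi>. ind y x))"

text \<open>Telescoping: the terms subtracted in one residual are the leading terms of the next, so
  only the first successors of \<open>\<chi>\<close> survive. Characters of level
  \<open>m / 2\<close> have no successor and end the chain.\<close>

lemma sum_eta0_above:
  "(\<Sum>\<psi>\<in>{\<psi> \<in> S \<inter> J. b m \<chi> < b m \<psi>}. eta0 \<psi> x) = (\<Sum>y\<in>N \<chi>. ind y x)"
proof (induction "m - b m \<chi>" arbitrary: \<chi> rule: less_induct)
  case less
  show ?case
  proof (cases "{\<psi> \<in> S \<inter> J. b m \<chi> < b m \<psi>} = {}")
    case True
    then have "N \<chi> = {}"
      by (auto simp: N_def)
    then show ?thesis
      unfolding True by simp
  next
    case False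
    then obtain \<nu> where \<nu>: "\<nu> \<in> N \<chi>"
      using N_nonempty by blast
    have \<nu>J: "\<nu> \<in> S" "\<nu> \<in> J" "b m \<chi> < b m \<nu>"
      using \<nu> by (auto simp: N_def)
    show ?thesis
    proof (cases "2 * b m \<nu> < m")
      case True
      have N: "N \<chi> = {\<nu>}"
        using N_singleton \<nu> True by blast
      have "b m \<nu> < b m \<psi>" if "\<psi> \<in> S \<inter> J" "b m \<chi> < b m \<psi>" "\<psi> \<noteq> \<nu>" for \<psi>
      proof -
        have "b m \<nu> \<le> b m \<psi>"
          using \<nu> that by (auto simp: N_def)
        moreover have "b m \<nu> \<noteq> b m \<psi>"
          using J_eqI[of \<nu> \<psi>] \<nu>J that True by auto
        ultimately show ?thesis
          by simp
      qed
      then have eq: "{\<psi> \<in> S \<inter> J. b m \<chi> < b m \<psi>} = insert \<nu> {\<psi> \<in> S \<inter> J. b m \<nu> < b m \<psi>}"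
        using \<nu>J by auto
      have "m - b m \<nu> < m - b m \<chi>"
        using \<nu>J(3) True by linarith
      then have IH: "(\<Sum>\<psi>\<in>{\<psi> \<in> S \<inter> J. b m \<nu> < b m \<psi>}. eta0 \<psi> x) = (\<Sum>y\<in>N \<nu>. ind y x)"
        by (rule less)
      have "(\<Sum>\<psi>\<in>insert \<nu> {\<psi> \<in> S \<inter> J. b m \<nu> < b m \<psi>}. eta0 \<psi> x)
          = eta0 \<nu> x + (\<Sum>\<psi>\<in>{\<psi> \<in> S \<inter> J. b m \<nu> < b m \<psi>}. eta0 \<psi> x)"
        using Irr_insert(3) by (subst sum.insert) auto
      then show ?thesis
        unfolding eq N IH by (simp add: eta0_def[of \<nu>])
    next
      case False
      have half: "2 * b m \<psi> = m" if "\<psi> \<in> S \<inter> J" "b m \<chi> < b m \<psi>" for \<psi>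
      proof -
        have "b m \<nu> \<le> b m \<psi>"
          using \<nu> that by (auto simp: N_def)
        then show ?thesis
          using False b_J[of \<psi>] that by auto
      qed
      have "b m \<psi> \<le> b m \<phi>"
        if "\<psi> \<in> S \<inter> J" "b m \<chi> < b m \<psi>" "\<phi> \<in> S \<inter> J" "b m \<chi> < b m \<phi>" for \<phi> \<psi>
        using half[OF that(1,2)] half[OF that(3,4)] by linarith
      then have "N \<chi> = {\<psi> \<in> S \<inter> J. b m \<chi> < b m \<psi>}"
        unfolding N_def by blast
      moreover have "N \<psi> = {}" if "\<psi> \<in> S \<inter> J" "b m \<chi> < b m \<psi>" for \<psi>
        using half[OF that] by (rule N_half)
      ultimately show ?thesis
        by (intro sum.cong) (auto simp: eta0_def)
    qed
  qed
qed

definition exceptional :: bool where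
  "exceptional \<longleftrightarrow> (\<exists>\<rho>\<in>J \<inter> S. \<exists>\<rho>'\<in>J - S. 2 * b m \<rho> = m \<and> 2 * b m \<rho>' = m)"

definition smax :: "complex mat \<Rightarrow> complex" where
  "smax = (SOME s. s \<in> S \<inter> J \<and> 2 * b m s < m \<and> (\<forall>t\<in>S \<inter> J. 2 * b m t < m \<longrightarrow> b m t \<le> b m s))"

text \<open>The condition \<open>A i + b m i \<le> A l + b m l\<close> of the lemma \<open>gap_above_half\<close>, for \<open>l\<close> the last
  element of the class of \<open>smax\<close> and \<open>i\<close> of level \<open>m / 2\<close> with \<open>A i = 1\<close>, says that this
  class reaches at least up to the level \<open>L\<close>.\<close>

definition L :: nat where
  "L = max (b m smax) (m div 2 + 1 - b m smax)"

text \<open>These are the characters moved to the class of the reflection character. If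
  \<open>smax\<close> is the reflection character itself, then \<open>L = m div 2\<close> and there
  are none.\<close>

definition high :: "(complex mat \<Rightarrow> complex) \<Rightarrow> bool" where
  "high \<chi> \<longleftrightarrow> exceptional \<and> \<chi> \<in> J \<and> \<chi> \<notin> S \<and> L < b m \<chi>"

definition spred :: "(complex mat \<Rightarrow> complex) \<Rightarrow> complex mat \<Rightarrow> complex" where
  "spred \<chi> = (SOME s. s \<in> S \<inter> J \<and> b m s < b m \<chi> \<and> (\<forall>t\<in>S \<inter> J. b m t < b m \<chi> \<longrightarrow> b m t \<le> b m s))"

definition rep0 :: "(complex mat \<Rightarrow> complex) \<Rightarrow> complex mat \<Rightarrow> complex" where
  "rep0 \<chi> = (if \<chi> \<in> S then \<chi> else if high \<chi> then reflection_char m else spred \<chi>)"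

lemma reflection_SJ: "reflection_char m \<in> S \<inter> J" "2 * b m (reflection_char m) < m"
  using S_special reflection_in_J b_reflection m_ge_3 by auto

lemma smax_properties:
  "smax \<in> S" "smax \<in> J" "2 * b m smax < m" "1 \<le> b m smax"
  "t \<in> S \<Longrightarrow> t \<in> J \<Longrightarrow> 2 * b m t < m \<Longrightarrow> b m t \<le> b m smax"
proof -
  have "finite {s \<in> S \<inter> J. 2 * b m s < m}" "reflection_char m \<in> {s \<in> S \<inter> J. 2 * b m s < m}"
    using reflection_SJ Irr_insert(3) by auto
  from ex_max_image[OF this, of "b m"] have "\<exists>s. s \<in> S \<inter> J \<and> 2 * b m s < m \<and> (\<forall>t\<in>S \<inter> J. 2 * b m t < m \<longrightarrow> b m t \<le> b m s)"
    by blast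
  from someI_ex[OF this, folded smax_def]
  have *: "smax \<in> S \<inter> J \<and> 2 * b m smax < m \<and> (\<forall>t\<in>S \<inter> J. 2 * b m t < m \<longrightarrow> b m t \<le> b m smax)" .
  then show "smax \<in> S" "smax \<in> J" "2 * b m smax < m" "t \<in> S \<Longrightarrow> t \<in> J \<Longrightarrow> 2 * b m t < m \<Longrightarrow> b m t \<le> b m smax"
    by auto
  show "1 \<le> b m smax"
  proof -
    have "b m (reflection_char m) \<le> b m smax"
      using * reflection_SJ by blast
    then show ?thesis
      by (simp add: b_reflection)
  qed
qed

lemma not_in_S:
  assumes "\<chi> \<in> Irr m" "\<chi> \<notin> S"
  shows "\<chi> \<in> J" "2 \<le> b m \<chi>"
proof -
  show J: "\<chi> \<in> J"
    using assms S_special by (auto simp: J_def)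
  have "b m \<chi> \<noteq> 0"
    using J_eqI[OF J trivial_in_J] b_trivial m_pos assms S_special by auto
  moreover have "b m \<chi> \<noteq> 1"
    using J_eqI[OF J reflection_in_J] b_reflection m_ge_3 assms S_special by auto
  ultimately show "2 \<le> b m \<chi>"
    by simp
qed

lemma spred_properties:
  assumes "\<chi> \<in> Irr m" "\<chi> \<notin> S"
  shows "spred \<chi> \<in> S" "spred \<chi> \<in> J" "b m (spred \<chi>) < b m \<chi>" "2 * b m (spred \<chi>) < m" "1 \<le> b m (spred \<chi>)"
    and "t \<in> S \<Longrightarrow> t \<in> J \<Longrightarrow> b m t < b m \<chi> \<Longrightarrow> b m t \<le> b m (spred \<chi>)"
proof -
  have "finite {s \<in> S \<inter> J. b m s < b m \<chi>}" "reflection_char m \<in> {s \<in> S \<inter> J. b m s < b m \<chi>}"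
    using reflection_SJ Irr_insert(3) not_in_S(2)[OF assms] b_reflection by auto
  from ex_max_image[OF this, of "b m"]
  have "\<exists>s. s \<in> S \<inter> J \<and> b m s < b m \<chi> \<and> (\<forall>t\<in>S \<inter> J. b m t < b m \<chi> \<longrightarrow> b m t \<le> b m s)"
    by blast
  from someI_ex[OF this, folded spred_def]
  have *: "spred \<chi> \<in> S \<inter> J \<and> b m (spred \<chi>) < b m \<chi> \<and> (\<forall>t\<in>S \<inter> J. b m t < b m \<chi> \<longrightarrow> b m t \<le> b m (spred \<chi>))" .
  then show "spred \<chi> \<in> S" "spred \<chi> \<in> J" "b m (spred \<chi>) < b m \<chi>"
    "t \<in> S \<Longrightarrow> t \<in> J \<Longrightarrow> b m t < b m \<chi> \<Longrightarrow> b m t \<le> b m (spred \<chi>)"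
    by auto
  show "2 * b m (spred \<chi>) < m"
    using * b_J[OF not_in_S(1)[OF assms]] by linarith
  show "1 \<le> b m (spred \<chi>)"
  proof -
    have "b m (reflection_char m) < b m \<chi>"
      using not_in_S(2)[OF assms] b_reflection by simp
    then have "b m (reflection_char m) \<le> b m (spred \<chi>)"
      using * reflection_SJ by blast
    then show ?thesis
      by (simp add: b_reflection)
  qed
qed

lemma rep0_properties:
  assumes "\<chi> \<in> Irr m"
  shows "rep0 \<chi> \<in> S" "rep0 (rep0 \<chi>) = rep0 \<chi>" "\<chi> \<in> S \<Longrightarrow> rep0 \<chi> = \<chi>"
    and "\<chi> \<notin> S \<Longrightarrow> rep0 \<chi> \<in> J" "\<chi> \<notin> S \<Longrightarrow> b m (rep0 \<chi>) < b m \<chi>" "\<chi> \<notin> S \<Longrightarrow> 2 * b m (rep0 \<chi>) < m"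
    and "\<chi> \<notin> S \<Longrightarrow> 1 \<le> b m (rep0 \<chi>)" "b m (rep0 \<chi>) \<le> b m \<chi>"
proof -
  show 1: "rep0 \<chi> \<in> S"
    using spred_properties(1)[OF assms] S_special by (simp add: rep0_def)
  then show "rep0 (rep0 \<chi>) = rep0 \<chi>"
    by (simp add: rep0_def[of "rep0 \<chi>"])
  show "\<chi> \<in> S \<Longrightarrow> rep0 \<chi> = \<chi>"
    by (simp add: rep0_def)
  show "\<chi> \<notin> S \<Longrightarrow> rep0 \<chi> \<in> J" "\<chi> \<notin> S \<Longrightarrow> 2 * b m (rep0 \<chi>) < m" "\<chi> \<notin> S \<Longrightarrow> 1 \<le> b m (rep0 \<chi>)"
    using spred_properties[OF assms] reflection_SJ b_reflection by (simp_all add: rep0_def)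
  show less: "b m (rep0 \<chi>) < b m \<chi>" if "\<chi> \<notin> S"
    using spred_properties(3)[OF assms] not_in_S(2)[OF assms] that b_reflection by (simp add: rep0_def)
  show "b m (rep0 \<chi>) \<le> b m \<chi>"
    using less by (cases "\<chi> \<in> S") (auto simp: rep0_def)
qed

text \<open>A high character only needs weight 1. Otherwise the generic bound applies outside the
  exceptional case; in the exceptional case \<open>smax\<close> serves as the upper barrier for
  characters below it, and the definition of \<open>L\<close> supplies the inequality for those from
  \<open>smax\<close> up to \<open>L\<close>.\<close>

lemma rep0_le:
  assumes sp: "springer m S X lt a P \<Lambda>" and \<chi>: "\<chi> \<in> Irr m" "\<chi> \<notin> S"
  shows "b m (rep0 \<chi>) \<le> a (supp X \<chi>)"
proof -
  interpret springer m S X lt a P \<Lambda>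
    by fact
  have J: "\<chi> \<in> J" and b2: "2 \<le> b m \<chi>"
    using not_in_S[OF \<chi>] by auto
  note pr = spred_properties[OF \<chi>]
  have "b m (rep0 \<chi>) \<le> A \<chi>"
  proof (cases "high \<chi>")
    case True
    have "\<chi> \<noteq> trivial_char m"
      using b2 b_trivial by auto
    then show ?thesis
      using A_ge_one[OF J] True \<chi> b_reflection by (simp add: rep0_def)
  next
    case False
    then have r: "rep0 \<chi> = spred \<chi>"
      using \<chi> by (simp add: rep0_def)
    show ?thesis
    proof (cases exceptional)
      case False
      then show ?thesis
        unfolding r by (intro A_lower_bound[OF J pr(1,2,3)]) (auto simp: exceptional_def)
    next
      case True
      then obtain \<rho> \<rho>' where \<rho>: "\<rho> \<in> J" "\<rho> \<in> S" "2 * b m \<rho> = m" and \<rho>': "\<rho>' \<in> J" "\<rho>' \<notin> S" "2 * b m \<rho>' = m"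
        by (auto simp: exceptional_def)
      note t = smax_properties
      show ?thesis
      proof (cases "b m \<chi> < b m smax")
        case True
        then show ?thesis
          unfolding r using A_lower_bound_below[OF J pr(1,2,3) t(1,2)] t(3) by blast
      next
        case False
        have "b m \<chi> \<noteq> b m smax"
          using J_eqI[OF J t(2)] t(1,3) \<chi>(2) by auto
        then have less: "b m smax < b m \<chi>"
          using False by simp
        have "b m \<chi> \<le> L"
          using \<open>\<not> high \<chi>\<close> True J \<chi>(2) by (auto simp: high_def)
        \<comment> \<open>Since \<open>\<chi>\<close> lies strictly beyond \<open>smax\<close>, the
          bound \<open>L\<close> must be the second argument of its maximum.\<close>
        then have "b m \<chi> + b m smax \<le> b m \<rho> + 1"
          using less \<rho>(3) by (auto simp: L_def max_def split: if_splits)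
        then have "b m smax \<le> A \<chi>"
          using A_lower_bound_exceptional[OF \<rho>(2,1,3) \<rho>' t(1,2,3) t(5) J less] by blast
        moreover have "b m (spred \<chi>) \<le> b m smax"
          using t(5) pr by blast
        ultimately show ?thesis
          unfolding r by simp
      qed
    qed
  qed
  then show ?thesis
    by (simp add: A_def)
qed


section \<open>Orthogonality of the residuals\<close>

lemma cov_ind_eta0:
  assumes "\<chi> \<in> J" "\<psi> \<in> J"
  shows "cov (ind \<chi>) (eta0 \<psi>) = tree_kernel m \<chi> \<psi> - (\<Sum>y\<in>N \<psi>. tree_kernel m \<chi> y)"
proof -
  have "(\<Sum>y\<in>N \<psi>. cov (ind \<chi>) (ind y)) = (\<Sum>y\<in>N \<psi>. tree_kernel m \<chi> y)"
    using subsetD[OF N_subset(2)] assms by (intro sum.cong) (auto simp: cov_ind)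
  then show ?thesis
    using assms by (simp add: eta0_def cov_diff cov_sum cov_ind)
qed

text \<open>Markov property: from the first successor of \<open>\<psi>\<close> on,
  \<open>\<psi>\<close> and its successors have the same total covariance with
  \<open>\<chi>\<close>. The last hypothesis excludes a character of level \<open>m / 2\<close> that
  is missing among successors at that level.\<close>

lemma cov_ind_eta0_zero:
  assumes "\<chi> \<in> J" "\<psi> \<in> J" and y: "y \<in> N \<psi>" "b m y \<le> b m \<chi>" and half: "2 * b m \<chi> = m \<Longrightarrow> \<chi> \<in> S \<or> 2 * b m y < m"
  shows "cov (ind \<chi>) (eta0 \<psi>) = 0"
proof -
  have yJ: "y \<in> J" "y \<in> S" "b m \<psi> < b m y"
    using y by (auto simp: N_def)
  then have K: "tree_kernel m \<chi> \<psi> = kappa m \<chi>"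
    using y by (simp add: tree_kernel_def)
  have "(\<Sum>y\<in>N \<psi>. tree_kernel m \<chi> y) = kappa m \<chi>"
  proof (cases "2 * b m y < m")
    case True
    have "b m y = b m \<chi> \<Longrightarrow> y = \<chi>"
      using J_eqI[OF yJ(1) assms(1)] True by simp
    then have "tree_kernel m \<chi> y = kappa m \<chi>"
      using y(2) by (auto simp: tree_kernel_def)
    then show ?thesis
      using N_singleton[OF y(1) True] by simp
  next
    case False
    then have 2: "2 * b m \<chi> = m" "b m \<chi> = b m y"
      using y(2) b_J[OF assms(1)] by linarith+
    then have \<chi>N: "\<chi> \<in> N \<psi>"
      using half False y assms(1) by (auto simp: N_def)
    have "(\<Sum>y\<in>N \<psi>. tree_kernel m \<chi> y) = (\<Sum>y\<in>N \<psi>. if y = \<chi> then kappa m \<chi> else 0)"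
    proof (intro sum.cong refl)
      fix z
      assume "z \<in> N \<psi>"
      then have "b m z = b m \<chi>"
        using \<chi>N by (auto simp: N_def intro!: antisym)
      then show "tree_kernel m \<chi> z = (if z = \<chi> then kappa m \<chi> else 0)"
        by (simp add: tree_kernel_def)
    qed
    then show ?thesis
      using \<chi>N N_subset(3) by simp
  qed
  then show ?thesis
    by (simp add: cov_ind_eta0 assms(1,2) K)
qed

text \<open>The terms subtracted in \<open>eta0 \<chi>\<close> are Springer representations beyond
  the level of \<open>\<psi>\<close>, and \<open>eta0 \<psi>\<close> is orthogonal to all of
  these.\<close>

lemma cov_eta0_eta0:
  assumes "\<chi> \<in> J" "\<psi> \<in> J" "b m \<psi> \<le> b m \<chi>"
  shows "cov (eta0 \<chi>) (eta0 \<psi>) = cov (ind \<chi>) (eta0 \<psi>)"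
proof -
  have "cov (ind y) (eta0 \<psi>) = 0" if "y \<in> N \<chi>" for y
  proof -
    have y: "y \<in> S" "y \<in> J" "b m \<psi> < b m y"
      using that assms(3) by (auto simp: N_def)
    obtain y' where "y' \<in> N \<psi>" "b m y' \<le> b m y"
      using N_nonempty[OF y] by blast
    then show ?thesis
      using cov_ind_eta0_zero y assms(2) by blast
  qed
  then show ?thesis
    by (simp add: eta0_def[of \<chi>] cov_diff cov_sum)
qed

text \<open>If \<open>b m \<psi> < b m \<chi>\<close> and the classes differ, then
  \<open>rep0 \<chi>\<close> lies strictly beyond \<open>\<psi>\<close>, since otherwise both would
  have the same nearest Springer representation. So a successor of \<open>\<psi>\<close> is met no
  later than \<open>\<chi>\<close>.\<close>

lemma cov_eta0_orthogonal:
  assumes "\<chi> \<in> J" "\<psi> \<in> J" "\<not> high \<chi>" "\<not> high \<psi>" "rep0 \<chi> \<noteq> rep0 \<psi>"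
  shows "cov (eta0 \<chi>) (eta0 \<psi>) = 0"
proof -
  have main: "cov (eta0 \<chi>) (eta0 \<psi>) = 0"
    if J: "\<chi> \<in> J" "\<psi> \<in> J" and nh: "\<not> high \<chi>" "\<not> high \<psi>" and neq: "rep0 \<chi> \<noteq> rep0 \<psi>" and le: "b m \<psi> \<le> b m \<chi>" for \<chi> \<psi>
    unfolding cov_eta0_eta0[OF J le]
  proof (cases "b m \<psi> = b m \<chi>")
    case True
    have "2 * b m \<psi> = m"
      using J_eqI[OF J(2,1) True] neq b_J[OF J(2)] by (metis le_neq_implies_less)
    then show "cov (ind \<chi>) (eta0 \<psi>) = 0"
      using neq True by (auto simp: cov_ind_eta0 J N_half tree_kernel_def)
  next
    case False
    with le have less: "b m \<psi> < b m \<chi>"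
      by simp
    note r = rep0_properties[OF J_in_Irr[OF J(1)]] and r' = rep0_properties[OF J_in_Irr[OF J(2)]]
    have rJ: "rep0 \<chi> \<in> J"
      using r(3,4) J(1) by metis
    have "b m \<psi> < b m (rep0 \<chi>)"
    proof (rule ccontr)
      assume not: "\<not> b m \<psi> < b m (rep0 \<chi>)"
      then have \<chi>S: "\<chi> \<notin> S"
        using r(3) less by auto
      then have rp: "rep0 \<chi> = spred \<chi>"
        using nh by (simp add: rep0_def)
      note p = spred_properties[OF J_in_Irr[OF J(1)] \<chi>S]
      have \<psi>neq: "b m \<psi> = b m (spred \<chi>) \<Longrightarrow> \<psi> = spred \<chi>"
        using J_eqI[OF J(2) p(2)] p(4) by simp
      show False
      proof (cases "\<psi> \<in> S")
        case True
        then have "b m \<psi> \<le> b m (spred \<chi>)"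
          using p(6) J less by blast
        then have "\<psi> = spred \<chi>"
          using \<psi>neq not rp by simp
        then show False
          using r'(3)[OF True] rp neq by simp
      next
        case False
        then have rp': "rep0 \<psi> = spred \<psi>"
          using nh by (simp add: rep0_def)
        note p' = spred_properties[OF J_in_Irr[OF J(2)] False]
        have "b m (spred \<chi>) < b m \<psi>"
          using \<psi>neq not rp False p(1) by (metis le_neq_implies_less not_le)
        then have "b m (spred \<chi>) \<le> b m (spred \<psi>)"
          using p'(6) p(1,2) by blast
        moreover have "b m (spred \<psi>) \<le> b m (spred \<chi>)"
          using p(6)[OF p'(1,2)] p'(3) less by simp
        ultimately have "spred \<chi> = spred \<psi>"
          using J_eqI[OF p(2) p'(2)] p(4) by simp
        then show False
          using rp rp' neq by simp
      qed
    qed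
    then obtain y where y: "y \<in> N \<psi>" "b m y \<le> b m (rep0 \<chi>)"
      using N_nonempty r(1) rJ by blast
    then have "b m y \<le> b m \<chi>"
      using r(8) by simp
    then show "cov (ind \<chi>) (eta0 \<psi>) = 0"
    proof (rule cov_ind_eta0_zero[OF J y(1)])
      show "\<chi> \<in> S \<or> 2 * b m y < m"
        using r(6) y(2) by (metis le_less_trans mult_le_mono2)
    qed
  qed
  show ?thesis
    using main[of \<chi> \<psi>] main[of \<psi> \<chi>] assms cov_sym by (metis nat_le_linear)
qed

text \<open>If a high character exists, then \<open>2 * L < m\<close> and this is the last element
  of the class of \<open>smax\<close>; by the Markov property it screens the high characters from
  the rest of that class.\<close>

definition chi_L :: "complex mat \<Rightarrow> complex" where
  "chi_L = (SOME \<chi>. \<chi> \<in> J \<and> b m \<chi> = L)"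

lemma smax_le_L: "b m smax \<le> L"
  by (simp add: L_def)

lemma chi_L_properties:
  assumes "high \<chi>"
  shows "chi_L \<in> J" "b m chi_L = L" "2 * L < m" "rep0 chi_L = smax" "\<not> high chi_L"
proof -
  show L: "2 * L < m"
    using assms b_J[of \<chi>] by (auto simp: high_def)
  then have "\<exists>\<chi>. \<chi> \<in> J \<and> b m \<chi> = L"
    using J_exists by blast
  from someI_ex[OF this, folded chi_L_def] have "chi_L \<in> J \<and> b m chi_L = L" .
  then show J: "chi_L \<in> J" and b: "b m chi_L = L"
    by auto
  show nh: "\<not> high chi_L"
    by (simp add: high_def b)
  show "rep0 chi_L = smax"
  proof (cases "chi_L \<in> S")
    case True
    then have "b m chi_L = b m smax"
      using smax_properties(5) J L b smax_le_L by (metis le_antisym)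
    then have "chi_L = smax"
      using J_eqI[OF J smax_properties(2)] L b by simp
    then show ?thesis
      using True by (simp add: rep0_def)
  next
    case False
    note p = spred_properties[OF J_in_Irr[OF J] False]
    have "b m smax \<noteq> L"
      using J_eqI[OF J smax_properties(2)] b L False smax_properties(1) by auto
    then have "b m smax \<le> b m (spred chi_L)"
      using p(6) smax_properties(1,2) smax_le_L b by simp
    moreover have "b m (spred chi_L) \<le> b m smax"
      using smax_properties(5) p by blast
    ultimately have "b m (spred chi_L) = b m smax"
      by (rule le_antisym[rotated])
    then have "spred chi_L = smax"
      using J_eqI[OF p(2) smax_properties(2) _ p(4)] by blast
    then show ?thesis
      using nh False by (simp add: rep0_def)
  qed
qed

lemma exceptionalE:
  assumes exceptional
  obtains \<rho> \<rho>' where "\<rho> \<in> J" "\<rho> \<in> S" "2 * b m \<rho> = m" "\<rho>' \<in> J" "\<rho>' \<notin> S" "2 * b m \<rho>' = m"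
    "\<And>\<psi>. \<psi> \<in> J \<Longrightarrow> 2 * b m \<psi> = m \<Longrightarrow> \<psi> = \<rho> \<or> \<psi> = \<rho>'"
proof -
  obtain \<rho> \<rho>' where \<rho>: "\<rho> \<in> J" "\<rho> \<in> S" "2 * b m \<rho> = m" and \<rho>': "\<rho>' \<in> J" "\<rho>' \<notin> S" "2 * b m \<rho>' = m"
    using assms by (auto simp: exceptional_def)
  then have "\<rho> \<noteq> \<rho>'"
    by auto
  then have halves: "\<psi> = \<rho> \<or> \<psi> = \<rho>'" if "\<psi> \<in> J" "2 * b m \<psi> = m" for \<psi>
    using J_half_partner[OF \<rho>(1,3)] \<rho>' that by metis
  show ?thesis
    by (rule that[OF \<rho> \<rho>']) (rule halves)
qed

text \<open>From \<open>smax\<close> on, up to level \<open>m / 2\<close>, the only successor is the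
  character \<open>\<rho>\<close> of level \<open>m / 2\<close> in \<open>S\<close>. Regression on
  it removes the summand 1 from \<open>1 + q ^ (m - 2 * b m y)\<close>; at level
  \<open>m / 2\<close> the other character is uncorrelated with \<open>\<rho>\<close> and keeps its
  variance 1.\<close>

lemma cov_upper:
  assumes exceptional and xy: "x \<in> J" "y \<in> J" "b m x \<le> b m y" "b m smax \<le> b m x"
    and half: "2 * b m x = m \<Longrightarrow> x \<notin> S" "2 * b m y = m \<Longrightarrow> y \<notin> S"
  shows "cov (eta0 y) (eta0 x) = q ^ (m - 2 * b m y)"
proof -
  obtain \<rho> \<rho>' where \<rho>: "\<rho> \<in> J" "\<rho> \<in> S" "2 * b m \<rho> = m" and \<rho>': "\<rho>' \<in> J" "\<rho>' \<notin> S" "2 * b m \<rho>' = m"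
    and halves: "\<And>\<psi>. \<psi> \<in> J \<Longrightarrow> 2 * b m \<psi> = m \<Longrightarrow> \<psi> = \<rho> \<or> \<psi> = \<rho>'"
    using exceptionalE[OF assms(1)] by metis
  have same: "b m x = b m y \<Longrightarrow> x = y"
    using J_eqI[OF xy(1,2)] halves xy(1,2) half \<rho>(2) b_J[OF xy(1)] by (metis le_neq_implies_less)
  then have K: "tree_kernel m y x = kappa m y"
    using xy(3) by (auto simp: tree_kernel_def)
  show ?thesis
  proof (cases "2 * b m x = m")
    case True
    then have "2 * b m y = m"
      using xy(3) b_J[OF xy(2)] by linarith
    then show ?thesis
      using True by (simp add: cov_eta0_eta0 cov_ind_eta0 xy K N_half kappa_def)
  next
    case False
    then have x2: "2 * b m x < m"
      using b_J[OF xy(1)] by simp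
    have uniq: "\<psi> = \<rho>" if \<psi>: "\<psi> \<in> S" "\<psi> \<in> J" "b m x < b m \<psi>" for \<psi>
    proof -
      have "\<not> 2 * b m \<psi> < m"
        using smax_properties(5)[OF \<psi>(1,2)] xy(4) \<psi>(3) by linarith
      then show ?thesis
        using halves[OF \<psi>(2)] b_J[OF \<psi>(2)] \<psi>(1) \<rho>'(2) by auto
    qed
    have N: "N x = {\<rho>}"
    proof (intro equalityI subsetI)
      fix z
      assume "z \<in> N x"
      then have "z \<in> S" "z \<in> J" "b m x < b m z"
        by (auto simp: N_def)
      then show "z \<in> {\<rho>}"
        using uniq by blast
    next
      fix z
      assume z: "z \<in> {\<rho>}"
      have "\<forall>\<phi>\<in>S \<inter> J. b m x < b m \<phi> \<longrightarrow> b m \<rho> \<le> b m \<phi>"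
        using uniq by (metis IntE order_refl)
      moreover have "b m x < b m \<rho>"
        using x2 \<rho>(3) by linarith
      ultimately show "z \<in> N x"
        using z \<rho> by (simp add: N_def)
    qed
    have "tree_kernel m y \<rho> = (if 2 * b m y = m then 0 else 1)"
      using \<rho> half(2) b_J[OF xy(2)] by (auto simp: tree_kernel_def kappa_def)
    then show ?thesis
      by (simp add: cov_eta0_eta0 cov_ind_eta0 xy K N kappa_def)
  qed
qed

lemma cov_upper_lower:
  assumes "\<psi> \<in> J" "x \<in> J" "b m \<psi> < b m smax" "b m smax \<le> b m x"
  shows "cov (eta0 x) (eta0 \<psi>) = 0"
proof -
  obtain y where y: "y \<in> N \<psi>" "b m y \<le> b m smax"
    using N_nonempty[OF smax_properties(1,2) assms(3)] by blast
  then show ?thesis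
    using assms smax_properties(3) by (simp add: cov_eta0_eta0 cov_ind_eta0_zero[OF assms(2,1) y(1)])
qed

lemma cov_upper_half:
  assumes exceptional "\<psi> \<in> J" "\<psi> \<in> S" "2 * b m \<psi> = m" "x \<in> J" "2 * b m x = m \<Longrightarrow> x \<notin> S"
  shows "cov (eta0 x) (eta0 \<psi>) = 0"
proof -
  have le: "b m x \<le> b m \<psi>"
    using assms(4) b_J[OF assms(5)] by linarith
  have "cov (eta0 \<psi>) (eta0 x) = 0"
  proof (cases "2 * b m x = m")
    case True
    then have "b m x = b m \<psi>" "x \<noteq> \<psi>"
      using assms by auto
    then show ?thesis
      using True assms le by (auto simp: cov_eta0_eta0 cov_ind_eta0 N_half tree_kernel_def)
  next
    case False
    then have "b m x < b m \<psi>"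
      using assms(4) b_J[OF assms(5)] by linarith
    then obtain y where "y \<in> N x" "b m y \<le> b m \<psi>"
      using N_nonempty assms(2,3) by blast
    then show ?thesis
      using assms le cov_ind_eta0_zero by (simp add: cov_eta0_eta0)
  qed
  then show ?thesis
    by (simp add: cov_sym)
qed

text \<open>The covariance of the residuals of \<open>\<chi>\<close> and \<open>chi_L\<close>
  divided by the variance of the latter, that is, \<open>q ^ (m - 2 * b m \<chi>)\<close> over
  \<open>q ^ (m - 2 * L)\<close>.\<close>

definition cc :: "(complex mat \<Rightarrow> complex) \<Rightarrow> complex poly fract" where
  "cc \<chi> = (if high \<chi> then q ^ (2 * L) / q ^ (2 * b m \<chi>) else 0)"

definition eta :: "(complex mat \<Rightarrow> complex) \<Rightarrow> (complex mat \<Rightarrow> complex) \<Rightarrow> complex poly fract" where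
  "eta \<chi> = (\<lambda>x. eta0 \<chi> x - cc \<chi> * eta0 chi_L x)"

lemma cov_eta:
  "cov (eta \<chi>) (eta \<psi>) = cov (eta0 \<chi>) (eta0 \<psi>) - cc \<psi> * cov (eta0 \<chi>) (eta0 chi_L)
    - cc \<chi> * (cov (eta0 chi_L) (eta0 \<psi>) - cc \<psi> * cov (eta0 chi_L) (eta0 chi_L))"
  by (simp add: eta_def cov_diff cov_scale right_diff_distrib)

lemma eta_not_high: "\<not> high \<chi> \<Longrightarrow> eta \<chi> = eta0 \<chi>"
  by (simp add: eta_def cc_def)

lemma highD:
  assumes "high \<chi>"
  shows exceptional "\<chi> \<in> J" "\<chi> \<notin> S" "L < b m \<chi>" "b m smax \<le> b m \<chi>"
    "cc \<chi> * q ^ (m - 2 * L) = q ^ (m - 2 * b m \<chi>)"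
proof -
  show "exceptional" and J: "\<chi> \<in> J" and "\<chi> \<notin> S" and "L < b m \<chi>"
    using assms by (auto simp: high_def)
  then show "b m smax \<le> b m \<chi>"
    using smax_le_L by simp
  have "q ^ (2 * L) * q ^ (m - 2 * L) = q ^ (m - 2 * b m \<chi>) * q ^ (2 * b m \<chi>)"
    using chi_L_properties(3)[OF assms] b_J[OF J] by (simp flip: power_add)
  then show "cc \<chi> * q ^ (m - 2 * L) = q ^ (m - 2 * b m \<chi>)"
    using assms by (simp add: cc_def divide_eq_eq)
qed

text \<open>If \<open>\<psi>\<close> lies before \<open>smax\<close>, or is the character of level
  \<open>m / 2\<close> in \<open>S\<close>, both covariances vanish. Otherwise its level is between
  those of \<open>smax\<close> and \<open>chi_L\<close>, and the choice of \<open>cc\<close> makes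
  the two terms cancel.\<close>

lemma cov_eta_high_not_high:
  assumes \<chi>: "high \<chi>" and \<psi>: "\<psi> \<in> J" "\<not> high \<psi>"
  shows "cov (eta \<chi>) (eta \<psi>) = 0"
proof -
  note h = highD[OF \<chi>] and c = chi_L_properties[OF \<chi>]
  have eq: "cov (eta \<chi>) (eta \<psi>) = cov (eta0 \<chi>) (eta0 \<psi>) - cc \<chi> * cov (eta0 chi_L) (eta0 \<psi>)"
    using \<psi>(2) by (simp add: cov_eta cc_def[of \<psi>])
  have cL: "b m smax \<le> b m chi_L" "2 * b m chi_L \<noteq> m"
    using smax_le_L c by auto
  consider "b m \<psi> < b m smax" | "b m smax \<le> b m \<psi>" "2 * b m \<psi> = m" "\<psi> \<in> S"
    | "b m smax \<le> b m \<psi>" "2 * b m \<psi> = m \<Longrightarrow> \<psi> \<notin> S"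
    by force
  then show ?thesis
  proof cases
    case 1
    then show ?thesis
      using cov_upper_lower[OF \<psi>(1) h(2) 1 h(5)] cov_upper_lower[OF \<psi>(1) c(1) 1 cL(1)] by (simp add: eq)
  next
    case 2
    then show ?thesis
      using cov_upper_half[OF h(1) \<psi>(1) 2(3,2) h(2)] cov_upper_half[OF h(1) \<psi>(1) 2(3,2) c(1)] h(3) cL(2)
      by (simp add: eq)
  next
    case 3
    have "b m \<psi> \<le> L"
    proof (cases "\<psi> \<in> S")
      case True
      then have "2 * b m \<psi> < m"
        using 3 b_J[OF \<psi>(1)] by (metis le_neq_implies_less)
      then show ?thesis
        using smax_properties(5)[OF True \<psi>(1)] smax_le_L by simp
    next
      case False
      then show ?thesis
        using \<psi> h(1) by (auto simp: high_def)
    qed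
    then have "cov (eta0 \<chi>) (eta0 \<psi>) = q ^ (m - 2 * b m \<chi>)" "cov (eta0 chi_L) (eta0 \<psi>) = q ^ (m - 2 * L)"
      using cov_upper[OF h(1) \<psi>(1) h(2) _ 3(1) 3(2)] cov_upper[OF h(1) \<psi>(1) c(1) _ 3(1) 3(2)] h c cL by auto
    then show ?thesis
      using h(6) by (simp add: eq)
  qed
qed

lemma cov_eta_orthogonal:
  assumes "\<chi> \<in> J" "\<psi> \<in> J" "rep0 \<chi> \<noteq> rep0 \<psi>"
  shows "cov (eta \<chi>) (eta \<psi>) = 0"
proof (cases "high \<chi> \<longleftrightarrow> high \<psi>")
  case True
  show ?thesis
  proof (cases "high \<chi>")
    case True
    then have "rep0 \<chi> = rep0 \<psi>"
      using \<open>high \<chi> \<longleftrightarrow> high \<psi>\<close> by (simp add: rep0_def high_def)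
    then show ?thesis
      using assms by simp
  next
    case False
    then show ?thesis
      using \<open>high \<chi> \<longleftrightarrow> high \<psi>\<close> assms by (simp add: eta_not_high cov_eta0_orthogonal)
  qed
next
  case False
  then show ?thesis
    using cov_eta_high_not_high[of \<chi> \<psi>] cov_eta_high_not_high[of \<psi> \<chi>] assms cov_sym by metis
qed

text \<open>The conditional covariance given \<open>chi_L\<close>. An explicit value is needed
  because \<open>cc\<close> contains negative powers of \<open>q\<close>, so that these entries are
  not visibly polynomial.\<close>

lemma cov_eta_high_high:
  assumes \<chi>: "high \<chi>" and \<psi>: "high \<psi>" and le: "b m \<psi> \<le> b m \<chi>"
  shows "cov (eta \<chi>) (eta \<psi>) = q ^ (m - 2 * b m \<chi>) - cc \<chi> * q ^ (m - 2 * b m \<psi>)"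
proof -
  note h = highD[OF \<chi>] and h' = highD[OF \<psi>] and c = chi_L_properties[OF \<chi>]
  have cL: "b m smax \<le> b m chi_L" "2 * b m chi_L \<noteq> m"
    using smax_le_L c by auto
  have "cov (eta0 \<chi>) (eta0 \<psi>) = q ^ (m - 2 * b m \<chi>)"
    using cov_upper[OF h(1) h'(2) h(2) le h'(5)] h h' by blast
  moreover have "cov (eta0 \<chi>) (eta0 chi_L) = q ^ (m - 2 * b m \<chi>)" 
    using cov_upper[OF h(1) c(1) h(2) _ cL(1)] h c(2) cL(2) by simp
  moreover have "cov (eta0 chi_L) (eta0 \<psi>) = q ^ (m - 2 * b m \<psi>)" 
    using cov_upper[OF h(1) c(1) h'(2) _ cL(1)] h' c(2) cL(2) cov_sym by simp
  moreover have "cov (eta0 chi_L) (eta0 chi_L) = q ^ (m - 2 * L)" 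
    using cov_upper[OF h(1) c(1) c(1) _ cL(1)] c(2) cL(2) by simp
  ultimately have "cov (eta \<chi>) (eta \<psi>) = q ^ (m - 2 * b m \<chi>) - cc \<psi> * q ^ (m - 2 * b m \<chi>)
      - cc \<chi> * (q ^ (m - 2 * b m \<psi>) - cc \<psi> * q ^ (m - 2 * L))"
    by (simp add: cov_eta)
  also have "cc \<psi> * q ^ (m - 2 * L) = q ^ (m - 2 * b m \<psi>)"
    by (rule h'(6))
  also have "cc \<psi> * q ^ (m - 2 * b m \<chi>) = cc \<chi> * q ^ (m - 2 * b m \<psi>)"
    unfolding h(6)[symmetric] h'(6)[symmetric] by (simp add: mult_ac)
  finally show ?thesis
    by simp
qed

text \<open>The Green functions stripped of their powers of \<open>q\<close>: row
  \<open>\<chi>\<close> expands the variable of \<open>\<chi>\<close> in the residuals. The entries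
  1 come from telescoping, \<open>cc\<close> from the regression on \<open>chi_L\<close>.\<close>

definition pmat :: "(complex mat \<Rightarrow> complex) \<Rightarrow> (complex mat \<Rightarrow> complex) \<Rightarrow> complex poly fract" where
  "pmat \<chi> \<psi> = ind \<chi> \<psi> + (if \<psi> \<in> S \<and> b m \<chi> < b m \<psi> then 1 else 0) + cc \<chi> * ind chi_L \<psi>"

lemma pmat_eta:
  assumes \<chi>: "\<chi> \<in> J"
  shows "(\<Sum>\<psi>\<in>J. pmat \<chi> \<psi> * eta \<psi> x) = ind \<chi> x"
proof -
  have ind: "(\<Sum>\<psi>\<in>J. ind \<phi> \<psi> * eta \<psi> x) = eta \<phi> x" if "\<phi> \<in> J" for \<phi>
  proof -
    have "(\<Sum>\<psi>\<in>J. ind \<phi> \<psi> * eta \<psi> x) = (\<Sum>\<psi>\<in>J. if \<psi> = \<phi> then eta \<psi> x else 0)"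
      by (intro sum.cong refl) (simp add: ind_def)
    then show ?thesis
      using that Irr_insert(3) by simp
  qed
  have 1: "(\<Sum>\<psi>\<in>J. (if \<psi> \<in> S \<and> b m \<chi> < b m \<psi> then 1 else 0) * eta \<psi> x) = (\<Sum>y\<in>N \<chi>. ind y x)"
  proof -
    have "(\<Sum>\<psi>\<in>J. (if \<psi> \<in> S \<and> b m \<chi> < b m \<psi> then 1 else 0) * eta \<psi> x)
        = (\<Sum>\<psi>\<in>J. if \<psi> \<in> S \<and> b m \<chi> < b m \<psi> then eta0 \<psi> x else 0)"
      by (intro sum.cong refl) (auto simp: eta_not_high high_def)
    also have "\<dots> = (\<Sum>\<psi>\<in>{\<psi> \<in> J. \<psi> \<in> S \<and> b m \<chi> < b m \<psi>}. eta0 \<psi> x)"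
      using Irr_insert(3) by (simp add: sum.inter_filter)
    also have "{\<psi> \<in> J. \<psi> \<in> S \<and> b m \<chi> < b m \<psi>} = {\<psi> \<in> S \<inter> J. b m \<chi> < b m \<psi>}"
      by auto
    finally show ?thesis
      by (simp only: sum_eta0_above)
  qed
  have 2: "(\<Sum>\<psi>\<in>J. cc \<chi> * ind chi_L \<psi> * eta \<psi> x) = cc \<chi> * eta0 chi_L x"
  proof (cases "high \<chi>")
    case True
    then show ?thesis
      using ind[OF chi_L_properties(1)[OF True]] chi_L_properties(5)[OF True]
      by (simp add: mult.assoc eta_not_high flip: sum_distrib_left)
  qed (simp add: cc_def)
  have "(\<Sum>\<psi>\<in>J. pmat \<chi> \<psi> * eta \<psi> x) = eta \<chi> x + (\<Sum>y\<in>N \<chi>. ind y x) + cc \<chi> * eta0 chi_L x"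
    by (simp only: pmat_def distrib_right sum.distrib ind[OF \<chi>] 1 2)
  then show ?thesis
    by (simp add: eta_def eta0_def[of \<chi>])
qed

text \<open>Bilinear expansion of the kernel in the residuals; their Gram matrix is block diagonal
  by \<open>cov_eta_orthogonal\<close>, so this is the required factorisation up to
  normalisation.\<close>

lemma pmat_cov_pmat:
  assumes "\<chi> \<in> J" "\<chi>' \<in> J"
  shows "(\<Sum>\<psi>\<in>J. \<Sum>\<psi>'\<in>J. pmat \<chi> \<psi> * cov (eta \<psi>) (eta \<psi>') * pmat \<chi>' \<psi>') = tree_kernel m \<chi> \<chi>'"
proof -
  have "tree_kernel m \<chi> \<chi>' = cov (\<lambda>x. \<Sum>\<psi>\<in>J. pmat \<chi> \<psi> * eta \<psi> x) (\<lambda>x. \<Sum>\<psi>\<in>J. pmat \<chi>' \<psi> * eta \<psi> x)"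
    using assms by (simp add: pmat_eta cov_ind[symmetric])
  also have "\<dots> = (\<Sum>\<psi>\<in>J. \<Sum>\<psi>'\<in>J. pmat \<chi> \<psi> * (pmat \<chi>' \<psi>' * cov (eta \<psi>) (eta \<psi>')))"
    by (simp only: cov_sum cov_scale sum_distrib_left)
  finally show ?thesis
    by (simp add: mult_ac)
qed

end

section \<open>Closure properties of the coefficient sets\<close>

lemma nonneg_poly_closed:
  "x \<in> nonneg_integer_coeff_polys \<Longrightarrow> y \<in> nonneg_integer_coeff_polys \<Longrightarrow> x + y \<in> nonneg_integer_coeff_polys"
  "q ^ n \<in> nonneg_integer_coeff_polys" "0 \<in> nonneg_integer_coeff_polys" "1 \<in> nonneg_integer_coeff_polys"
proof -
  show 0: "q ^ n \<in> nonneg_integer_coeff_polys" for n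
    unfolding nonneg_integer_coeff_polys_def q_power
    by (intro range_eqI[of _ _ "monom 1 n"]) (simp add: map_poly_monom)
  show "1 \<in> nonneg_integer_coeff_polys"
    using 0[of 0] by simp
  show "0 \<in> nonneg_integer_coeff_polys"
    unfolding nonneg_integer_coeff_polys_def by (intro range_eqI[of _ _ 0]) simp
  assume "x \<in> nonneg_integer_coeff_polys" "y \<in> nonneg_integer_coeff_polys"
  then obtain f g :: "nat poly" where "x = to_fract (map_poly of_nat f)" "y = to_fract (map_poly of_nat g)"
    by (auto simp: nonneg_integer_coeff_polys_def)
  moreover have "map_poly of_nat (f + g) = map_poly of_nat f + (map_poly of_nat g :: complex poly)"
    by (intro poly_eqI) (simp add: coeff_map_poly)
  ultimately show "x + y \<in> nonneg_integer_coeff_polys"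
    unfolding nonneg_integer_coeff_polys_def by (intro range_eqI[of _ _ "f + g"]) simp
qed

lemma integer_poly_closed:
  "x \<in> integer_coeff_polys \<Longrightarrow> y \<in> integer_coeff_polys \<Longrightarrow> x + y \<in> integer_coeff_polys"
  "x \<in> integer_coeff_polys \<Longrightarrow> y \<in> integer_coeff_polys \<Longrightarrow> x - y \<in> integer_coeff_polys"
  "x \<in> integer_coeff_polys \<Longrightarrow> y \<in> integer_coeff_polys \<Longrightarrow> x * y \<in> integer_coeff_polys"
  "q ^ n \<in> integer_coeff_polys" "0 \<in> integer_coeff_polys" "1 \<in> integer_coeff_polys"
proof -
  interpret of_int_poly_hom: map_poly_comm_ring_hom "of_int :: int \<Rightarrow> complex" ..
  have I: "to_fract (map_poly of_int f) \<in> integer_coeff_polys" for f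
    by (auto simp: integer_coeff_polys_def)
  show 0: "q ^ n \<in> integer_coeff_polys" for n
    unfolding q_power using I[of "monom 1 n"] by (simp add: map_poly_monom)
  show "1 \<in> integer_coeff_polys"
    using 0[of 0] by simp
  show "0 \<in> integer_coeff_polys"
    using I[of 0] by simp
  assume "x \<in> integer_coeff_polys" "y \<in> integer_coeff_polys"
  then obtain f g :: "int poly" where fg: "x = to_fract (map_poly of_int f)" "y = to_fract (map_poly of_int g)"
    by (auto simp: integer_coeff_polys_def)
  show "x + y \<in> integer_coeff_polys" "x - y \<in> integer_coeff_polys" "x * y \<in> integer_coeff_polys"
    using I[of "f + g"] I[of "f - g"] I[of "f * g"]
    by (simp_all add: fg of_int_poly_hom.hom_add of_int_poly_hom.hom_minus of_int_poly_hom.hom_mult)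
qed

lemma integer_poly_sum: "(\<And>x. x \<in> B \<Longrightarrow> f x \<in> integer_coeff_polys) \<Longrightarrow> sum f B \<in> integer_coeff_polys"
  by (induction B rule: infinite_finite_induct) (auto intro: integer_poly_closed)

lemma integer_poly_rational: "x \<in> integer_coeff_polys \<Longrightarrow> x \<in> rational_coeff_functions"
proof -
  assume "x \<in> integer_coeff_polys"
  then obtain f :: "int poly" where f: "x = to_fract (map_poly of_int f)"
    by (auto simp: integer_coeff_polys_def)
  have "map_poly of_rat (map_poly of_int f :: rat poly) = (map_poly of_int f :: complex poly)"
    by (intro poly_eqI) (simp add: coeff_map_poly)
  then have "x = to_fract (map_poly of_rat (map_poly of_int f :: rat poly)) / to_fract (map_poly of_rat 1)"
    by (simp add: f)
  then show ?thesis
    unfolding rational_coeff_functions_def by (metis (mono_tags, lifting) mem_Collect_eq one_neq_zero)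
qed

lemma nonneg_poly_integer: "x \<in> nonneg_integer_coeff_polys \<Longrightarrow> x \<in> integer_coeff_polys"
proof -
  assume "x \<in> nonneg_integer_coeff_polys"
  then obtain f :: "nat poly" where f: "x = to_fract (map_poly of_nat f)"
    by (auto simp: nonneg_integer_coeff_polys_def)
  have "map_poly of_int (map_poly of_nat f :: int poly) = (map_poly of_nat f :: complex poly)"
    by (intro poly_eqI) (simp add: coeff_map_poly)
  then show ?thesis
    unfolding integer_coeff_polys_def f by (metis range_eqI)
qed

lemma (in dihedral) R_Irr:
  assumes "\<chi> \<in> Irr m"
  shows "R m \<chi> \<in> nonneg_integer_coeff_polys" and "k \<le> b m \<chi> \<Longrightarrow> divisible_by_q_power k (R m \<chi>)"
proof -
  have "R m \<chi> \<in> nonneg_integer_coeff_polys \<and> (\<exists>f. R m \<chi> = q ^ b m \<chi> * to_fract f)"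
  proof (cases "\<chi> = sign_char m")
    case True
    then show ?thesis
      using R_sign b_sign nonneg_poly_closed by (auto intro!: exI[of _ 1])
  next
    case False
    with m_pos assms show ?thesis
    proof (cases rule: Irr_cases)
      case 1
      then show ?thesis
        using R_trivial_char[OF m_pos] nonneg_poly_closed by (auto intro!: exI[of _ 1])
    next
      case (2 i)
      have "m - i = i + (m - 2 * i)"
        using 2 by simp
      then have "q ^ (m - i) = q ^ i * q ^ (m - 2 * i)"
        by (metis power_add)
      then have "R m \<chi> = q ^ b m \<chi> * to_fract (1 + monom 1 (m - 2 * i))"
        using 2 m_pos by (simp add: R_rot_char distrib_left flip: q_power)
      moreover have "R m \<chi> \<in> nonneg_integer_coeff_polys"
        using 2 m_pos by (simp add: R_rot_char nonneg_poly_closed)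
      ultimately show ?thesis
        by blast
    next
      case (3 r s)
      then show ?thesis
        using R_half_char[of r s] nonneg_poly_closed by (auto intro!: exI[of _ 1])
    qed
  qed
  then obtain f where f: "R m \<chi> \<in> nonneg_integer_coeff_polys" "R m \<chi> = q ^ b m \<chi> * to_fract f"
    by blast
  then show "R m \<chi> \<in> nonneg_integer_coeff_polys"
    by blast
  assume "k \<le> b m \<chi>"
  then have "q ^ b m \<chi> = q ^ k * q ^ (b m \<chi> - k)"
    by (simp flip: power_add)
  then have "R m \<chi> = q ^ k * to_fract (monom 1 (b m \<chi> - k) * f)"
    using f(2) by (simp add: q_power mult.assoc)
  then show "divisible_by_q_power k (R m \<chi>)"
    unfolding divisible_by_q_power_def by blast
qed

section \<open>The candidate datum and its Green functions\<close>

context springer_reps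
begin

text \<open>For odd \<open>m\<close> no such character exists and \<open>mark\<close> is
  unspecified; \<open>height\<close> still refines the order by b-values, since it only adds 1 to a
  doubled b-value.\<close>

definition mark :: "complex mat \<Rightarrow> complex" where
  "mark = (SOME h. h \<in> J \<and> 2 * b m h = m)"

text \<open>The second summand breaks the tie between the two characters with \<open>b\<close>-value \<open>m / 2\<close>.\<close>

definition height :: "(complex mat \<Rightarrow> complex) \<Rightarrow> nat" where
  "height \<chi> = 2 * b m \<chi> + (if \<chi> = mark then 1 else 0)"

lemma height_inj:
  assumes "\<chi> \<in> Irr m" "\<psi> \<in> Irr m" "height \<chi> = height \<psi>"
  shows "\<chi> = \<psi>"
proof -
  have eq: "b m \<chi> = b m \<psi>" "\<chi> = mark \<longleftrightarrow> \<psi> = mark"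
    using assms(3) by (auto simp: height_def split: if_splits) presburger+
  have not_sign: "b m \<phi> < m" if "\<phi> \<in> J" for \<phi>
    using b_J[OF that] m_pos by linarith
  have eq_sign: "\<phi> = sign_char m" if "\<phi> \<in> Irr m" "b m \<phi> = m" for \<phi>
    using not_sign[of \<phi>] that by (auto simp: J_def)
  show ?thesis
  proof (cases "\<chi> \<in> J \<and> \<psi> \<in> J")
    case False
    then show ?thesis
      using assms(1,2) eq(1) eq_sign b_sign by (metis DiffI J_def singletonD)
  next
    case True
    show ?thesis
    proof (cases "2 * b m \<chi> < m")
      case True
      then show ?thesis
        using J_eqI \<open>\<chi> \<in> J \<and> \<psi> \<in> J\<close> eq(1) by blast
    next
      case False
      then have 2: "2 * b m \<chi> = m" "2 * b m \<psi> = m"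
        using b_J True eq(1) by (metis le_neq_implies_less)+
      then have "\<exists>h. h \<in> J \<and> 2 * b m h = m"
        using True by blast
      from someI_ex[OF this, folded mark_def] have mk: "mark \<in> J" "2 * b m mark = m"
        by auto
      show ?thesis
        using J_half_partner[OF mk] True 2 eq(2) by metis
    qed
  qed
qed

lemma height_mono: "height \<chi> < height \<psi> \<Longrightarrow> b m \<chi> \<le> b m \<psi>" "b m \<chi> < b m \<psi> \<Longrightarrow> height \<chi> < height \<psi>"
  by (auto simp: height_def split: if_splits)

definition cl :: "(complex mat \<Rightarrow> complex) \<Rightarrow> (complex mat \<Rightarrow> complex) set" where
  "cl s = {\<psi> \<in> Irr m. rep0 \<psi> = s}"

definition X0 :: "(complex mat \<Rightarrow> complex) set set" where
  "X0 = cl ` S"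

text \<open>A larger \<open>height\<close> means a lower class, as \<open>a\<close> must reverse the
  order.\<close>

definition lt0 :: "(complex mat \<Rightarrow> complex) set rel" where
  "lt0 = {(cl s, cl t) | s t. s \<in> S \<and> t \<in> S \<and> height t < height s}"

definition a0 :: "(complex mat \<Rightarrow> complex) set \<Rightarrow> nat" where
  "a0 C = Min (b m ` C)"

lemma S_in_Irr: "s \<in> S \<Longrightarrow> s \<in> Irr m"
  using S_Irr by blast

lemma mem_cl: "s \<in> S \<Longrightarrow> s \<in> cl s"
  using S_in_Irr rep0_properties(3) by (simp add: cl_def)

lemma cl_inj: "s \<in> S \<Longrightarrow> t \<in> S \<Longrightarrow> cl s = cl t \<longleftrightarrow> s = t"
  using mem_cl[of s] by (auto simp: cl_def dest: rep0_properties(3)[OF S_in_Irr])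

lemma cl_lt: "s \<in> S \<Longrightarrow> t \<in> S \<Longrightarrow> (cl s, cl t) \<in> lt0 \<longleftrightarrow> height t < height s"
proof -
  assume st: "s \<in> S" "t \<in> S"
  have "height t < height s" if "(cl s, cl t) \<in> lt0"
  proof -
    obtain s' t' where "cl s = cl s'" "cl t = cl t'" "s' \<in> S" "t' \<in> S" "height t' < height s'"
      using \<open>(cl s, cl t) \<in> lt0\<close> by (auto simp: lt0_def)
    then show ?thesis
      using st by (simp add: cl_inj)
  qed
  then show ?thesis
    using st by (auto simp: lt0_def)
qed

lemma partition_X0: "partition_on (Irr m) X0"
  unfolding partition_on_def
proof (intro conjI)
  show "\<Union> X0 = Irr m"
    using rep0_properties(1) by (auto simp: X0_def cl_def)
  show "disjoint X0"
    by (auto simp: X0_def cl_def disjoint_def)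
  show "{} \<notin> X0"
    using mem_cl by (auto simp: X0_def)
qed

lemma supp_X0: "\<chi> \<in> Irr m \<Longrightarrow> supp X0 \<chi> = cl (rep0 \<chi>)"
  using supp_properties(3)[OF partition_X0, of \<chi> "cl (rep0 \<chi>)"] rep0_properties(1)
  by (simp add: X0_def cl_def)

lemma b_cl:
  assumes "s \<in> S" "\<psi> \<in> cl s"
  shows "b m s \<le> b m \<psi>" and "b m \<psi> = b m s \<Longrightarrow> \<psi> = s"
proof -
  have \<psi>: "\<psi> \<in> Irr m" "rep0 \<psi> = s"
    using assms by (auto simp: cl_def)
  show "b m s \<le> b m \<psi>"
    using rep0_properties(8)[OF \<psi>(1)] \<psi>(2) by simp
  show "\<psi> = s" if eq: "b m \<psi> = b m s"
  proof (cases "\<psi> \<in> S")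
    case True
    then show ?thesis
      using rep0_properties(3)[OF \<psi>(1) True] \<psi>(2) by simp
  next
    case False
    then show ?thesis
      using rep0_properties(5)[OF \<psi>(1) False] \<psi>(2) eq by simp
  qed
qed

lemma Min_cl: "s \<in> S \<Longrightarrow> Min (b m ` cl s) = b m s"
proof -
  assume s: "s \<in> S"
  have "finite (cl s)"
    using finite_Irr by (simp add: cl_def)
  then show ?thesis
    using mem_cl[OF s] b_cl(1)[OF s] by (intro Min_eqI) auto
qed

lemma a0_cl: "s \<in> S \<Longrightarrow> a0 (cl s) = b m s"
  by (simp add: a0_def Min_cl)

lemma springer_rep_cl: "s \<in> S \<Longrightarrow> springer_rep m (cl s) = s"
proof -
  assume s: "s \<in> S"
  show ?thesis
    unfolding springer_rep_def Min_cl[OF s]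
  proof (rule the_equality)
    show "s \<in> cl s \<and> b m s = b m s"
      using mem_cl[OF s] by simp
    show "\<psi> = s" if "\<psi> \<in> cl s \<and> b m \<psi> = b m s" for \<psi>
      using b_cl(2)[OF s] that by blast
  qed
qed

lemma datum_X0: "lusztig_shoji_datum m X0 lt0 a0"
  unfolding lusztig_shoji_datum_def strict_linear_order_on_def
proof (intro conjI allI impI partition_X0)
  show "lt0 \<subseteq> X0 \<times> X0"
    by (auto simp: lt0_def X0_def)
  show "trans lt0"
  proof (rule transI)
    fix C D E
    assume "(C, D) \<in> lt0" "(D, E) \<in> lt0"
    then obtain s t t' u where "C = cl s" "D = cl t" "D = cl t'" "E = cl u" "s \<in> S" "t \<in> S" "t' \<in> S" "u \<in> S"
      "height t < height s" "height u < height t'"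
      by (auto simp: lt0_def)
    then show "(C, E) \<in> lt0"
      using cl_inj cl_lt[of s u] by force
  qed
  show "irrefl lt0"
    using cl_inj by (auto simp: irrefl_def lt0_def)
  show "total_on X0 lt0"
  proof (rule total_onI)
    fix C D
    assume "C \<in> X0" "D \<in> X0" "C \<noteq> D"
    then obtain s t where st: "C = cl s" "D = cl t" "s \<in> S" "t \<in> S" "s \<noteq> t"
      by (auto simp: X0_def)
    then have "height s \<noteq> height t"
      using height_inj S_in_Irr by blast
    then show "(C, D) \<in> lt0 \<or> (D, C) \<in> lt0"
      using st by (auto simp: cl_lt)
  qed
  fix C D
  assume "(C, D) \<in> lt0"
  then show "a0 D \<le> a0 C"
    using height_mono(1) by (auto simp: lt0_def a0_cl)
qed

text \<open>For characters other than the sign this is \<open>pmat\<close> with its powers of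
  \<open>q\<close> restored, see \<open>P0_pmat\<close>; the column of the sign character consists
  of the fake degrees.\<close>

definition P0 :: "(complex mat \<Rightarrow> complex) \<Rightarrow> (complex mat \<Rightarrow> complex) \<Rightarrow> complex poly fract" where
  "P0 \<chi> \<psi> = (if \<psi> = sign_char m then R m \<chi> else if \<chi> = sign_char m then 0
     else if \<chi> = \<psi> then q ^ b m (rep0 \<chi>)
     else if \<psi> \<in> S \<and> b m \<chi> < b m \<psi> then q ^ b m \<chi>
     else if high \<chi> \<and> \<psi> = chi_L then q ^ (b m smax + L - b m \<chi>) else 0)"

text \<open>The Gram matrix of the residuals, rescaled by the inverse of the column factors in
  \<open>P0\<close>. The entry at the sign character is 1 because there \<open>P0\<close> is
  \<open>q ^ m\<close> and \<open>Omega\<close> is the square of it.\<close>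

definition Lambda0 :: "(complex mat \<Rightarrow> complex) \<Rightarrow> (complex mat \<Rightarrow> complex) \<Rightarrow> complex poly fract" where
  "Lambda0 \<chi> \<psi> = (if \<chi> = sign_char m \<and> \<psi> = sign_char m then 1
     else if \<chi> = sign_char m \<or> \<psi> = sign_char m \<or> rep0 \<chi> \<noteq> rep0 \<psi> then 0
     else (q ^ m - 1) * (q ^ b m \<chi> / q ^ b m (rep0 \<chi>)) * (q ^ b m \<psi> / q ^ b m (rep0 \<psi>)) * cov (eta \<chi>) (eta \<psi>))"

text \<open>The second argument of the maximum in \<open>L\<close> is made for this. The exponent in
  \<open>P0\<close> is thus not truncated, and it is at least 1, the weight of the class that
  contains the high characters.\<close>

lemma high_bound:
  assumes "high \<chi>"
  shows "b m \<chi> < b m smax + L"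
proof -
  have "b m \<chi> \<le> m div 2"
    using b_J[OF highD(2)[OF assms]] by linarith
  then show ?thesis
    by (auto simp: L_def)
qed

lemma P0_pmat:
  assumes "\<chi> \<in> J" "\<psi> \<in> J"
  shows "P0 \<chi> \<psi> = q ^ b m \<chi> * pmat \<chi> \<psi> * (q ^ b m (rep0 \<psi>) / q ^ b m \<psi>)"
proof -
  have ns: "\<chi> \<noteq> sign_char m" "\<psi> \<noteq> sign_char m"
    using assms by (auto simp: J_def)
  consider "\<chi> = \<psi>" | "\<chi> \<noteq> \<psi>" "\<psi> \<in> S" "b m \<chi> < b m \<psi>" | "\<chi> \<noteq> \<psi>" "\<not> (\<psi> \<in> S \<and> b m \<chi> < b m \<psi>)"
    by blast
  then show ?thesis
  proof cases
    case 1
    have "high \<chi> \<Longrightarrow> chi_L \<noteq> \<chi>"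
      using chi_L_properties(5) by metis
    then have z: "cc \<chi> * ind chi_L \<psi> = 0"
      using 1 by (auto simp: cc_def ind_def)
    have "pmat \<chi> \<psi> = 1"
      unfolding pmat_def z using 1 by (simp add: ind_def)
    then show ?thesis
      using 1 ns by (simp add: P0_def)
  next
    case 2
    have "high \<chi> \<Longrightarrow> chi_L \<noteq> \<psi>"
      using chi_L_properties(2) highD(4)[of \<chi>] 2 by auto
    then have z: "cc \<chi> * ind chi_L \<psi> = 0"
      by (auto simp: cc_def ind_def)
    have "pmat \<chi> \<psi> = 1"
      unfolding pmat_def z using 2 by (simp add: ind_def)
    then show ?thesis
      using 2 ns rep0_properties(3)[OF J_in_Irr[OF assms(2)]] by (simp add: P0_def)
  next
    case 3
    show ?thesis
    proof (cases "high \<chi> \<and> \<psi> = chi_L")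
      case True
      note c = chi_L_properties[of \<chi>] and h = highD[of \<chi>]
      have "q ^ (b m smax + L - b m \<chi>) * (q ^ (2 * b m \<chi>) * q ^ L) = q ^ b m \<chi> * q ^ (2 * L) * q ^ b m smax"
        using high_bound[of \<chi>] True by (simp flip: power_add) (simp add: add_ac mult_2)
      then have "q ^ (b m smax + L - b m \<chi>) = q ^ b m \<chi> * (q ^ (2 * L) / q ^ (2 * b m \<chi>)) * (q ^ b m smax / q ^ L)"
        by (simp add: eq_divide_eq mult.assoc)
      then have "q ^ (b m smax + L - b m \<chi>) = q ^ b m \<chi> * cc \<chi> * (q ^ b m (rep0 \<psi>) / q ^ b m \<psi>)"
        using True c by (simp add: cc_def)
      moreover have "pmat \<chi> \<psi> = cc \<chi>"
        using True 3(1) unfolding pmat_def if_not_P[OF 3(2)] by (simp add: ind_def)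
      moreover have "P0 \<chi> \<psi> = q ^ (b m smax + L - b m \<chi>)"
        using True 3(1) ns unfolding P0_def if_not_P[OF 3(2)] by simp
      ultimately show ?thesis
        by simp
    next
      case False
      then have z: "cc \<chi> * ind chi_L \<psi> = 0"
        by (auto simp: cc_def ind_def)
      have "pmat \<chi> \<psi> = 0"
        unfolding pmat_def z using 3 by (auto simp: ind_def)
      then show ?thesis
        using False 3 ns by (auto simp: P0_def)
    qed
  qed
qed

text \<open>The sign character contributes the product of fake degrees, the rest contributes the
  tree kernel, and \<open>Omega_kernel\<close> adds the two up.\<close>

lemma P0_Lambda0_P0:
  assumes "\<chi> \<in> Irr m" "\<chi>' \<in> Irr m"
  shows "(\<Sum>\<psi> \<in> Irr m. \<Sum>\<psi>' \<in> Irr m. P0 \<chi> \<psi> * Lambda0 \<psi> \<psi>' * P0 \<chi>' \<psi>') = Omega m \<chi> \<chi>'"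
proof -
  let ?E = "sign_char m"
  have ne: "\<psi> \<noteq> ?E" if "\<psi> \<in> J" for \<psi>
    using that by (auto simp: J_def)
  have split: "(\<Sum>\<psi>\<in>Irr m. f \<psi>) = f ?E + (\<Sum>\<psi>\<in>J. f \<psi>)" for f :: "_ \<Rightarrow> complex poly fract"
    using Irr_insert(2,3) by (simp add: Irr_insert(1))
  have "(\<Sum>\<psi> \<in> Irr m. \<Sum>\<psi>' \<in> Irr m. P0 \<chi> \<psi> * Lambda0 \<psi> \<psi>' * P0 \<chi>' \<psi>')
     = R m \<chi> * R m \<chi>' + (\<Sum>\<psi> \<in> J. \<Sum>\<psi>' \<in> J. P0 \<chi> \<psi> * Lambda0 \<psi> \<psi>' * P0 \<chi>' \<psi>')"
  proof -
    have E1: "(\<Sum>\<psi>' \<in> Irr m. P0 \<chi> ?E * Lambda0 ?E \<psi>' * P0 \<chi>' \<psi>') = R m \<chi> * R m \<chi>'"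
      using ne by (simp add: split Lambda0_def P0_def)
    have E2: "(\<Sum>\<psi>' \<in> Irr m. P0 \<chi> \<psi> * Lambda0 \<psi> \<psi>' * P0 \<chi>' \<psi>') = (\<Sum>\<psi>' \<in> J. P0 \<chi> \<psi> * Lambda0 \<psi> \<psi>' * P0 \<chi>' \<psi>')"
      if "\<psi> \<in> J" for \<psi>
      using ne[OF that] by (simp add: split Lambda0_def)
    have "(\<Sum>\<psi> \<in> Irr m. \<Sum>\<psi>' \<in> Irr m. P0 \<chi> \<psi> * Lambda0 \<psi> \<psi>' * P0 \<chi>' \<psi>')
      = (\<Sum>\<psi>' \<in> Irr m. P0 \<chi> ?E * Lambda0 ?E \<psi>' * P0 \<chi>' \<psi>') +
        (\<Sum>\<psi> \<in> J. \<Sum>\<psi>' \<in> Irr m. P0 \<chi> \<psi> * Lambda0 \<psi> \<psi>' * P0 \<chi>' \<psi>')"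
      by (rule split)
    also have "\<dots> = R m \<chi> * R m \<chi>' + (\<Sum>\<psi> \<in> J. \<Sum>\<psi>' \<in> J. P0 \<chi> \<psi> * Lambda0 \<psi> \<psi>' * P0 \<chi>' \<psi>')"
      unfolding E1 by (intro arg_cong2[of _ _ _ _ "(+)"] refl sum.cong E2)
    finally show ?thesis .
  qed
  also have "\<dots> = Omega m \<chi> \<chi>'"
  proof (cases "\<chi> \<in> J \<and> \<chi>' \<in> J")
    case False
    then have E: "\<chi> = ?E \<or> \<chi>' = ?E"
      using assms by (auto simp: J_def)
    have "P0 \<chi> \<psi> * Lambda0 \<psi> \<psi>' * P0 \<chi>' \<psi>' = 0" if "\<psi> \<in> J" "\<psi>' \<in> J" for \<psi> \<psi>'
    proof -
      have "P0 ?E \<psi> = 0" "P0 ?E \<psi>' = 0"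
        using ne[OF that(1)] ne[OF that(2)] by (simp_all add: P0_def)
      then show ?thesis
        using E by auto
    qed
    then have "(\<Sum>\<psi> \<in> J. \<Sum>\<psi>' \<in> J. P0 \<chi> \<psi> * Lambda0 \<psi> \<psi>' * P0 \<chi>' \<psi>') = 0"
      by simp
    then show ?thesis
      using E assms Omega_sign[OF m_pos] Omega_sym[of m ?E] R_sign by (auto simp: mult.commute)
  next
    case True
    have "P0 \<chi> \<psi> * Lambda0 \<psi> \<psi>' * P0 \<chi>' \<psi>'
       = (q ^ m - 1) * q ^ (b m \<chi> + b m \<chi>') * (pmat \<chi> \<psi> * cov (eta \<psi>) (eta \<psi>') * pmat \<chi>' \<psi>')"
      if \<psi>: "\<psi> \<in> J" "\<psi>' \<in> J" for \<psi> \<psi>'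
    proof -
      have "Lambda0 \<psi> \<psi>' = (q ^ m - 1) * (q ^ b m \<psi> / q ^ b m (rep0 \<psi>)) * (q ^ b m \<psi>' / q ^ b m (rep0 \<psi>'))
          * cov (eta \<psi>) (eta \<psi>')"
        using ne \<psi> cov_eta_orthogonal[OF \<psi>] by (simp add: Lambda0_def)
      then show ?thesis
        using True \<psi> by (simp add: P0_pmat power_add)
    qed
    then have "(\<Sum>\<psi> \<in> J. \<Sum>\<psi>' \<in> J. P0 \<chi> \<psi> * Lambda0 \<psi> \<psi>' * P0 \<chi>' \<psi>')
      = (q ^ m - 1) * q ^ (b m \<chi> + b m \<chi>') * tree_kernel m \<chi> \<chi>'"
      using True by (simp add: pmat_cov_pmat[symmetric] sum_distrib_left)
    then show ?thesis
      using Omega_kernel[OF m_pos] True by (simp add: J_def)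
  qed
  finally show ?thesis .
qed


lemma kappa_integer: "kappa m \<chi> \<in> integer_coeff_polys"
  by (simp add: kappa_def integer_poly_closed)

lemma tree_kernel_integer: "tree_kernel m \<chi> \<psi> \<in> integer_coeff_polys"
  by (simp add: tree_kernel_def kappa_integer integer_poly_closed)

lemma cov_integer:
  assumes "\<And>x. f x \<in> integer_coeff_polys" "\<And>x. g x \<in> integer_coeff_polys"
  shows "cov f g \<in> integer_coeff_polys"
  unfolding cov_def by (intro integer_poly_sum integer_poly_closed tree_kernel_integer assms)

lemma eta0_integer: "eta0 \<chi> x \<in> integer_coeff_polys"
  unfolding eta0_def ind_def by (intro integer_poly_closed integer_poly_sum) (auto intro: integer_poly_closed)

text \<open>Only entries between two high characters are in doubt, because of the negative exponent
  in \<open>cc\<close>. The factors \<open>D\<close> compensate it, as high characters lie in a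
  class of weight 1.\<close>

lemma Lambda0_integer:
  assumes "\<chi> \<in> Irr m" "\<psi> \<in> Irr m"
  shows "Lambda0 \<chi> \<psi> \<in> integer_coeff_polys"
proof (cases "\<chi> = sign_char m \<or> \<psi> = sign_char m \<or> rep0 \<chi> \<noteq> rep0 \<psi>")
  case True
  then show ?thesis
    by (auto simp: Lambda0_def integer_poly_closed)
next
  case False
  then have J: "\<chi> \<in> J" "\<psi> \<in> J" and rep: "rep0 \<chi> = rep0 \<psi>"
    using assms by (auto simp: J_def)
  define D where "D \<chi> = q ^ b m \<chi> / q ^ b m (rep0 \<chi>)" for \<chi>
  have D: "D \<chi> = q ^ (b m \<chi> - b m (rep0 \<chi>))" if "\<chi> \<in> J" for \<chi>
    using rep0_properties(8)[OF J_in_Irr[OF that]] by (simp add: D_def power_diff)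
  have qm: "q ^ m - 1 \<in> integer_coeff_polys"
    by (intro integer_poly_closed)
  have "D \<chi> * D \<psi> * cov (eta \<chi>) (eta \<psi>) \<in> integer_coeff_polys"
  proof (cases "high \<chi> \<and> high \<psi>")
    case True
    have high: "D \<chi> * D \<psi> * cov (eta \<chi>) (eta \<psi>) \<in> integer_coeff_polys"
      if h: "high \<chi>" "high \<psi>" and le: "b m \<psi> \<le> b m \<chi>" for \<chi> \<psi>
    proof -
      note h1 = highD[OF h(1)] and h2 = highD[OF h(2)]
      have rep: "b m (rep0 \<chi>) = 1" "b m (rep0 \<psi>) = 1"
        using h h1(3) h2(3) b_reflection by (simp_all add: rep0_def)
      have pos: "1 \<le> L"
        using smax_properties(4) smax_le_L by simp
      have b2: "2 * b m \<chi> \<le> m" "2 * b m \<psi> \<le> m"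
        using b_J h1(2) h2(2) by auto
      \<comment> \<open>The resulting exponent is nonnegative because \<open>L\<close> is at least 1
        and no b-value in \<open>J\<close> exceeds \<open>m / 2\<close>.\<close>
      have "D \<chi> * D \<psi> * cc \<chi> * q ^ (m - 2 * b m \<psi>) = q ^ (2 * L - 2 + (m - b m \<chi> - b m \<psi>))"
      proof -
        have 1: "(2 * L - 2 + (m - b m \<chi> - b m \<psi>)) + 2 + 2 * b m \<chi>
            = b m \<chi> + b m \<psi> + 2 * L + (m - 2 * b m \<psi>)"
          using pos b2 le by linarith
        have "q ^ (2 * L - 2 + (m - b m \<chi> - b m \<psi>)) * q ^ 2 * q ^ (2 * b m \<chi>)
            = q ^ b m \<chi> * q ^ b m \<psi> * q ^ (2 * L) * q ^ (m - 2 * b m \<psi>)"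
          unfolding power_add[symmetric] 1 ..
        then show ?thesis
          using h by (simp add: D_def rep cc_def power2_eq_square eq_divide_eq divide_eq_eq mult_ac)
      qed
      then have "D \<chi> * D \<psi> * cov (eta \<chi>) (eta \<psi>)
          = D \<chi> * D \<psi> * q ^ (m - 2 * b m \<chi>) - q ^ (2 * L - 2 + (m - b m \<chi> - b m \<psi>))"
        by (simp add: cov_eta_high_high[OF h le] right_diff_distrib mult.assoc)
      also have "\<dots> \<in> integer_coeff_polys"
        using D[OF h1(2)] D[OF h2(2)] by (auto intro!: integer_poly_closed)
      finally show ?thesis .
    qed
    show ?thesis
      using high[of \<chi> \<psi>] high[of \<psi> \<chi>] True cov_sym[of "eta \<chi>" "eta \<psi>"] by (metis mult.commute nat_le_linear)
  next
    case False
    have "cov (eta \<chi>) (eta \<psi>) \<in> integer_coeff_polys"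
    proof (cases "high \<chi> \<or> high \<psi>")
      case True
      then have "cov (eta \<chi>) (eta \<psi>) = 0"
        using cov_eta_high_not_high[of \<chi> \<psi>] cov_eta_high_not_high[of \<psi> \<chi>] False J cov_sym by metis
      then show ?thesis
        by (simp add: integer_poly_closed)
    next
      case False
      then show ?thesis
        by (simp add: eta_not_high cov_integer eta0_integer)
    qed
    then show ?thesis
      using D J by (auto intro!: integer_poly_closed)
  qed
  from integer_poly_closed(3)[OF qm this] show ?thesis
    using False by (simp add: Lambda0_def D_def mult.assoc)
qed

lemma P0_nonneg:
  assumes "\<chi> \<in> Irr m" "\<psi> \<in> Irr m"
  shows "P0 \<chi> \<psi> \<in> nonneg_integer_coeff_polys"
  using R_Irr(1)[OF assms(1)] by (simp add: P0_def nonneg_poly_closed)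

lemma divisible_power: "k \<le> n \<Longrightarrow> divisible_by_q_power k (q ^ n)"
proof -
  assume "k \<le> n"
  then have "q ^ n = q ^ k * to_fract (monom 1 (n - k))"
    by (simp flip: power_add q_power)
  then show ?thesis
    unfolding divisible_by_q_power_def by blast
qed

lemma P0_divisible:
  assumes "\<chi> \<in> Irr m" "\<psi> \<in> Irr m"
  shows "divisible_by_q_power (b m (rep0 \<chi>)) (P0 \<chi> \<psi>)"
proof -
  have zero: "divisible_by_q_power k 0" for k
    unfolding divisible_by_q_power_def by (intro exI[of _ 0]) simp
  have high: "b m (rep0 \<chi>) \<le> b m smax + L - b m \<chi>" if "high \<chi>"
    using high_bound[OF that] highD(3)[OF that] that b_reflection by (simp add: rep0_def)
  show ?thesis
    unfolding P0_def
    using R_Irr(2)[OF assms(1)] rep0_properties(8)[OF assms(1)] divisible_power zero high by simp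
qed

lemma green_X0: "green_functions m X0 lt0 a0 P0 Lambda0"
  unfolding green_functions_def
proof (intro ballI conjI impI)
  fix \<chi> \<psi>
  assume I: "\<chi> \<in> Irr m" "\<psi> \<in> Irr m"
  note rS = rep0_properties(1)[OF I(1)] rep0_properties(1)[OF I(2)]
  show "P0 \<chi> \<psi> \<in> rational_coeff_functions" "Lambda0 \<chi> \<psi> \<in> rational_coeff_functions"
    using P0_nonneg[OF I] Lambda0_integer[OF I] nonneg_poly_integer integer_poly_rational by blast+
  show "(\<Sum>x\<in>Irr m. \<Sum>y\<in>Irr m. P0 \<chi> x * Lambda0 x y * P0 \<psi> y) = Omega m \<chi> \<psi>"
    using I by (rule P0_Lambda0_P0)
  have E: "rep0 (sign_char m) = sign_char m"
    using rep0_properties(3) S_special(3) sign_in_Irr by blast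
  have SE: "sign_char m \<in> S"
    by (rule S_special(3))
  have repE: "rep0 \<phi> = sign_char m \<longleftrightarrow> \<phi> = sign_char m" if "\<phi> \<in> Irr m" for \<phi>
  proof (cases "\<phi> \<in> S")
    case True
    then show ?thesis
      using rep0_properties(3)[OF that] by simp
  next
    case False
    then have "rep0 \<phi> \<noteq> sign_char m" "\<phi> \<noteq> sign_char m"
      using rep0_properties(4)[OF that] SE by (auto simp: J_def)
    then show ?thesis
      by simp
  qed
  have topE: "\<not> height (rep0 \<phi>) > height (sign_char m)" if "\<phi> \<in> Irr m" for \<phi>
  proof
    assume "height (rep0 \<phi>) > height (sign_char m)"
    then have "m \<le> b m (rep0 \<phi>)" "rep0 \<phi> \<noteq> sign_char m"
      using height_mono(1)[of "sign_char m" "rep0 \<phi>"] b_sign by auto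
    moreover have "rep0 \<phi> \<in> J"
      using \<open>rep0 \<phi> \<noteq> sign_char m\<close> S_in_Irr[OF rep0_properties(1)[OF that]] by (simp add: J_def)
    ultimately show False
      using b_J[of "rep0 \<phi>"] m_pos by linarith
  qed
  show "P0 \<chi> \<psi> = 0" if "(supp X0 \<chi>, supp X0 \<psi>) \<in> lt0"
  proof -
    have h: "height (rep0 \<psi>) < height (rep0 \<chi>)"
      using that cl_lt rS by (simp add: supp_X0 I)
    have ne: "\<psi> \<noteq> sign_char m"
      using h topE[OF I(1)] E by auto
    have b_le: "b m (rep0 \<psi>) \<le> b m (rep0 \<chi>)"
      using height_mono(1)[OF h] .
    have 1: "\<not> (\<psi> \<in> S \<and> b m \<chi> < b m \<psi>)"
      using b_le rep0_properties(3)[OF I(2)] rep0_properties(8)[OF I(1)] by auto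
    \<comment> \<open>The class of \<open>chi_L\<close> is that of \<open>smax\<close>, and since
      \<open>smax\<close> has b-value at least 1, its class cannot lie above that of the reflection
      character.\<close>
    have 2: "\<not> (high \<chi> \<and> \<psi> = chi_L)"
    proof
      assume hi: "high \<chi> \<and> \<psi> = chi_L"
      then have "rep0 \<psi> = smax" "rep0 \<chi> = reflection_char m"
        using chi_L_properties(4) highD(3)[of \<chi>] by (auto simp: rep0_def[of \<chi>])
      then have "b m smax \<le> 1" "smax \<noteq> reflection_char m"
        using b_le b_reflection h by auto
      then show False
        using J_eqI[OF smax_properties(2) reflection_in_J] smax_properties(3,4) b_reflection by simp
    qed
    show ?thesis
      using h ne 1 2 by (auto simp: P0_def)
  qed
  show "P0 \<chi> \<psi> = (if \<chi> = \<psi> then q ^ a0 (supp X0 \<chi>) else 0)" if "supp X0 \<chi> = supp X0 \<psi>"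
  proof -
    have rep: "rep0 \<chi> = rep0 \<psi>"
      using that rS by (simp add: supp_X0 I cl_inj)
    have a: "a0 (supp X0 \<chi>) = b m (rep0 \<chi>)"
      using rS by (simp add: supp_X0 I a0_cl)
    show ?thesis
    proof (cases "\<psi> = sign_char m")
      case True
      then have "\<chi> = sign_char m"
        using rep repE[OF I(1)] E by simp
      then show ?thesis
        using True R_sign E a b_sign by (simp add: P0_def)
    next
      case False
      then have ne: "\<chi> \<noteq> sign_char m"
        using rep repE[OF I(2)] E by auto
      have 1: "\<not> (\<psi> \<in> S \<and> b m \<chi> < b m \<psi>)"
        using rep rep0_properties(3)[OF I(2)] rep0_properties(8)[OF I(1)] by auto
      \<comment> \<open>A common class would make \<open>smax\<close> the reflection character; then
        \<open>L\<close> is at least \<open>m div 2\<close> and no character is high.\<close>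
      have 2: "\<not> (high \<chi> \<and> \<psi> = chi_L)"
      proof
        assume hi: "high \<chi> \<and> \<psi> = chi_L"
        then have "smax = reflection_char m"
          using chi_L_properties(4) highD(3)[of \<chi>] rep by (auto simp: rep0_def[of \<chi>])
        then have "b m smax = 1"
          by (simp add: b_reflection)
        then have "m div 2 \<le> L"
          by (simp add: L_def)
        then show False
          using highD(2,4)[of \<chi>] b_J[of \<chi>] hi by auto
      qed
      show ?thesis
        using False ne 1 2 a by (auto simp: P0_def)
    qed
  qed
  show "Lambda0 \<chi> \<psi> = 0" if "supp X0 \<chi> \<noteq> supp X0 \<psi>"
    using that by (auto simp: Lambda0_def supp_X0 I)
qed

lemma springer_X0: "springer_correspondence_with_reps m S X0 lt0 a0"
  unfolding springer_correspondence_with_reps_def springer_correspondence_def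
proof (intro conjI)
  show "lusztig_shoji_datum m X0 lt0 a0"
    by (rule datum_X0)
  show img: "springer_rep m ` X0 = S"
    unfolding X0_def image_image using springer_rep_cl by simp
  show "special_chars m \<subseteq> springer_rep m ` X0"
    unfolding img using S_special by (simp add: special_chars_def)
  show "\<forall>C\<in>X0. a0 C = Min (b m ` C) \<and> (\<exists>!\<chi>. \<chi> \<in> C \<and> b m \<chi> = Min (b m ` C))"
  proof
    fix C
    assume "C \<in> X0"
    then obtain s where s: "C = cl s" "s \<in> S"
      by (auto simp: X0_def)
    have "\<exists>!\<chi>. \<chi> \<in> cl s \<and> b m \<chi> = b m s"
    proof (rule ex1I[of _ s])
      show "s \<in> cl s \<and> b m s = b m s"
        using mem_cl[OF s(2)] by simp
      show "\<psi> = s" if "\<psi> \<in> cl s \<and> b m \<psi> = b m s" for \<psi>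
        using b_cl(2)[OF s(2)] that by blast
    qed
    then show "a0 C = Min (b m ` C) \<and> (\<exists>!\<chi>. \<chi> \<in> C \<and> b m \<chi> = Min (b m ` C))"
      using s by (simp add: a0_def Min_cl)
  qed
  show "\<forall>F\<in>families m. \<forall>\<chi>\<in>F \<inter> special_chars m. \<forall>\<chi>'\<in>F - special_chars m.
      supp X0 \<chi>' = supp X0 \<chi> \<or> (supp X0 \<chi>', supp X0 \<chi>) \<in> lt0"
  proof (intro ballI)
    fix F \<chi> \<psi>
    assume F: "F \<in> families m" and \<chi>: "\<chi> \<in> F \<inter> special_chars m" and \<psi>: "\<psi> \<in> F - special_chars m"
    then have F_eq: "F = Irr m - {trivial_char m, sign_char m}"
      by (auto simp: families_def special_chars_def)
    have \<chi>_eq: "\<chi> = reflection_char m"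
      using \<chi> F_eq by (auto simp: special_chars_def)
    have \<psi>I: "\<psi> \<in> Irr m" "\<psi> \<in> J" "\<psi> \<noteq> trivial_char m" "\<psi> \<noteq> reflection_char m"
      using \<psi> F_eq by (auto simp: special_chars_def J_def)
    have r: "rep0 (reflection_char m) = reflection_char m"
      using rep0_properties(3)[OF S_in_Irr] S_special by blast
    have "b m (rep0 \<psi>) \<ge> 1"
    proof (cases "\<psi> \<in> S")
      case True
      have "b m \<psi> \<noteq> 0"
        using J_eqI[OF \<psi>I(2) trivial_in_J] b_trivial m_pos \<psi>I(3) by auto
      then show ?thesis
        using True rep0_properties(3)[OF \<psi>I(1)] by simp
    next
      case False
      then show ?thesis
        using rep0_properties(7)[OF \<psi>I(1)] by simp
    qed
    moreover have "rep0 \<psi> = reflection_char m" if "b m (rep0 \<psi>) = 1"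
    proof -
      have "rep0 \<psi> \<in> J"
        using rep0_properties(3,4)[OF \<psi>I(1)] \<psi>I(2) by metis
      then show ?thesis
        using J_eqI[OF _ reflection_in_J] that b_reflection m_ge_3 by simp
    qed
    ultimately have "rep0 \<psi> = reflection_char m \<or> height (reflection_char m) < height (rep0 \<psi>)"
      using height_mono(2)[of "reflection_char m" "rep0 \<psi>"] b_reflection by linarith
    then show "supp X0 \<psi> = supp X0 \<chi> \<or> (supp X0 \<psi>, supp X0 \<chi>) \<in> lt0"
      using cl_lt[OF rep0_properties(1)[OF \<psi>I(1)] S_special(2)]
      by (auto simp: \<chi>_eq supp_X0 \<psi>I(1) S_in_Irr S_special r)
  qed
  have "divisible_by_q_power (a0 C) (P0 \<chi> \<psi>)" if C: "C \<in> X0" "\<chi> \<in> C" "\<psi> \<in> Irr m" for C \<chi> \<psi>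
  proof -
    obtain s where s: "C = cl s" "s \<in> S"
      using C(1) by (auto simp: X0_def)
    then have "\<chi> \<in> Irr m" "rep0 \<chi> = s"
      using C(2) by (auto simp: cl_def)
    then show ?thesis
      using P0_divisible[OF _ C(3)] s by (auto simp: a0_cl)
  qed
  then show "\<exists>P \<Lambda>. green_functions m X0 lt0 a0 P \<Lambda> \<and>
        (\<forall>\<chi> \<in> Irr m. \<forall>\<chi>' \<in> Irr m. \<Lambda> \<chi> \<chi>' \<in> integer_coeff_polys \<and> P \<chi> \<chi>' \<in> nonneg_integer_coeff_polys) \<and>
        (\<forall>C \<in> X0. \<forall>\<chi> \<in> C. \<forall>\<chi>' \<in> Irr m. divisible_by_q_power (a0 C) (P \<chi> \<chi>'))"
    using green_X0 Lambda0_integer P0_nonneg by blast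
qed

end

section \<open>Maximality and uniqueness\<close>

lemma (in dihedral) springer_correspondenceE:
  assumes "springer_correspondence_with_reps m S X lt a"
  obtains P \<Lambda> where "springer m S X lt a P \<Lambda>"
proof -
  have "\<exists>P \<Lambda>. green_functions m X lt a P \<Lambda> \<and>
        (\<forall>\<chi> \<in> Irr m. \<forall>\<chi>' \<in> Irr m. \<Lambda> \<chi> \<chi>' \<in> integer_coeff_polys \<and> P \<chi> \<chi>' \<in> nonneg_integer_coeff_polys) \<and>
        (\<forall>C \<in> X. \<forall>\<chi> \<in> C. \<forall>\<chi>' \<in> Irr m. divisible_by_q_power (a C) (P \<chi> \<chi>'))"
    using assms unfolding springer_correspondence_with_reps_def springer_correspondence_def by (elim conjE)
  then obtain P \<Lambda> where P: "green_functions m X lt a P \<Lambda>"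
    "\<forall>\<chi> \<in> Irr m. \<forall>\<chi>' \<in> Irr m. \<Lambda> \<chi> \<chi>' \<in> integer_coeff_polys \<and> P \<chi> \<chi>' \<in> nonneg_integer_coeff_polys"
    "\<forall>C \<in> X. \<forall>\<chi> \<in> C. \<forall>\<chi>' \<in> Irr m. divisible_by_q_power (a C) (P \<chi> \<chi>')"
    by (elim exE conjE)
  show ?thesis
  proof (rule that[of P \<Lambda>])
    show "springer m S X lt a P \<Lambda>"
      by unfold_locales (use assms P in auto)
  qed
qed

context springer_reps
begin

text \<open>Weights suffice to compare classes: outside \<open>S\<close> the candidate
  representation has level below \<open>m / 2\<close>, where the b-value determines the character,
  so equal weights mean equal representations.\<close>

lemma rep0_compare:
  assumes "springer_correspondence_with_reps m S X lt a" "\<chi> \<in> Irr m"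
  shows "springer_rep m (supp X \<chi>) \<in> S" and "b m (springer_rep m (supp X \<chi>)) = a (supp X \<chi>)"
    and "\<chi> \<in> S \<Longrightarrow> springer_rep m (supp X \<chi>) = \<chi>"
    and "b m (rep0 \<chi>) \<le> a (supp X \<chi>)"
    and "a (supp X \<chi>) \<le> b m (rep0 \<chi>) \<Longrightarrow> springer_rep m (supp X \<chi>) = rep0 \<chi>"
proof -
  obtain P \<Lambda> where sp: "springer m S X lt a P \<Lambda>"
    using springer_correspondenceE[OF assms(1)] .
  then interpret springer m S X lt a P \<Lambda> .
  note r = rep_properties[OF assms(2), unfolded rep_def A_def]
  show 1: "springer_rep m (supp X \<chi>) \<in> S" and 2: "b m (springer_rep m (supp X \<chi>)) = a (supp X \<chi>)"
    using r by auto
  show 3: "\<chi> \<in> S \<Longrightarrow> springer_rep m (supp X \<chi>) = \<chi>"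
    using S_properties(2) by (simp add: rep_def)
  note r0 = rep0_properties[OF assms(2)]
  show 4: "b m (rep0 \<chi>) \<le> a (supp X \<chi>)"
    using rep0_le[OF sp assms(2)] r0(3) 2 3 by (cases "\<chi> \<in> S") auto
  assume le: "a (supp X \<chi>) \<le> b m (rep0 \<chi>)"
  show "springer_rep m (supp X \<chi>) = rep0 \<chi>"
  proof (cases "\<chi> \<in> S")
    case True
    then show ?thesis
      using 3 r0(3) by simp
  next
    case False
    have eq: "b m (springer_rep m (supp X \<chi>)) = b m (rep0 \<chi>)"
      using 2 4 le by simp
    moreover have "springer_rep m (supp X \<chi>) \<noteq> sign_char m"
      using eq r0(6)[OF False] b_sign m_pos by auto
    ultimately show ?thesis
      using J_eqI[OF _ r0(4)[OF False]] r0(6)[OF False] S_in_Irr[OF 1] by (simp add: J_def)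
  qed
qed

lemma maximal_X0: "maximal_springer_correspondence m S X0 lt0 a0"
  unfolding maximal_springer_correspondence_def
proof (intro conjI allI impI ballI springer_X0)
  fix X lt a \<chi>
  assume sp: "springer_correspondence_with_reps m S X lt a" and \<chi>: "\<chi> \<in> Irr m"
  note c = rep0_compare[OF sp \<chi>] and r = rep0_properties(1)[OF \<chi>]
  let ?s = "springer_rep m (supp X \<chi>)"
  have "?s = rep0 \<chi> \<or> height (rep0 \<chi>) < height ?s"
    using c(2,4,5) height_mono(2)[of "rep0 \<chi>" ?s] by linarith
  then have "cl ?s = supp X0 \<chi> \<or> (cl ?s, supp X0 \<chi>) \<in> lt0"
    using cl_lt[OF c(1) r] by (auto simp: supp_X0 \<chi>)
  then show "\<exists>C\<in>X0. springer_rep m C = springer_rep m (supp X \<chi>) \<and> (C = supp X0 \<chi> \<or> (C, supp X0 \<chi>) \<in> lt0)"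
    using c(1) springer_rep_cl[OF c(1)] by (auto simp: X0_def)
qed

text \<open>The candidate is itself a competitor, so maximality bounds the weights of
  \<open>X\<close> by those of \<open>X0\<close>, while \<open>rep0_compare\<close> gives the
  reverse inequality. Equal Springer representations for all characters then give equal
  partitions.\<close>

lemma maximal_unique:
  assumes "maximal_springer_correspondence m S X lt a"
  shows "X = X0"
proof -
  have sp: "springer_correspondence_with_reps m S X lt a"
    using assms by (simp add: maximal_springer_correspondence_def)
  then obtain P \<Lambda> where "springer m S X lt a P \<Lambda>"
    by (rule springer_correspondenceE)
  then interpret springer m S X lt a P \<Lambda> .
  have rep_eq: "rep \<chi> = rep0 \<chi>" if \<chi>: "\<chi> \<in> Irr m" for \<chi>
  proof -
    \<comment> \<open>The class of \<open>X\<close> with which the class of \<open>\<chi>\<close> in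
      \<open>X0\<close> is identified; maximality of \<open>X\<close> places it at or below the
      class of \<open>\<chi>\<close> in \<open>X\<close>.\<close>
    obtain C where C: "C \<in> X" "springer_rep m C = springer_rep m (supp X0 \<chi>)"
      "C = supp X \<chi> \<or> (C, supp X \<chi>) \<in> lt"
      using assms springer_X0 \<chi> unfolding maximal_springer_correspondence_def by blast
    have "springer_rep m (supp X0 \<chi>) = rep0 \<chi>"
      using rep0_properties(1)[OF \<chi>] by (simp add: supp_X0 \<chi> springer_rep_cl)
    then have "a C = b m (rep0 \<chi>)"
      using springer_rep_unique(2)[OF C(1)] C(2) by simp
    moreover have "a (supp X \<chi>) \<le> a C"
      using C(3) datum by (auto simp: lusztig_shoji_datum_def)
    ultimately show ?thesis
      using rep0_compare(5)[OF sp \<chi>] by (simp add: rep_def)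
  qed
  have supp_cl: "supp X \<chi> = cl (rep0 \<chi>)" if \<chi>: "\<chi> \<in> Irr m" for \<chi>
  proof (intro equalityI subsetI)
    fix \<psi>
    assume \<psi>: "\<psi> \<in> supp X \<chi>"
    then have I: "\<psi> \<in> Irr m"
      using class_subset[OF supp_in[OF \<chi>]] by blast
    then have "supp X \<psi> = supp X \<chi>"
      using supp_eq[OF _ supp_in[OF \<chi>] \<psi>] by blast
    then show "\<psi> \<in> cl (rep0 \<chi>)"
      using rep_eq[OF I] rep_eq[OF \<chi>] I by (simp add: cl_def rep_def)
  next
    fix \<psi>
    assume "\<psi> \<in> cl (rep0 \<chi>)"
    then have I: "\<psi> \<in> Irr m" "rep \<psi> = rep \<chi>"
      using rep_eq \<chi> by (auto simp: cl_def)
    then have "supp X \<psi> = supp X \<chi>"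
      using rep_properties(4)[OF I(1)] rep_properties(4)[OF \<chi>] by simp
    then show "\<psi> \<in> supp X \<chi>"
      using in_supp[OF I(1)] by simp
  qed
  have "X = supp X ` Irr m"
  proof (intro equalityI subsetI)
    fix C
    assume C: "C \<in> X"
    then obtain \<chi> where "\<chi> \<in> C"
      using part by (metis all_not_in_conv partition_onD3)
    then show "C \<in> supp X ` Irr m"
      using class_subset[OF C] supp_eq[OF _ C] by blast
  qed (use supp_in in auto)
  also have "\<dots> = cl ` (rep0 ` Irr m)"
    using supp_cl by (auto simp: image_image)
  also have "rep0 ` Irr m = S"
  proof (intro equalityI subsetI)
    fix s
    assume "s \<in> S"
    then show "s \<in> rep0 ` Irr m"
      using rep0_properties(3)[OF S_in_Irr] S_in_Irr by (metis image_eqI)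
  qed (use rep0_properties(1) in auto)
  finally show ?thesis
    by (simp add: X0_def)
qed

end

theorem theorem3p4:
  fixes m :: nat and S :: "(complex mat \<Rightarrow> complex) set"
  assumes "m \<ge> 3"
    and "S \<subseteq> Irr m"
    and "trivial_char m \<in> S" and "reflection_char m \<in> S" and "sign_char m \<in> S"
  shows "\<exists>!X. \<exists>lt a. maximal_springer_correspondence m S X lt a"
proof -
  interpret springer_reps m S
    using assms by unfold_locales auto
  show ?thesis
    using maximal_X0 maximal_unique by blast
qed

end
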